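(* Let $I$ be a finite set. The dual algebra $\mathsf{F}^*(I)$ of the coalgebra $\mathsf{F}(I)$ of oriented forests on $I$ is isomorphic, as a $\mathbb{Z}$-graded unital algebra, to the algebra $\mathsf{M}(I)$, which is the graded-commutative associative unital algebra over $\mathbb{Z}$ presented by generators $\Omega_{i,j}$ of degree $1$ for $i\neq j$ in $I$ and relations $$\Omega_{i,k}\,\Omega_{j,k}=0$$ for $i,j,k$ pairwise different in $I$, and $$\Omega_{i_0,i_1}\Omega_{i_1,i_2}\cdots\Omega_{i_n,i_0}=0$$ for $n\geq 1$ and pairwise different $i_0,\dots,i_n$ in $I$.
   Context: A forest on $I$ is an acyclic graph with vertex set $I$ in which each connected component has a distinguished vertex called its root; so it is a partition $\pi(F)$ of $I$ together with a rooted tree on each part. Vertices that are not roots are called nodes, and $N(F)$ is the set of nodes of $F$. A forest is seen as a poset: $i\leq_F j$ if $i,j$ are in the same tree of $F$ and $i$ is on the path from $j$ to the root of this tree. For forests $F',F$ on $I$, $F'\subseteq F$ means: $\pi(F')$ is finer than (or equal to) $\pi(F)$, and each tree of $F'$ is induced by $F$ as a poset (on each part of $\pi(F')$ the order $\leq_{F'}$ is the restriction of $\leq_F$). For $N\subseteq N(F)$, put $\gamma(F,N)=\sum_{F'\subseteq F,\ N(F')=N}F'$. Everything is in the category of $\mathbb{Z}$-graded abelian groups with Koszul sign rules. Commutative algebras are graded-commutative, with elements of odd degree having square zero (so $\mathsf{M}(I)$ is a quotient of the exterior algebra over $\mathbb{Z}$ on the $\Omega_{i,j}$). An orientation $o$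 of a forest $F$ is a maximal exterior product of the set $N(F)\sqcup\{R_F\}$ (the wedge product of all its elements in some order, with the usual signs), where $R_F$ is an auxiliary element. $\mathsf{F}(I)$ is the free $\mathbb{Z}$-module on oriented forests $o\otimes F$ on $I$ modulo $(-o)\otimes F=-(o\otimes F)$, graded by $\deg(o\otimes F)=\#N(F)$. Its coproduct is $$\Delta(o\otimes F)=\sum_{N(F)=N_1\sqcup N_2}(o_1\otimes\gamma(F,N_1))\otimes(o_2\otimes\gamma(F,N_2)),$$ the sum being over ordered pairs $(N_1,N_2)$, where the orientations satisfy $o=o_1\wedge r\wedge o_2$ modulo $R=R_1\wedge r\wedge R_2$ (here $R,R_1,R_2$ are the auxiliary elements for $o,o_1,o_2$; equivalently, if $o=\omega\wedge R$ and $o_a=\omega_a\wedge R_a$ with $\omega_a$ a maximal exterior product of $N_a$, then $\omega=\omega_1\wedge\omega_2$). With this $\Delta$, $\mathsf{F}(I)$ is a cocommutative coassociative coalgebra, with counit the projection to the degree-zero component (which is $\mathbb{Z}$, spanned by the forest without nodes, oriented by $R$). $\mathsf{F}^*(I)$ is the $\mathbb{Z}$-dual of $\mathsf{F}(I)$, whose degree $n$ component is the dual of the degree $n$ component of $\mathsf{F}(I)$, with product dual to $\Delta$ (Koszul sign rule) and unit dual to the counit. *)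

theory Defs
  imports "HOL-Algebra.Free_Abelian_Groups" "HOL-Algebra.QuotRing" "HOL-Combinatorics.Permutations"
begin

section \<open>Forests\<close>

text \<open>
  The ground set \<open>I\<close> is not stored in the forest; it is a parameter of all notions below.
  An edge is a two-element set of vertices.
\<close>

datatype 'a forest = Forest (edges: "'a set set") (roots: "'a set")

definition is_path :: "'a set set \<Rightarrow> 'a \<Rightarrow> 'a list \<Rightarrow> 'a \<Rightarrow> bool" where
  "is_path E u p v \<longleftrightarrow>
     p \<noteq> [] \<and> hd p = u \<and> last p = v \<and> distinct p \<and> successively (\<lambda>x y. {x, y} \<in> E) p"

definition is_cycle :: "'a set set \<Rightarrow> 'a list \<Rightarrow> bool" where
  "is_cycle E p \<longleftrightarrow>
     3 \<le> length p \<and> distinct p \<and> successively (\<lambda>x y. {x, y} \<in> E) p \<and> {last p, hd p} \<in> E"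

definition is_connected :: "'a set set \<Rightarrow> 'a \<Rightarrow> 'a \<Rightarrow> bool" where
  "is_connected E u v \<longleftrightarrow> (\<exists>p. is_path E u p v)"

definition is_forest :: "'a set \<Rightarrow> 'a forest \<Rightarrow> bool" where
  "is_forest I F \<longleftrightarrow>
     edges F \<subseteq> {{x, y} | x y. x \<in> I \<and> y \<in> I \<and> x \<noteq> y} \<and>
     (\<nexists>p. is_cycle (edges F) p) \<and>
     roots F \<subseteq> I \<and>
     (\<forall>x\<in>I. \<exists>!r. r \<in> roots F \<and> is_connected (edges F) x r)"

definition nodes :: "'a set \<Rightarrow> 'a forest \<Rightarrow> 'a set" where
  "nodes I F = I - roots F"

definition parts :: "'a set \<Rightarrow> 'a forest \<Rightarrow> 'a set set" where
  "parts I F = I // {(x, y) \<in> I \<times> I. is_connected (edges F) x y}"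

definition forest_le :: "'a forest \<Rightarrow> 'a \<Rightarrow> 'a \<Rightarrow> bool" where
  "forest_le F i j \<longleftrightarrow> (\<exists>r\<in>roots F. \<exists>p. is_path (edges F) j p r \<and> i \<in> set p)"

definition subforest :: "'a set \<Rightarrow> 'a forest \<Rightarrow> 'a forest \<Rightarrow> bool" where
  "subforest I F' F \<longleftrightarrow>
     (\<forall>P'\<in>parts I F'. \<exists>P\<in>parts I F. P' \<subseteq> P) \<and>
     (\<forall>P'\<in>parts I F'. \<forall>i\<in>P'. \<forall>j\<in>P'. forest_le F' i j \<longleftrightarrow> forest_le F i j)"

definition gamma :: "'a set \<Rightarrow> 'a forest \<Rightarrow> 'a set \<Rightarrow> 'a forest \<Rightarrow>\<^sub>0 int" where
  "gamma I F N = (\<Sum>F' | is_forest I F' \<and> subforest I F' F \<and> nodes I F' = N. frag_of F')"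


section \<open>Orientations\<close>

text \<open>
  Exterior products of elements are realised as alternating tensors: \<open>x1 \<and> \<dots> \<and> xn\<close> is the sum of
  \<open>sign \<sigma>\<close> times the word \<open>x\<sigma>1 \<dots> x\<sigma>n\<close>, an element of the free module on words, written as its
  coefficient function. The auxiliary element \<open>R\<close> of a forest is \<open>None\<close>, and a node \<open>x\<close> is \<open>Some x\<close>.
\<close>

type_synonym 'b ext = "'b list \<Rightarrow> int"

definition wedge :: "'b list \<Rightarrow> 'b ext" where
  "wedge xs = (\<lambda>ys. \<Sum>\<sigma> | \<sigma> permutes {..<length xs} \<and> permute_list \<sigma> xs = ys. sign \<sigma>)"

definition maximal_products :: "'b set \<Rightarrow> 'b ext set" where
  "maximal_products S =
     {o'. \<exists>w. distinct w \<and> set w = S \<and> (o' = wedge w \<or> o' = - wedge w)}"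

definition orientations :: "'a set \<Rightarrow> 'a forest \<Rightarrow> 'a option ext set" where
  "orientations I F = maximal_products (insert None (Some ` nodes I F))"

type_synonym 'a oforest = "'a option ext \<times> 'a forest"

definition oriented_forests :: "'a set \<Rightarrow> 'a oforest set" where
  "oriented_forests I = {(o', F). is_forest I F \<and> o' \<in> orientations I F}"

text \<open>
  \<open>o = \<omega>1 \<and> \<omega>2 \<and> R\<close>, \<open>o1 = \<omega>1 \<and> R1\<close> and \<open>o2 = \<omega>2 \<and> R2\<close>, where \<open>\<omega>1\<close> and \<open>\<omega>2\<close> are the maximal exterior
  products \<open>\<plusminus>w1\<close> and \<open>\<plusminus>w2\<close> of \<open>N1\<close> and \<open>N2\<close>.
\<close>

definition splits_orientation ::
  "'a set \<Rightarrow> 'a set \<Rightarrow> 'a option ext \<Rightarrow> 'a option ext \<times> 'a option ext \<Rightarrow> bool" where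
  "splits_orientation N1 N2 o' = (\<lambda>(o1, o2).
     \<exists>w1 w2. \<exists>s1\<in>{1, -1}. \<exists>s2\<in>{1, -1}.
       distinct w1 \<and> set w1 = N1 \<and> distinct w2 \<and> set w2 = N2 \<and>
       o1 = (\<lambda>z. s1 * wedge (map Some w1 @ [None]) z) \<and>
       o2 = (\<lambda>z. s2 * wedge (map Some w2 @ [None]) z) \<and>
       o' = (\<lambda>z. s1 * s2 * wedge (map Some w1 @ map Some w2 @ [None]) z))"


section \<open>Abelian groups by generators and relations, tensor products\<close>

definition relators :: "'b set \<Rightarrow> ('b \<Rightarrow>\<^sub>0 int) set \<Rightarrow> ('b \<Rightarrow>\<^sub>0 int) set" where
  "relators S Rel = generate (free_Abelian_group S) Rel"

definition presented_group :: "'b set \<Rightarrow> ('b \<Rightarrow>\<^sub>0 int) set \<Rightarrow> ('b \<Rightarrow>\<^sub>0 int) set monoid" where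
  "presented_group S Rel = free_Abelian_group S Mod relators S Rel"

definition presented_class :: "'b set \<Rightarrow> ('b \<Rightarrow>\<^sub>0 int) set \<Rightarrow> ('b \<Rightarrow>\<^sub>0 int) \<Rightarrow> ('b \<Rightarrow>\<^sub>0 int) set" where
  "presented_class S Rel c = relators S Rel #>\<^bsub>free_Abelian_group S\<^esub> c"

definition bilinear_rels ::
  "('g, 'm) monoid_scheme \<Rightarrow> ('h, 'n) monoid_scheme \<Rightarrow> ('g \<times> 'h \<Rightarrow>\<^sub>0 int) set" where
  "bilinear_rels G H =
     {frag_of (x \<otimes>\<^bsub>G\<^esub> x', y) - frag_of (x, y) - frag_of (x', y) | x x' y.
        x \<in> carrier G \<and> x' \<in> carrier G \<and> y \<in> carrier H} \<union>
     {frag_of (x, y \<otimes>\<^bsub>H\<^esub> y') - frag_of (x, y) - frag_of (x, y') | x y y'.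
        x \<in> carrier G \<and> y \<in> carrier H \<and> y' \<in> carrier H}"

definition tensor_group ::
  "('g, 'm) monoid_scheme \<Rightarrow> ('h, 'n) monoid_scheme \<Rightarrow> ('g \<times> 'h \<Rightarrow>\<^sub>0 int) set monoid" where
  "tensor_group G H = presented_group (carrier G \<times> carrier H) (bilinear_rels G H)"

definition tensor_class ::
  "('g, 'm) monoid_scheme \<Rightarrow> ('h, 'n) monoid_scheme \<Rightarrow> ('g \<times> 'h \<Rightarrow>\<^sub>0 int) \<Rightarrow> ('g \<times> 'h \<Rightarrow>\<^sub>0 int) set" where
  "tensor_class G H = presented_class (carrier G \<times> carrier H) (bilinear_rels G H)"


section \<open>The coalgebra of oriented forests\<close>

definition orientation_rels :: "'a set \<Rightarrow> ('a oforest \<Rightarrow>\<^sub>0 int) set" where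
  "orientation_rels I =
     {frag_of (- o', F) + frag_of (o', F) | o' F. (o', F) \<in> oriented_forests I}"

definition forest_module :: "'a set \<Rightarrow> ('a oforest \<Rightarrow>\<^sub>0 int) set monoid" where
  "forest_module I = presented_group (oriented_forests I) (orientation_rels I)"

definition forest_class :: "'a set \<Rightarrow> ('a oforest \<Rightarrow>\<^sub>0 int) \<Rightarrow> ('a oforest \<Rightarrow>\<^sub>0 int) set" where
  "forest_class I = presented_class (oriented_forests I) (orientation_rels I)"

definition oforest_degree :: "'a set \<Rightarrow> 'a oforest \<Rightarrow> int" where
  "oforest_degree I x = int (card (nodes I (snd x)))"

definition forest_component :: "'a set \<Rightarrow> int \<Rightarrow> ('a oforest \<Rightarrow>\<^sub>0 int) set set" where
  "forest_component I n =
     {forest_class I c | c. Poly_Mapping.keys c \<subseteq> {x \<in> oriented_forests I. oforest_degree I x = n}}"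

text \<open>
  Maps out of a quotient are written by taking the common value \<open>the_elem\<close> on
  all representatives of a coset.
\<close>

definition forest_proj ::
  "'a set \<Rightarrow> int \<Rightarrow> ('a oforest \<Rightarrow>\<^sub>0 int) set \<Rightarrow> ('a oforest \<Rightarrow>\<^sub>0 int) set" where
  "forest_proj I n X =
     the_elem ((\<lambda>c. forest_class I
       (frag_extend (\<lambda>x. if oforest_degree I x = n then frag_of x else 0) c)) ` X)"

definition orient :: "'a set \<Rightarrow> 'a option ext \<Rightarrow> ('a forest \<Rightarrow>\<^sub>0 int) \<Rightarrow> ('a oforest \<Rightarrow>\<^sub>0 int) set" where
  "orient I o' g = forest_class I (frag_extend (\<lambda>F. frag_of (o', F)) g)"

text \<open>
  The pair \<open>(o1, o2)\<close> is determined only up to a simultaneous change of sign, which does not affect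
  the class of the summand in the tensor product; hence the choice.
\<close>

definition coproduct_gen ::
  "'a set \<Rightarrow> 'a oforest \<Rightarrow> ('a oforest \<Rightarrow>\<^sub>0 int) set \<times> ('a oforest \<Rightarrow>\<^sub>0 int) set \<Rightarrow>\<^sub>0 int" where
  "coproduct_gen I = (\<lambda>(o', F).
     \<Sum>(N1, N2) | N1 \<union> N2 = nodes I F \<and> N1 \<inter> N2 = {}.
       let (o1, o2) = (SOME q. splits_orientation N1 N2 o' q)
       in frag_of (orient I o1 (gamma I F N1), orient I o2 (gamma I F N2)))"

definition coproduct ::
  "'a set \<Rightarrow> ('a oforest \<Rightarrow>\<^sub>0 int) set
     \<Rightarrow> (('a oforest \<Rightarrow>\<^sub>0 int) set \<times> ('a oforest \<Rightarrow>\<^sub>0 int) set \<Rightarrow>\<^sub>0 int) set" where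
  "coproduct I X =
     the_elem ((\<lambda>c. tensor_class (forest_module I) (forest_module I)
       (frag_extend (coproduct_gen I) c)) ` X)"

definition counit :: "'a set \<Rightarrow> ('a oforest \<Rightarrow>\<^sub>0 int) set \<Rightarrow> int" where
  "counit I X = (THE z. forest_proj I 0 X =
     forest_class I (frag_cmul z (frag_of (wedge [None], Forest {} I))))"


section \<open>The dual algebra\<close>

text \<open>
  Koszul sign rule: \<open>(\<phi> \<otimes> \<psi>)(x \<otimes> y) = (-1)^(deg \<psi> * deg x) * \<phi> x * \<psi> y\<close> for homogeneous \<open>\<psi>\<close> and \<open>x\<close>. Below,
  \<open>x\<close> is decomposed into its components of degree \<open>m\<close>, and \<open>\<psi>\<close> into its components
  of degree \<open>n\<close>, which are the composites of \<open>\<psi>\<close> with the projections to degree \<open>n\<close>. Degrees of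
  forests are at most \<open>card I\<close>.
\<close>

definition koszul_pairing ::
  "'a set \<Rightarrow> (('a oforest \<Rightarrow>\<^sub>0 int) set \<Rightarrow> int) \<Rightarrow> (('a oforest \<Rightarrow>\<^sub>0 int) set \<Rightarrow> int)
     \<Rightarrow> ('a oforest \<Rightarrow>\<^sub>0 int) set \<Rightarrow> ('a oforest \<Rightarrow>\<^sub>0 int) set \<Rightarrow> int" where
  "koszul_pairing I \<phi> \<psi> x y =
     (\<Sum>m\<le>card I. \<Sum>n\<le>card I.
        (-1) ^ (n * m) * \<phi> (forest_proj I (int m) x) * \<psi> (forest_proj I (int n) y))"

definition koszul_tensor ::
  "'a set \<Rightarrow> (('a oforest \<Rightarrow>\<^sub>0 int) set \<Rightarrow> int) \<Rightarrow> (('a oforest \<Rightarrow>\<^sub>0 int) set \<Rightarrow> int)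
     \<Rightarrow> (('a oforest \<Rightarrow>\<^sub>0 int) set \<times> ('a oforest \<Rightarrow>\<^sub>0 int) set \<Rightarrow>\<^sub>0 int) set \<Rightarrow> int" where
  "koszul_tensor I \<phi> \<psi> T =
     the_elem ((\<lambda>c. \<Sum>(x, y)\<in>Poly_Mapping.keys c.
       Poly_Mapping.lookup c (x, y) * koszul_pairing I \<phi> \<psi> x y) ` T)"

definition dual_algebra :: "'a set \<Rightarrow> (('a oforest \<Rightarrow>\<^sub>0 int) set \<Rightarrow> int) ring" where
  "dual_algebra I =
     \<lparr>carrier = hom (forest_module I) integer_group \<inter> extensional (carrier (forest_module I)),
      monoid.mult = (\<lambda>\<phi> \<psi>. \<lambda>X\<in>carrier (forest_module I). koszul_tensor I \<phi> \<psi> (coproduct I X)),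
      one = (\<lambda>X\<in>carrier (forest_module I). counit I X),
      zero = (\<lambda>X\<in>carrier (forest_module I). 0),
      add = (\<lambda>\<phi> \<psi>. \<lambda>X\<in>carrier (forest_module I). \<phi> X + \<psi> X)\<rparr>"

text \<open>A functional on the degree \<open>n\<close> component is identified with its extension by \<open>0\<close>.\<close>

definition dual_component :: "'a set \<Rightarrow> int \<Rightarrow> (('a oforest \<Rightarrow>\<^sub>0 int) set \<Rightarrow> int) set" where
  "dual_component I n =
     {\<phi> \<in> carrier (dual_algebra I). \<forall>m. m \<noteq> n \<longrightarrow> (\<forall>X\<in>forest_component I m. \<phi> X = 0)}"


section \<open>Graded-commutative algebras by generators of degree one and relations\<close>

definition word_mult :: "('g list \<Rightarrow>\<^sub>0 int) \<Rightarrow> ('g list \<Rightarrow>\<^sub>0 int) \<Rightarrow> ('g list \<Rightarrow>\<^sub>0 int)" where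
  "word_mult p q = frag_extend (\<lambda>u. frag_extend (\<lambda>v. frag_of (u @ v)) q) p"

definition free_algebra :: "'g set \<Rightarrow> ('g list \<Rightarrow>\<^sub>0 int) ring" where
  "free_algebra S =
     \<lparr>carrier = {p. Poly_Mapping.keys p \<subseteq> lists S},
      monoid.mult = word_mult, one = frag_of [], zero = 0, add = (+)\<rparr>"

definition free_component :: "'g set \<Rightarrow> int \<Rightarrow> ('g list \<Rightarrow>\<^sub>0 int) set" where
  "free_component S n = {p. Poly_Mapping.keys p \<subseteq> {w \<in> lists S. int (length w) = n}}"

definition graded_comm_rels :: "'g set \<Rightarrow> ('g list \<Rightarrow>\<^sub>0 int) set" where
  "graded_comm_rels S =
     {word_mult p q - frag_cmul ((-1) ^ (m * n)) (word_mult q p) | p q m n.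
        p \<in> free_component S (int m) \<and> q \<in> free_component S (int n)} \<union>
     {word_mult p p | p m. odd m \<and> p \<in> free_component S (int m)}"

definition presented_ideal :: "'g set \<Rightarrow> ('g list \<Rightarrow>\<^sub>0 int) set \<Rightarrow> ('g list \<Rightarrow>\<^sub>0 int) set" where
  "presented_ideal S Rel = Idl\<^bsub>free_algebra S\<^esub> (graded_comm_rels S \<union> Rel)"

definition presented_algebra :: "'g set \<Rightarrow> ('g list \<Rightarrow>\<^sub>0 int) set \<Rightarrow> ('g list \<Rightarrow>\<^sub>0 int) set ring" where
  "presented_algebra S Rel = free_algebra S Quot presented_ideal S Rel"

definition presented_component ::
  "'g set \<Rightarrow> ('g list \<Rightarrow>\<^sub>0 int) set \<Rightarrow> int \<Rightarrow> ('g list \<Rightarrow>\<^sub>0 int) set set" where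
  "presented_component S Rel n =
     (\<lambda>p. presented_ideal S Rel +>\<^bsub>free_algebra S\<^esub> p) ` free_component S n"


section \<open>The algebra \<open>M(I)\<close>\<close>

text \<open>The generator \<open>\<Omega>\<^sub>i\<^sub>j\<close> is the pair \<open>(i, j)\<close>, and monomials are words in such pairs.\<close>

definition Omega_gens :: "'a set \<Rightarrow> ('a \<times> 'a) set" where
  "Omega_gens I = {(i, j). i \<in> I \<and> j \<in> I \<and> i \<noteq> j}"

definition Omega_rels :: "'a set \<Rightarrow> (('a \<times> 'a) list \<Rightarrow>\<^sub>0 int) set" where
  "Omega_rels I =
     {frag_of [(i, k), (j, k)] | i j k.
        i \<in> I \<and> j \<in> I \<and> k \<in> I \<and> i \<noteq> j \<and> i \<noteq> k \<and> j \<noteq> k} \<union>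
     {frag_of (zip p (rotate1 p)) | p. set p \<subseteq> I \<and> distinct p \<and> 2 \<le> length p}"

definition Omega_algebra :: "'a set \<Rightarrow> (('a \<times> 'a) list \<Rightarrow>\<^sub>0 int) set ring" where
  "Omega_algebra I = presented_algebra (Omega_gens I) (Omega_rels I)"

definition Omega_component :: "'a set \<Rightarrow> int \<Rightarrow> (('a \<times> 'a) list \<Rightarrow>\<^sub>0 int) set set" where
  "Omega_component I = presented_component (Omega_gens I) (Omega_rels I)"

end

theory Submission
  imports Defs
begin

text \<open>
  A forest is the same as an acyclic set of arcs (parent, child) in which every child has one parent,
  and a nonzero monomial of \<open>M(I)\<close> is such a set as well, up to sign. Send a word
  \<open>\<Omega>\<^sub>i\<^sub>1\<^sub>k\<^sub>1 \<cdots> \<Omega>\<^sub>i\<^sub>n\<^sub>k\<^sub>n\<close> to the functional whose value on \<open>o \<otimes> F\<close> is \<open>\<plusminus>1\<close> if the \<open>k\<^sub>a\<close> are distinct and are the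
  nodes of \<open>F\<close> and \<open>i\<^sub>a\<close> lies strictly below \<open>k\<^sub>a\<close> in \<open>F\<close> for all \<open>a\<close>, and \<open>0\<close> otherwise. This is multiplicative
  because, given a choice of some \<open>i < k\<close> in \<open>F\<close> for every \<open>k \<in> N\<close>, exactly one summand \<open>F'\<close> of
  \<open>\<gamma>(F, N)\<close> satisfies all these inequalities. It kills the relations, since the order of \<open>F\<close> has no
  cycles. On monomials of forests it is unitriangular for the inclusion of orders, hence bijective
  modulo the relations.
\<close>

section \<open>Forests as arc sets\<close>

text \<open>Words are read through the order of \<open>F\<close> and not through its edges because
  functionals dual to single forests do not multiply to one another. On three vertices, \<Omega>_12
  \<Omega>_13 must be nonzero on every forest with root 1, namely on the star and on the two chains,
  and these are the forests whose order contains 1 < 2 and 1 < 3. The map leaves the presented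
  algebra, since there only relations have to be checked; the isomorphism sought is the inverse of
  the induced map. Associativity and the other ring axioms of the dual are not checked on forests:
  they are transported along the surjective multiplicative map from the free algebra. Inclusion of
  forests enters the algebra through two facts only: a subforest has a smaller order, and exactly
  one subforest with given nodes lies above a given choice of one smaller vertex for each node.
  Signs are handled by evaluating an orientation at an enumeration of the nodes followed by
  \<open>None\<close>. In degree n the factor (-1)^(n(n-1)/2) absorbs the Koszul sign of the dual
  product.\<close>

lemma rtrancl_imp_distinct_path:
  assumes "(x, y) \<in> R\<^sup>*"
  shows "\<exists>p. p \<noteq> [] \<and> distinct p \<and> hd p = x \<and> last p = y \<and> successively (\<lambda>a b. (a, b) \<in> R) p"
  using assms
proof (induction rule: converse_rtrancl_induct)
  case base
  show ?case by (rule exI[of _ "[y]"]) simp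
next
  case (step x x')
  then obtain p where p: "p \<noteq> []" "distinct p" "hd p = x'" "last p = y"
    "successively (\<lambda>a b. (a, b) \<in> R) p" by blast
  show ?case
  proof (cases "x \<in> set p")
    case True
    \<comment> \<open>If the path already visits \<open>x\<close>, its part from \<open>x\<close> on
      is a path by itself.\<close>
    then obtain us vs where "p = us @ x # vs" by (meson split_list)
    with p show ?thesis
      by (intro exI[of _ "x # vs"]) (auto simp: successively_append_iff)
  next
    case False
    with p step(1) show ?thesis
      by (intro exI[of _ "x # p"]) (auto simp: successively_Cons)
  qed
qed

lemma successively_imp_rtrancl:
  assumes "p \<noteq> []" "successively (\<lambda>a b. (a, b) \<in> R) p" "z \<in> set p"
  shows "(hd p, z) \<in> R\<^sup>* \<and> (z, last p) \<in> R\<^sup>*"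
  using assms
proof (induction p arbitrary: z)
  case (Cons a p)
  show ?case
  proof (cases "p = []")
    case False
    with Cons have *: "(a, hd p) \<in> R" "successively (\<lambda>a b. (a, b) \<in> R) p"
      by (auto simp: successively_Cons)
    show ?thesis
      using Cons.IH[OF False *(2)] *(1) Cons.prems(3) False
      by (auto intro: converse_rtrancl_into_rtrancl dest!: hd_in_set)
  qed (use Cons in auto)
qed simp

abbreviation adj :: "'a set set \<Rightarrow> ('a \<times> 'a) set" where
  "adj E \<equiv> {(x, y). {x, y} \<in> E}"

text \<open>Trades repetition-free vertex lists for a closure, where composing and reversing
  connections is immediate.\<close>

lemma is_connected_iff_rtrancl: "is_connected E u v \<longleftrightarrow> (u, v) \<in> (adj E)\<^sup>*"
proof
  assume "is_connected E u v"
  then obtain p where "is_path E u p v" by (auto simp: is_connected_def)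
  then show "(u, v) \<in> (adj E)\<^sup>*"
    using successively_imp_rtrancl[of p "adj E" "last p"] by (auto simp: is_path_def)
next
  assume "(u, v) \<in> (adj E)\<^sup>*"
  from rtrancl_imp_distinct_path[OF this] show "is_connected E u v"
    by (auto simp: is_connected_def is_path_def)
qed

lemma is_connected_sym: "is_connected E u v \<Longrightarrow> is_connected E v u"
proof -
  have "sym (adj E)" by (auto simp: sym_def insert_commute)
  then show "is_connected E u v \<Longrightarrow> is_connected E v u"
    unfolding is_connected_iff_rtrancl by (meson sym_rtrancl symE)
qed

lemma is_connected_refl: "is_connected E u u"
  by (simp add: is_connected_iff_rtrancl)

section \<open>Arc sets, the forests they define and their orders\<close>

definition forest_of :: "'a set \<Rightarrow> ('a \<times> 'a) set \<Rightarrow> 'a forest" where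
  "forest_of I S = Forest ((\<lambda>(i, k). {i, k}) ` S) (I - snd ` S)"

text \<open>Here \<open>inj_on snd S\<close> says that no vertex has two parents. The strict order
  of the forest will be \<open>S\<^sup>+\<close>, with ancestors on the left.\<close>

locale arborescence =
  fixes I :: "'a set" and S :: "('a \<times> 'a) set"
  assumes fin: "finite I" and sub: "S \<subseteq> I \<times> I" and inj: "inj_on snd S" and acyc: "acyclic S"
begin

lemma finite_arcs: "finite S"
  using fin sub by (meson finite_SigmaI finite_subset)

lemma parent_unique: "(x, z) \<in> S \<Longrightarrow> (y, z) \<in> S \<Longrightarrow> x = y"
  using inj_onD[OF inj, of "(x, z)" "(y, z)"] by simp

lemma irrefl: "(x, x) \<notin> S\<^sup>+"
  using acyc by (auto simp: acyclic_def)

lemma trancl_sub: "S\<^sup>+ \<subseteq> I \<times> I"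
  using sub by (rule trancl_subset_Sigma)

lemma subset_gens: "S \<subseteq> Omega_gens I"
  using sub irrefl by (auto simp: Omega_gens_def)

text \<open>The converse of \<open>S\<close> is a partial function, so climbing from
  \<open>z\<close> meets all its ancestors one after the other.\<close>

lemma down_chain:
  assumes "(x, z) \<in> S\<^sup>*" "(y, z) \<in> S\<^sup>*"
  shows "(x, y) \<in> S\<^sup>* \<or> (y, x) \<in> S\<^sup>*"
proof -
  have "single_valued (S\<inverse>)" using parent_unique by (auto simp: single_valued_def)
  from single_valued_confluent[OF this] assms show ?thesis
    by (auto simp: rtrancl_converse)
qed

lemma root_rtrancl: "r \<notin> snd ` S \<Longrightarrow> (x, r) \<in> S\<^sup>* \<Longrightarrow> x = r"
  by (metis imageI rtranclE snd_conv)

lemma root_exists: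
  assumes "x \<in> I"
  obtains r where "r \<in> I - snd ` S" "(r, x) \<in> S\<^sup>*"
proof -
  have "wf S" using finite_arcs acyc by (rule finite_acyclic_wf)
  then have "x \<in> I \<longrightarrow> (\<exists>r. r \<in> I - snd ` S \<and> (r, x) \<in> S\<^sup>*)"
  proof (induction x rule: wf_induct_rule)
    case (less x)
    show ?case
    proof (cases "x \<in> snd ` S")
      case True
      then obtain y where "(y, x) \<in> S" by auto
      with less sub show ?thesis by (meson SigmaD1 rtrancl.rtrancl_into_rtrancl subsetD)
    qed auto
  qed
  with assms that show ?thesis by blast
qed

lemma root_unique:
  assumes "r \<notin> snd ` S" "r' \<notin> snd ` S" "(r, x) \<in> S\<^sup>*" "(r', x) \<in> S\<^sup>*"
  shows "r = r'"
  using down_chain[OF assms(3,4)] root_rtrancl assms(1,2) by metis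

lemma edge_iff: "{x, y} \<in> edges (forest_of I S) \<longleftrightarrow> (x, y) \<in> S \<or> (y, x) \<in> S"
  by (force simp: forest_of_def doubleton_eq_iff)

lemma roots_forest_of: "roots (forest_of I S) = I - snd ` S"
  by (simp add: forest_of_def)

lemma nodes_forest_of: "nodes I (forest_of I S) = snd ` S"
  using sub by (auto simp: nodes_def roots_forest_of)

text \<open>An undirected walk cannot leave the descendants of \<open>r\<close>: a step to a child
  prolongs the chain from \<open>r\<close>, and a step to the parent removes its last arc, which
  exists because \<open>r\<close> is nobody's child and which is the right one because parents are
  unique.\<close>

lemma root_of_connected:
  assumes "r \<notin> snd ` S" "(x, y) \<in> (adj (edges (forest_of I S)))\<^sup>*" "(r, x) \<in> S\<^sup>*"
  shows "(r, y) \<in> S\<^sup>*"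
  using assms(2,3)
proof (induction rule: rtrancl_induct)
  case (step y z)
  then have "(y, z) \<in> S \<or> (z, y) \<in> S" by (auto simp: edge_iff)
  then show ?case
  proof
    assume "(z, y) \<in> S"
    moreover have "(r, y) \<in> S\<^sup>*" using step by blast
    ultimately show ?thesis
      using assms(1) parent_unique by (metis imageI rtranclE snd_conv)
  qed (use step in \<open>meson rtrancl.rtrancl_into_rtrancl\<close>)
qed

lemma rtrancl_connected: "(x, y) \<in> S\<^sup>* \<Longrightarrow> is_connected (edges (forest_of I S)) x y"
proof -
  have "S \<subseteq> adj (edges (forest_of I S))" by (auto simp: edge_iff)
  from rtrancl_mono[OF this] show "(x, y) \<in> S\<^sup>* \<Longrightarrow> is_connected (edges (forest_of I S)) x y"
    by (auto simp: is_connected_iff_rtrancl)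
qed

lemma connected_root_iff:
  assumes "r \<in> I - snd ` S"
  shows "is_connected (edges (forest_of I S)) x r \<longleftrightarrow> (r, x) \<in> S\<^sup>*"
proof
  assume "is_connected (edges (forest_of I S)) x r"
  then have "(r, x) \<in> (adj (edges (forest_of I S)))\<^sup>*"
    using is_connected_sym is_connected_iff_rtrancl by metis
  with root_of_connected[of r r x] assms show "(r, x) \<in> S\<^sup>*" by auto
qed (use rtrancl_connected is_connected_sym in metis)

lemma is_forest_forest_of: "is_forest I (forest_of I S)"
  unfolding is_forest_def
proof (intro conjI ballI)
  show "edges (forest_of I S) \<subseteq> {{x, y} |x y. x \<in> I \<and> y \<in> I \<and> x \<noteq> y}"
    using subset_gens by (fastforce simp: forest_of_def Omega_gens_def)
  show "roots (forest_of I S) \<subseteq> I" by (auto simp: forest_of_def)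
  show "\<exists>!r. r \<in> roots (forest_of I S) \<and> is_connected (edges (forest_of I S)) x r"
    if "x \<in> I" for x
  proof -
    obtain r where r: "r \<in> I - snd ` S" "(r, x) \<in> S\<^sup>*" using root_exists[OF \<open>x \<in> I\<close>] .
    show ?thesis
      unfolding roots_forest_of
    proof (rule ex1I)
      show "r \<in> I - snd ` S \<and> is_connected (edges (forest_of I S)) x r"
        using r connected_root_iff by blast
      show "r' = r" if "r' \<in> I - snd ` S \<and> is_connected (edges (forest_of I S)) x r'" for r'
        using that r connected_root_iff root_unique by blast
    qed
  qed
  show "\<nexists>p. is_cycle (edges (forest_of I S)) p"
  proof
    assume "\<exists>p. is_cycle (edges (forest_of I S)) p"
    then obtain p where p: "3 \<le> length p" "distinct p" "{last p, hd p} \<in> edges (forest_of I S)"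
      "successively (\<lambda>x y. {x, y} \<in> edges (forest_of I S)) p"
      by (auto simp: is_cycle_def)
    \<comment> \<open>On a cycle choose a vertex \<open>v\<close> none of whose children lies on the
      cycle. Both its neighbours on the cycle are then its parent, hence equal.\<close>
    have "wf (S\<inverse>)" using finite_arcs acyc by (rule finite_acyclic_wf_converse)
    moreover have "hd p \<in> set p" using p by (intro hd_in_set) auto
    ultimately obtain v where v: "v \<in> set p" "\<And>y. (v, y) \<in> S \<Longrightarrow> y \<notin> set p"
      by (meson wfE_min converseI)
    then obtain as bs where ab: "p = as @ v # bs" by (meson split_list)
    \<comment> \<open>Rotated to start at \<open>v\<close>, the cycle has the two neighbours of
      \<open>v\<close> as first and last entry of the rest.\<close>
    define q where "q = v # bs @ as"
    have q: "distinct q" "set q = set p" "3 \<le> length q" using p ab by (auto simp: q_def)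
    have adjq: "{v, hd (bs @ as)} \<in> edges (forest_of I S)"
      "{v, last (bs @ as)} \<in> edges (forest_of I S)"
      using p ab q(3)
      by (auto simp: q_def successively_append_iff successively_Cons insert_commute
          hd_append last_append split: if_splits)
    obtain a c where ac: "bs @ as = a # c" "c \<noteq> []" using q(3) unfolding q_def
      by (cases "bs @ as") (auto, fastforce)
    have "last (bs @ as) \<in> set p" "hd (bs @ as) \<in> set p"
      using q(2) ac unfolding q_def by (metis last_in_set hd_in_set list.discI list.set_intros(2))+
    then have "(hd (bs @ as), v) \<in> S" "(last (bs @ as), v) \<in> S"
      using adjq v by (auto simp: edge_iff)
    then have "hd (bs @ as) = last (bs @ as)" by (rule parent_unique)
    with ac q(1) show False unfolding q_def by (auto dest: last_in_set)
  qed
qed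

text \<open>Suppose the first step went from a parent \<open>a\<close> to its child
  \<open>b\<close>. The remaining path climbs from \<open>b\<close> to its parent, which is
  \<open>a\<close> again, against distinctness; if nothing remains, \<open>b\<close> is the end of
  the path and has no parent.\<close>

lemma path_to_root_descends:
  assumes "successively (\<lambda>x y. {x, y} \<in> edges (forest_of I S)) p" "distinct p" "p \<noteq> []"
    "last p \<notin> snd ` S"
  shows "successively (\<lambda>x y. (y, x) \<in> S) p"
  using assms
proof (induction p)
  case (Cons a p)
  show ?case
  proof (cases p)
    case (Cons b q)
    have ih: "successively (\<lambda>x y. (y, x) \<in> S) p" using Cons.IH Cons.prems Cons by auto
    have "(a, b) \<in> S \<or> (b, a) \<in> S" using Cons.prems Cons by (auto simp: edge_iff)
    moreover have "(a, b) \<notin> S"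
    proof
      assume ab: "(a, b) \<in> S"
      show False
      proof (cases q)
        case Nil
        with Cons.prems Cons ab show False by (auto simp: image_iff)
      next
        fix c q' assume "q = c # q'"
        with Cons ih ab have "c = a" by (auto dest: parent_unique)
        with \<open>q = c # q'\<close> Cons Cons.prems show False by auto
      qed
    qed
    ultimately show ?thesis using ih Cons by auto
  qed simp
qed simp

lemma forest_le_iff:
  assumes "j \<in> I"
  shows "forest_le (forest_of I S) i j \<longleftrightarrow> (i, j) \<in> S\<^sup>*"
proof
  assume "forest_le (forest_of I S) i j"
  then obtain r p where p: "r \<in> I - snd ` S" "is_path (edges (forest_of I S)) j p r" "i \<in> set p"
    by (auto simp: forest_le_def roots_forest_of)
  then have "successively (\<lambda>x y. (y, x) \<in> S) p"
    by (intro path_to_root_descends) (auto simp: is_path_def)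
  then have "(j, i) \<in> (S\<inverse>)\<^sup>*"
    using successively_imp_rtrancl[of p "S\<inverse>" i] p by (auto simp: is_path_def)
  then show "(i, j) \<in> S\<^sup>*" by (simp add: rtrancl_converse)
next
  assume ij: "(i, j) \<in> S\<^sup>*"
  then have "i \<in> I" using assms sub by (metis converse_rtranclE mem_Sigma_iff subsetD)
  then obtain r where r: "r \<in> I - snd ` S" "(r, i) \<in> S\<^sup>*" using root_exists by blast
  obtain p where p: "p \<noteq> []" "distinct p" "hd p = j" "last p = r"
    "successively (\<lambda>a b. (a, b) \<in> S\<inverse>) p"
    using rtrancl_imp_distinct_path[of j r "S\<inverse>"] r(2) ij rtrancl_trans[of r i S j]
    unfolding rtrancl_converse by blast
  have path: "is_path (edges (forest_of I S)) j p r"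
    unfolding is_path_def using p by (auto simp: edge_iff elim!: successively_mono)
  have "i \<in> set p"
  proof -
    \<comment> \<open>With each vertex other than its end \<open>r\<close>, the path contains the
      next one, which is the only parent; so it contains all the ancestors that matter.\<close>
    have closed: "x \<in> set p" if "(x, z) \<in> S\<^sup>*" "(r, x) \<in> S\<^sup>*" "z \<in> set p" for x z
      using that
    proof (induction rule: rtrancl_induct)
      case (step y z)
      show ?case
      proof (cases "z = r")
        case True
        with step r have "(y, z) \<in> S" "z \<notin> snd ` S" by auto
        then show ?thesis by force
      next
        case False
        with step.prems p obtain us w vs where "p = us @ z # w # vs"
          by (metis append_is_Nil_conv last_snoc list.exhaust split_list)
        with p(5) have "(w, z) \<in> S" by (auto simp: successively_append_iff)
        with step.hyps have "w = y" using parent_unique by blast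
        with \<open>p = us @ z # w # vs\<close> step show ?thesis by auto
      qed
    qed
    then show ?thesis using closed[OF ij r(2)] p by (metis hd_in_set)
  qed
  with r path show "forest_le (forest_of I S) i j"
    by (auto simp: forest_le_def roots_forest_of)
qed

text \<open>If x is the parent of y, a vertex strictly between x and y would be an ancestor of y,
  hence x or an ancestor of x, which closes a cycle. So the arcs are the covering pairs of the
  order, and the order determines them.\<close>

lemma covering: "S = S\<^sup>+ - S\<^sup>+ O S\<^sup>+"
proof (intro equalityI subsetI)
  fix a assume "a \<in> S"
  then obtain x y where a: "a = (x, y)" "(x, y) \<in> S" by (cases a) auto
  have "(z, y) \<notin> S\<^sup>+" if "(x, z) \<in> S\<^sup>+" for z
  proof
    assume "(z, y) \<in> S\<^sup>+"
    then obtain w where "(z, w) \<in> S\<^sup>*" "(w, y) \<in> S" by (meson tranclD2)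
    with a parent_unique have "(z, x) \<in> S\<^sup>*" by blast
    with that irrefl show False by (meson trancl_rtrancl_trancl)
  qed
  with a show "a \<in> S\<^sup>+ - S\<^sup>+ O S\<^sup>+" by auto
next
  fix a assume *: "a \<in> S\<^sup>+ - S\<^sup>+ O S\<^sup>+"
  then obtain x y where a: "a = (x, y)" "(x, y) \<in> S\<^sup>+" by (cases a) auto
  from a(2) show "a \<in> S" using * a(1) by cases auto
qed

end

lemma arborescence_eqI:
  assumes "arborescence I S" "arborescence I' T" "S\<^sup>+ = T\<^sup>+"
  shows "S = T"
  using arborescence.covering[OF assms(1)] arborescence.covering[OF assms(2)] assms(3) by simp

text \<open>
  The parent of a node is its successor on a path to the root; two different candidates would close
  up to a cycle through the node.
\<close>

lemma forest_of_surj: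
  assumes "finite I" "is_forest I F"
  obtains S where "arborescence I S" "F = forest_of I S"
proof -
  define E where "E = edges F"
  define S where "S = {(i, k). \<exists>r\<in>roots F. \<exists>p. is_path E k (k # i # p) r}"
  have EI: "x \<in> I \<and> y \<in> I \<and> x \<noteq> y" if "{x, y} \<in> E" for x y
  proof -
    from that assms(2) have "{x, y} \<in> {{x, y} | x y. x \<in> I \<and> y \<in> I \<and> x \<noteq> y}"
      by (auto simp: is_forest_def E_def)
    then show ?thesis by (auto simp: doubleton_eq_iff)
  qed
  have nocycle: "\<not> is_cycle E p" for p
    using assms(2) by (auto simp: is_forest_def E_def)
  have rootsI: "roots F \<subseteq> I" using assms(2) by (auto simp: is_forest_def)
  have root_ex: "\<exists>r\<in>roots F. is_connected E x r" if "x \<in> I" for x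
    using that assms(2) by (auto simp: is_forest_def E_def)
  have root_uniq: "r = r'" if "r \<in> roots F" "r' \<in> roots F" "is_connected E x r" "is_connected E x r'" "x \<in> I"
    for r r' x using that assms(2) by (auto simp: is_forest_def E_def)
  have S_edge: "{i, k} \<in> E" if "(i, k) \<in> S" for i k
    using that by (auto simp: S_def is_path_def insert_commute)
  have no_parent: "(i, r) \<notin> S" if "r \<in> roots F" for i r
  proof
    assume "(i, r) \<in> S"
    then obtain r' p where p: "r' \<in> roots F" "is_path E r (r # i # p) r'" by (auto simp: S_def)
    then have "is_connected E r r'" by (auto simp: is_connected_def)
    with root_uniq[of r r' r] that rootsI p(1) is_connected_refl[of E r] have "r = r'" by blast
    with p show False by (auto simp: is_path_def dest!: last_in_set split: if_splits)
  qed
  have parent_uniq: "i = i'" if ik: "(i, k) \<in> S" "(i', k) \<in> S" for i i' k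
  proof (rule ccontr)
    assume ne: "i \<noteq> i'"
    obtain r p where p: "r \<in> roots F" "is_path E k (k # i # p) r" using ik(1) unfolding S_def by blast
    obtain r' p' where p': "r' \<in> roots F" "is_path E k (k # i' # p') r'"
      using ik(2) unfolding S_def by blast
    have "k \<in> I" using EI S_edge ik by blast
    with root_uniq[of r r' k] p p' have rr: "r' = r" by (auto simp: is_connected_def)
    \<comment> \<open>Adjacency with \<open>k\<close> deleted. Both candidates \<open>i\<close> and
      \<open>i'\<close> reach \<open>r\<close> inside it, so they are joined by a path that avoids
      \<open>k\<close>.\<close>
    define R where "R = {(x, y). {x, y} \<in> E \<and> x \<noteq> k \<and> y \<noteq> k}"
    have "sym R" by (auto simp: R_def sym_def insert_commute)
    have reach: "(j, r) \<in> R\<^sup>*" if "is_path E k (k # j # q) r" for j q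
    proof -
      have "successively (\<lambda>x y. {x, y} \<in> E) (j # q)" "k \<notin> set (j # q)" "last (j # q) = r"
        using that by (auto simp: is_path_def)
      then have "successively (\<lambda>x y. (x, y) \<in> R) (j # q)"
        by (auto simp: R_def elim!: successively_mono)
      from successively_imp_rtrancl[OF _ this, of r] show ?thesis
        using \<open>last (j # q) = r\<close> by (auto dest: last_in_set)
    qed
    have "(i, i') \<in> R\<^sup>*"
      using reach[OF p(2)] reach[of i' p'] p'(2) rr \<open>sym R\<close>
      by (meson rtrancl_trans symE sym_rtrancl)
    from rtrancl_imp_distinct_path[OF this] obtain q
      where q: "q \<noteq> []" "distinct q" "hd q = i" "last q = i'" "successively (\<lambda>a b. (a, b) \<in> R) q"
      by blast
    have "i \<noteq> k" "i' \<noteq> k" using p p' by (auto simp: is_path_def)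
    have "k \<notin> set q"
    proof
      assume "k \<in> set q"
      from successively_imp_rtrancl[OF q(1,5) this] q(3) have "(i, k) \<in> R\<^sup>*" by simp
      then show False using \<open>i \<noteq> k\<close> by cases (auto simp: R_def)
    qed
    have "2 \<le> length q" using q ne by (cases q; cases "tl q") auto
    have "successively (\<lambda>x y. {x, y} \<in> E) q" using q(5) by (auto simp: R_def elim!: successively_mono)
    then have "is_cycle E (k # q)"
      using \<open>k \<notin> set q\<close> \<open>2 \<le> length q\<close> q S_edge[OF ik(1)] S_edge[OF ik(2)]
      by (auto simp: is_cycle_def successively_Cons insert_commute)
    with nocycle show False by blast
  qed
  have descend: "(r, x) \<in> S\<^sup>*" if "is_path E x p r" "r \<in> roots F" for x p r
    using that
  proof (induction p arbitrary: x)
    case (Cons a p)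
    show ?case
    proof (cases p)
      case (Cons b q)
      with Cons.prems have *: "is_path E b p r" "a = x" by (auto simp: is_path_def)
      have "is_path E x (x # b # q) r" using Cons.prems Cons *(2) by simp
      with Cons.prems(2) have "(b, x) \<in> S" unfolding S_def by blast
      with Cons.IH[OF *(1)] Cons.prems show ?thesis by (meson rtrancl.rtrancl_into_rtrancl)
    qed (use Cons.prems in \<open>auto simp: is_path_def\<close>)
  qed (auto simp: is_path_def)
  have root_above: "\<exists>r\<in>roots F. (r, x) \<in> S\<^sup>*" if "x \<in> I" for x
    using root_ex[OF that] descend by (auto simp: is_connected_def)
  \<comment> \<open>A root has no parent and hence lies on no cycle. The property passes from parent
    to child: a cycle through a child ends with the arc from its only parent, so it passes through
    that parent too. Every vertex descends from a root.\<close>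
  have "acyclic S"
    unfolding acyclic_def
  proof (intro allI notI)
    fix x assume xx: "(x, x) \<in> S\<^sup>+"
    then obtain y where "(y, x) \<in> S" by (meson tranclD2)
    with S_edge EI have "x \<in> I" by blast
    then obtain r where "r \<in> roots F" "(r, x) \<in> S\<^sup>*" using root_above by blast
    from this(2) have "(x, x) \<notin> S\<^sup>+"
    proof (induction rule: rtrancl_induct)
      case base
      show ?case using no_parent[OF \<open>r \<in> roots F\<close>] by (meson tranclD2)
    next
      case (step y z)
      show ?case
      proof
        assume "(z, z) \<in> S\<^sup>+"
        then obtain w where "(z, w) \<in> S\<^sup>*" "(w, z) \<in> S" by (meson tranclD2)
        with parent_uniq step.hyps have "(z, y) \<in> S\<^sup>*" by blast
        with step show False by (meson rtrancl_into_trancl2)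
      qed
    qed
    with xx show False by blast
  qed
  have sub: "S \<subseteq> I \<times> I" using S_edge EI by auto
  have arb: "arborescence I S"
    using assms(1) sub \<open>acyclic S\<close> parent_uniq by unfold_locales (auto simp: inj_on_def)
  have "roots F = I - snd ` S"
  proof (intro equalityI subsetI)
    fix x assume "x \<in> I - snd ` S"
    moreover from this obtain r where "r \<in> roots F" "(r, x) \<in> S\<^sup>*" using root_above by blast
    ultimately show "x \<in> roots F" using arborescence.root_rtrancl[OF arb] by blast
  qed (use rootsI no_parent in force)
  moreover have "edges F = (\<lambda>(i, k). {i, k}) ` S"
  proof (intro equalityI subsetI)
    fix e assume e: "e \<in> edges F"
    moreover from this have "e \<in> {{x, y} | x y. x \<in> I \<and> y \<in> I \<and> x \<noteq> y}"
      using assms(2) by (auto simp: is_forest_def)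
    ultimately obtain x y where xy: "e = {x, y}" "x \<noteq> y" "x \<in> I" by auto
    obtain r p where p: "r \<in> roots F" "is_path E x p r" using root_ex[OF xy(3)] by (auto simp: is_connected_def)
    have exy: "{x, y} \<in> E" "{y, x} \<in> E" using e xy by (auto simp: E_def insert_commute)
    \<comment> \<open>If the path from \<open>x\<close> to the root avoids \<open>y\<close>, putting
      \<open>y\<close> in front makes \<open>x\<close> the parent of \<open>y\<close>. Otherwise the
      edge is a shortcut from \<open>x\<close> to the rest of the path after \<open>y\<close>, which
      makes \<open>y\<close> the parent of \<open>x\<close>.\<close>
    have "(x, y) \<in> S \<or> (y, x) \<in> S"
    proof (cases "y \<in> set p")
      case False
      obtain q where "p = x # q" using p by (cases p) (auto simp: is_path_def)
      with False p exy have "is_path E y (y # x # q) r" by (auto simp: is_path_def)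
      with p show ?thesis by (auto simp: S_def)
    next
      case True
      then obtain us vs where uv: "p = us @ y # vs" by (meson split_list)
      with p xy(2) have "us \<noteq> []" "hd us = x" by (auto simp: is_path_def hd_append split: if_splits)
      then have "x \<in> set us" by force
      with uv p exy have "is_path E x (x # y # vs) r"
        by (auto simp: is_path_def successively_append_iff)
      with p show ?thesis by (auto simp: S_def)
    qed
    with xy show "e \<in> (\<lambda>(i, k). {i, k}) ` S" by (force simp: insert_commute)
  qed (use S_edge in \<open>auto simp: E_def\<close>)
  ultimately have "F = forest_of I S" by (cases F) (simp add: forest_of_def)
  with arb that show ?thesis by blast
qed

lemma forests_eq_image:
  assumes "finite I"
  shows "{F. is_forest I F} = forest_of I ` {S. arborescence I S}"
proof (intro equalityI subsetI)
  fix F assume "F \<in> {F. is_forest I F}"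
  with forest_of_surj[OF assms, of F] show "F \<in> forest_of I ` {S. arborescence I S}" by auto
qed (auto intro: arborescence.is_forest_forest_of)

lemma finite_arborescences: "finite I \<Longrightarrow> finite {S. arborescence I S}"
  by (rule finite_subset[of _ "Pow (I \<times> I)"]) (auto dest: arborescence.sub)

lemma finite_forests: "finite I \<Longrightarrow> finite {F. is_forest I F}"
  by (simp add: forests_eq_image finite_arborescences)

section \<open>Inclusion of forests in terms of arcs, and subforests with prescribed
  inequalities\<close>

lemma trancl_subset_trancl: "T \<subseteq> S\<^sup>+ \<Longrightarrow> T\<^sup>+ \<subseteq> S\<^sup>+"
  using trancl_mono_subset[of T "S\<^sup>+"] trancl_id[OF trans_trancl, of S] by simp

lemma rtrancl_subset_of_trancl: "T \<subseteq> S\<^sup>+ \<Longrightarrow> T\<^sup>* \<subseteq> S\<^sup>*"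
  using trancl_subset_trancl[of T S] by (metis rtrancl_trancl_reflcl sup_mono order_refl)

text \<open>Two vertices are in one tree of \<open>T\<close> when they descend from a common root
  \<open>r\<close>. The inclusion \<open>T \<subseteq> S\<^sup>+\<close> carries both the refinement
  of partitions and one half of the comparison of orders; the second condition is the other half,
  tree by tree.\<close>

lemma subforest_forest_of_iff:
  assumes "arborescence I S" "arborescence I T"
  shows "subforest I (forest_of I T) (forest_of I S) \<longleftrightarrow>
    T \<subseteq> S\<^sup>+ \<and> (\<forall>r x y. r \<in> I - snd ` T \<longrightarrow> (r, x) \<in> T\<^sup>* \<longrightarrow> (r, y) \<in> T\<^sup>* \<longrightarrow> (x, y) \<in> S\<^sup>* \<longrightarrow> (x, y) \<in> T\<^sup>*)"
    (is "?l \<longleftrightarrow> ?r")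
proof -
  interpret S: arborescence I S by fact
  interpret T: arborescence I T by fact
  let ?conn = "\<lambda>S. is_connected (edges (forest_of I S))"
  have parts: "parts I (forest_of I T) = {{y \<in> I. ?conn T x y} | x. x \<in> I}"
    "parts I (forest_of I S) = {{y \<in> I. ?conn S x y} | x. x \<in> I}"
    by (auto simp: parts_def quotient_def)
  have part_le: "?conn S x y" if "T \<subseteq> S\<^sup>+" "?conn T x y" for x y
  proof -
    have *: "S\<^sup>+ \<subseteq> (adj (edges (forest_of I S)))\<^sup>*"
      using S.rtrancl_connected trancl_into_rtrancl by (fastforce simp: is_connected_iff_rtrancl)
    have "adj (edges (forest_of I T)) \<subseteq> (adj (edges (forest_of I S)))\<^sup>*"
    proof
      fix a assume "a \<in> adj (edges (forest_of I T))"
      then obtain u v where a: "a = (u, v)" "(u, v) \<in> T \<or> (v, u) \<in> T" by (auto simp: T.edge_iff)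
      with * that have "(u, v) \<in> (adj (edges (forest_of I S)))\<^sup>* \<or> (v, u) \<in> (adj (edges (forest_of I S)))\<^sup>*"
        by blast
      with a show "a \<in> (adj (edges (forest_of I S)))\<^sup>*"
        using is_connected_sym by (metis is_connected_iff_rtrancl)
    qed
    with that(2) show ?thesis unfolding is_connected_iff_rtrancl
      using rtrancl_subset_rtrancl by blast
  qed
  show ?thesis
  proof
    assume l: ?l
    then have le: "(i, j) \<in> T\<^sup>* \<longleftrightarrow> (i, j) \<in> S\<^sup>*" if "x \<in> I" "i \<in> I" "j \<in> I" "?conn T x i" "?conn T x j" for x i j
    proof -
      let ?P = "{y \<in> I. ?conn T x y}"
      have "?P \<in> parts I (forest_of I T)" "i \<in> ?P" "j \<in> ?P" using that by (auto simp: parts)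
      with l have "forest_le (forest_of I T) i j \<longleftrightarrow> forest_le (forest_of I S) i j"
        unfolding subforest_def by (meson bspec)
      with S.forest_le_iff[OF \<open>j \<in> I\<close>, of i] T.forest_le_iff[OF \<open>j \<in> I\<close>, of i]
      show ?thesis by simp
    qed
    show ?r
    proof (intro conjI allI impI)
      show "T \<subseteq> S\<^sup>+"
      proof
        fix a assume a: "a \<in> T"
        then obtain x y where xy: "a = (x, y)" "(x, y) \<in> T" "x \<noteq> y" using T.irrefl by (cases a) auto
        then have "x \<in> I" "y \<in> I" using T.sub by auto
        with xy le[of x x y] have "(x, y) \<in> S\<^sup>*"
          using T.rtrancl_connected is_connected_refl by blast
        with xy show "a \<in> S\<^sup>+" by (metis rtranclD)
      qed
      fix r x y assume *: "r \<in> I - snd ` T" "(r, x) \<in> T\<^sup>*" "(r, y) \<in> T\<^sup>*" "(x, y) \<in> S\<^sup>*"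
      have "x \<in> I" "y \<in> I"
        using *(1) rtranclD[OF *(2)] rtranclD[OF *(3)] T.trancl_sub by auto
      with * le[of r x y] T.rtrancl_connected[of r] show "(x, y) \<in> T\<^sup>*" by auto
    qed
  next
    assume r: ?r
    have TS: "T\<^sup>* \<subseteq> S\<^sup>*" using r rtrancl_subset_of_trancl by blast
    have le: "(i, j) \<in> T\<^sup>* \<longleftrightarrow> (i, j) \<in> S\<^sup>*" if "x \<in> I" "i \<in> I" "j \<in> I" "?conn T x i" "?conn T x j" for x i j
    proof -
      obtain q where q: "q \<in> I - snd ` T" "(q, x) \<in> T\<^sup>*" using T.root_exists[OF \<open>x \<in> I\<close>] .
      have "(q, i) \<in> T\<^sup>*" "(q, j) \<in> T\<^sup>*"
        using T.root_of_connected[of q x] q that by (auto simp: is_connected_iff_rtrancl)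
      with q(1) TS conjunct2[OF r, rule_format, of q i j] show ?thesis by auto
    qed
    have "\<exists>P\<in>parts I (forest_of I S). P' \<subseteq> P" if "P' \<in> parts I (forest_of I T)" for P'
    proof -
      from that obtain x where "x \<in> I" "P' = {y \<in> I. ?conn T x y}" unfolding parts by blast
      with part_le[OF conjunct1[OF r]] show ?thesis
        unfolding parts by (intro bexI[of _ "{y \<in> I. ?conn S x y}"]) auto
    qed
    then show ?l
      unfolding subforest_def
    proof (intro conjI ballI)
      fix P' i j assume P': "P' \<in> parts I (forest_of I T)" "i \<in> P'" "j \<in> P'"
      then obtain x where x: "x \<in> I" "P' = {y \<in> I. ?conn T x y}" unfolding parts by blast
      with P' le[of x i j] have "j \<in> I" "(i, j) \<in> T\<^sup>* \<longleftrightarrow> (i, j) \<in> S\<^sup>*" by auto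
      then show "forest_le (forest_of I T) i j \<longleftrightarrow> forest_le (forest_of I S) i j"
        by (simp add: S.forest_le_iff T.forest_le_iff)
    qed blast
  qed
qed

text \<open>The arcs are the covering pairs of \<open>D\<close>. Finiteness lets them generate
  \<open>D\<close>, by induction on the size of the open interval; two elements covered by the same
  one are comparable by the chain hypothesis, hence equal.\<close>

lemma chain_order_arborescence:
  assumes "finite I" "D \<subseteq> I \<times> I" "trans D" "irrefl D"
    and chain: "\<And>x y z. (x, z) \<in> D \<Longrightarrow> (y, z) \<in> D \<Longrightarrow> x = y \<or> (x, y) \<in> D \<or> (y, x) \<in> D"
  obtains S where "arborescence I S" "S\<^sup>+ = D"
proof -
  define S where "S = D - D O D"
  have fin: "finite {z. (x, z) \<in> D \<and> (z, y) \<in> D}" for x y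
    by (rule finite_subset[OF _ assms(1)]) (use assms(2) in auto)
  have "S\<^sup>+ \<subseteq> D"
    using trancl_mono_subset[of S D] trancl_id[OF assms(3)] by (auto simp: S_def)
  have "(x, y) \<in> S\<^sup>+" if "(x, y) \<in> D" for x y
    using that
  proof (induction "card {z. (x, z) \<in> D \<and> (z, y) \<in> D}" arbitrary: x y rule: less_induct)
    case less
    show ?case
    proof (cases "(x, y) \<in> S")
      case False
      then obtain w where w: "(x, w) \<in> D" "(w, y) \<in> D" using less.prems by (auto simp: S_def)
      have "{z. (x, z) \<in> D \<and> (z, w) \<in> D} \<subset> {z. (x, z) \<in> D \<and> (z, y) \<in> D}"
        "{z. (w, z) \<in> D \<and> (z, y) \<in> D} \<subset> {z. (x, z) \<in> D \<and> (z, y) \<in> D}"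
        using w assms(3,4) by (auto simp: irrefl_def dest: transD)
      then have "(x, w) \<in> S\<^sup>+" "(w, y) \<in> S\<^sup>+"
        using less.hyps w psubset_card_mono[OF fin] by presburger+
      then show ?thesis by (rule trancl_trans)
    qed auto
  qed
  with \<open>S\<^sup>+ \<subseteq> D\<close> have SD: "S\<^sup>+ = D" by auto
  moreover have "arborescence I S"
  proof
    show "finite I" "S \<subseteq> I \<times> I" using assms by (auto simp: S_def)
    have "x = y" if "(x, z) \<in> S" "(y, z) \<in> S" for x y z
      using that chain[of x z y] unfolding S_def by blast
    then show "inj_on snd S" by (auto simp: inj_on_def)
    show "acyclic S" using SD assms(4) by (auto simp: acyclic_def irrefl_def)
  qed
  ultimately show ?thesis using that by blast
qed

text \<open>
  Both \<open>T\<close> and \<open>U\<close> have one root in every tree and the same set of roots, hence they have the same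
  partition; this determines the order of \<open>T\<close> as a restriction of that of \<open>S\<close>.
\<close>

lemma ex1_subforest_above:
  assumes "arborescence I S" "U \<subseteq> S\<^sup>+" "inj_on snd U"
  shows "\<exists>!T. arborescence I T \<and> subforest I (forest_of I T) (forest_of I S) \<and> snd ` T = snd ` U \<and> U \<subseteq> T\<^sup>+"
proof -
  interpret S: arborescence I S by fact
  interpret U: arborescence I U
  proof
    show "finite I" "inj_on snd U" by (fact S.fin, fact assms(3))
    show "U \<subseteq> I \<times> I" using assms(2) S.trancl_sub by blast
    show "acyclic U" using assms(2) S.acyc trancl_subset_trancl by (meson acyclic_def subsetD)
  qed
  have US: "U\<^sup>+ \<subseteq> S\<^sup>+" using assms(2) by (rule trancl_subset_trancl)
  \<comment> \<open>The order that \<open>T\<close> is forced to have: two vertices are comparable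
    in \<open>T\<close> if they are so in \<open>S\<close> and lie in one tree of
    \<open>U\<close>.\<close>
  define D where "D = {(x, y) \<in> S\<^sup>+. \<exists>r. r \<in> I - snd ` U \<and> (r, x) \<in> U\<^sup>* \<and> (r, y) \<in> U\<^sup>*}"
  have UD: "U \<subseteq> D"
  proof
    fix a assume "a \<in> U"
    then obtain x y where a: "a = (x, y)" "(x, y) \<in> U" by (cases a) auto
    then obtain r where "r \<in> I - snd ` U" "(r, x) \<in> U\<^sup>*" using U.root_exists U.sub by blast
    with a assms(2) show "a \<in> D" by (auto simp: D_def intro: rtrancl.rtrancl_into_rtrancl)
  qed
  have Dchain: "x = y \<or> (x, y) \<in> D \<or> (y, x) \<in> D" if "(x, z) \<in> D" "(y, z) \<in> D" for x y z
  proof -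
    from that obtain r r' where r: "r \<in> I - snd ` U" "(r, x) \<in> U\<^sup>*" "(r, z) \<in> U\<^sup>*"
      "r' \<in> I - snd ` U" "(r', y) \<in> U\<^sup>*" "(r', z) \<in> U\<^sup>*" "(x, z) \<in> S\<^sup>+" "(y, z) \<in> S\<^sup>+"
      by (auto simp: D_def)
    then have "r = r'" using U.root_unique by blast
    moreover have "x = y \<or> (x, y) \<in> S\<^sup>+ \<or> (y, x) \<in> S\<^sup>+"
      using S.down_chain[of x z y] r by (metis rtranclD trancl_into_rtrancl)
    ultimately show ?thesis using r by (auto simp: D_def)
  qed
  have "trans D"
  proof
    fix x y z assume *: "(x, y) \<in> D" "(y, z) \<in> D"
    then obtain r r' where r: "r \<in> I - snd ` U" "(r, x) \<in> U\<^sup>*" "(r, y) \<in> U\<^sup>*"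
      "r' \<in> I - snd ` U" "(r', y) \<in> U\<^sup>*" "(r', z) \<in> U\<^sup>*" by (auto simp: D_def)
    then have "r = r'" using U.root_unique by blast
    with r * show "(x, z) \<in> D" by (auto simp: D_def)
  qed
  moreover have "irrefl D" using S.irrefl by (auto simp: D_def irrefl_def)
  moreover have "D \<subseteq> I \<times> I" using S.trancl_sub by (auto simp: D_def)
  ultimately obtain T where T: "arborescence I T" "T\<^sup>+ = D"
    using chain_order_arborescence[OF S.fin, of D] Dchain by blast
  interpret T: arborescence I T by fact
  have snd_trancl: "snd ` R\<^sup>+ = snd ` R" for R :: "('a \<times> 'a) set"
    using trancl_range[of R] by (simp add: Range_snd)
  \<comment> \<open>A root \<open>y\<close> of \<open>U\<close> has nothing below it in
    \<open>D\<close>: the common root \<open>r\<close> would be \<open>y\<close> itself, and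
    \<open>r\<close> is below or equal to \<open>x\<close>, which is strictly below
    \<open>y\<close>.\<close>
  have sndT: "snd ` T = snd ` U"
  proof (intro equalityI subsetI)
    fix y assume "y \<in> snd ` T"
    then obtain x where "(x, y) \<in> D" using T(2) by force
    then obtain r where r: "r \<in> I - snd ` U" "(r, x) \<in> U\<^sup>*" "(r, y) \<in> U\<^sup>*" "(x, y) \<in> S\<^sup>+"
      by (auto simp: D_def)
    show "y \<in> snd ` U"
    proof (rule ccontr)
      assume "y \<notin> snd ` U"
      with r U.root_rtrancl have "r = y" by blast
      with r US S.irrefl show False by (metis rtranclD subsetD trancl_trans)
    qed
  next
    fix y assume "y \<in> snd ` U"
    then show "y \<in> snd ` T" using image_mono[OF UD, of snd] T(2) snd_trancl[of T] by blast
  qed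
  show ?thesis
  proof (rule ex1I)
    have "subforest I (forest_of I T) (forest_of I S)"
      unfolding subforest_forest_of_iff[OF assms(1) T(1)]
    proof (intro conjI allI impI)
      show "T \<subseteq> S\<^sup>+" using T(2) by (auto simp: D_def)
      fix r x y assume *: "r \<in> I - snd ` T" "(r, x) \<in> T\<^sup>*" "(r, y) \<in> T\<^sup>*" "(x, y) \<in> S\<^sup>*"
      have "(r, z) \<in> U\<^sup>*" if "(r, z) \<in> T\<^sup>*" for z
      proof (cases "r = z")
        case False
        with that have "(r, z) \<in> D" using T(2) by (metis rtranclD)
        then obtain r' where "r' \<in> I - snd ` U" "(r', r) \<in> U\<^sup>*" "(r', z) \<in> U\<^sup>*" by (auto simp: D_def)
        with U.root_rtrancl[of r r'] *(1) sndT show ?thesis by auto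
      qed auto
      with * sndT have "x = y \<or> (x, y) \<in> D" using rtranclD[OF *(4)] by (auto simp: D_def)
      with T(2) show "(x, y) \<in> T\<^sup>*" by (metis rtrancl.rtrancl_refl trancl_into_rtrancl)
    qed
    with T sndT UD show "arborescence I T \<and> subforest I (forest_of I T) (forest_of I S) \<and>
        snd ` T = snd ` U \<and> U \<subseteq> T\<^sup>+" by auto
  next
    fix V
    assume "arborescence I V \<and> subforest I (forest_of I V) (forest_of I S) \<and> snd ` V = snd ` U \<and> U \<subseteq> V\<^sup>+"
    then have V: "arborescence I V" "subforest I (forest_of I V) (forest_of I S)" "snd ` V = snd ` U" "U \<subseteq> V\<^sup>+"
      by auto
    interpret V: arborescence I V by fact
    note sub = V(2)[unfolded subforest_forest_of_iff[OF assms(1) V(1)]]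
    have UV: "(x, y) \<in> V\<^sup>*" if "(x, y) \<in> U\<^sup>*" for x y
      using that rtrancl_subset_of_trancl[OF V(4)] by blast
    have VS: "V\<^sup>+ \<subseteq> S\<^sup>+" using sub trancl_subset_trancl by blast
    have "V\<^sup>+ = D"
    proof (intro equalityI subrelI)
      fix x y assume xy: "(x, y) \<in> V\<^sup>+"
      then have I: "x \<in> I" "y \<in> I" using V.trancl_sub by auto
      obtain r where r: "r \<in> I - snd ` U" "(r, x) \<in> U\<^sup>*" using U.root_exists[OF I(1)] .
      obtain r' where r': "r' \<in> I - snd ` U" "(r', y) \<in> U\<^sup>*" using U.root_exists[OF I(2)] .
      \<comment> \<open>Since \<open>U \<subseteq> V\<^sup>+\<close> and the roots agree, both
        \<open>r\<close> and \<open>r'\<close> are the root of \<open>y\<close> in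
        \<open>V\<close>.\<close>
      have "(r, y) \<in> V\<^sup>*" using UV[OF r(2)] xy by auto
      from V.root_unique[OF _ _ this UV[OF r'(2)]] have "r = r'" using r(1) r'(1) V(3) by auto
      with r r' xy VS show "(x, y) \<in> D" by (auto simp: D_def)
    next
      fix x y assume xy: "(x, y) \<in> D"
      then obtain r where r: "r \<in> I - snd ` U" "(r, x) \<in> U\<^sup>*" "(r, y) \<in> U\<^sup>*" "(x, y) \<in> S\<^sup>+"
        by (auto simp: D_def)
      then have "(x, y) \<in> V\<^sup>*"
        using conjunct2[OF sub, rule_format, of r x y] UV[OF r(2)] UV[OF r(3)] V(3)
          trancl_into_rtrancl[OF r(4)] by auto
      moreover have "x \<noteq> y" using r(4) S.irrefl by auto
      ultimately show "(x, y) \<in> V\<^sup>+" by (auto dest: rtranclD)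
    qed
    with T V arborescence_eqI show "V = T" by metis
  qed
qed

section \<open>Alternating functions and orientations\<close>

text \<open>Adjacent swaps carry the first letter to its place, and the tails are treated in the
  longer context \<open>us @ [x]\<close>. The principle is used for signs of alternating functions
  and again for words modulo the defining ideal.\<close>

lemma mset_eq_swap_induct:
  assumes "mset xs = mset ys"
    and refl: "\<And>xs. P xs xs" and trans: "\<And>xs ys zs. P xs ys \<Longrightarrow> P ys zs \<Longrightarrow> P xs zs"
    and swap: "\<And>us x y vs. P (us @ [x, y] @ vs) (us @ [y, x] @ vs)"
  shows "P xs ys"
proof -
  have move: "P (us @ x # ws @ vs) (us @ ws @ x # vs)" for us x ws vs
  proof (induction ws arbitrary: us)
    case (Cons w ws)
    show ?case
      using trans[OF swap[of us x w "ws @ vs", simplified] Cons[of "us @ [w]", simplified]] by simp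
  qed (simp add: refl)
  have "P (us @ xs) (us @ ys)" for us
    using assms(1)
  proof (induction xs arbitrary: us ys)
    case (Cons x xs)
    then have "x \<in> set ys" by (metis list.set_intros(1) mset_eq_setD)
    then obtain ws vs where ys: "ys = ws @ x # vs" by (meson split_list)
    with Cons.prems have "mset xs = mset (ws @ vs)" by simp
    from trans[OF Cons.IH[OF this, of "us @ [x]", simplified] move] ys show ?case by simp
  qed (simp add: refl)
  from this[of "[]"] show ?thesis by simp
qed

text \<open>Only neighbours are exchanged. Over the integers this includes vanishing on words with
  two equal neighbours.\<close>

definition alternating :: "('b list \<Rightarrow> int) \<Rightarrow> bool" where
  "alternating f \<longleftrightarrow> (\<forall>us x y vs. f (us @ [x, y] @ vs) = - f (us @ [y, x] @ vs))"

lemma alternatingD: "alternating f \<Longrightarrow> f (us @ x # y # vs) = - f (us @ y # x # vs)"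
  unfolding alternating_def by (metis append_Cons append_Nil)

lemma alternating_minus: "alternating f \<Longrightarrow> alternating (- f)"
  unfolding alternating_def uminus_apply by metis

text \<open>The point is the order of quantifiers: one sign \<open>s\<close> serves all alternating
  functions and all contexts. This allows the signs of an orientation and of its two factors to be
  compared.\<close>

lemma alternating_mset_eq:
  assumes "mset xs = mset ys"
  obtains s :: int where "s \<in> {1, -1}"
    "\<And>f us vs. alternating f \<Longrightarrow> f (us @ xs @ vs) = s * f (us @ ys @ vs)"
proof -
  have "\<exists>s::int\<in>{1, -1}. \<forall>f us vs. alternating f \<longrightarrow> f (us @ xs @ vs) = s * f (us @ ys @ vs)"
  proof (rule mset_eq_swap_induct[OF assms], goal_cases)
    case (2 xs ys zs)
    then obtain s t :: int where "s \<in> {1, -1}" "t \<in> {1, -1}"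
      "\<forall>f us vs. alternating f \<longrightarrow> f (us @ xs @ vs) = s * f (us @ ys @ vs)"
      "\<forall>f us vs. alternating f \<longrightarrow> f (us @ ys @ vs) = t * f (us @ zs @ vs)" by blast
    moreover from this(3,4) have "\<forall>f us vs. alternating f \<longrightarrow> f (us @ xs @ vs) = (s * t) * f (us @ zs @ vs)"
      by (simp add: mult.assoc)
    moreover from \<open>s \<in> {1, -1}\<close> \<open>t \<in> {1, -1}\<close> have "s * t \<in> {1, -1}" by auto
    ultimately show ?case by blast
  next
    case (3 us x y vs)
    have "f (ts @ (us @ [x, y] @ vs) @ ws) = - 1 * f (ts @ (us @ [y, x] @ vs) @ ws)"
      if "alternating f" for f :: "'a list \<Rightarrow> int" and ts ws
      using alternatingD[OF that, of "ts @ us" x y "vs @ ws"] by simp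
    then show ?case by blast
  qed auto
  with that show ?thesis by blast
qed

text \<open>Each letter of \<open>xs\<close> passes all of \<open>ys\<close>. This is the origin of
  the graded commutativity of the pairing.\<close>

lemma alternating_swap_blocks:
  assumes "alternating f"
  shows "f (us @ xs @ ys @ vs) = (-1) ^ (length xs * length ys) * f (us @ ys @ xs @ vs)"
proof -
  have move: "f (us @ x # ys @ vs) = (-1) ^ length ys * f (us @ ys @ x # vs)" for us x vs
  proof (induction ys arbitrary: us)
    case (Cons y ys)
    show ?case
      using alternatingD[OF assms, of us x y "ys @ vs"] Cons[of "us @ [y]"] by simp
  qed simp
  show ?thesis
  proof (induction xs arbitrary: us)
    case (Cons x xs)
    show ?case
      using Cons[of "us @ [x]"] move[of us x "xs @ vs"] by (simp add: power_add)
  qed simp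
qed

lemma permute_list_transpose:
  "permute_list (transpose (length us) (Suc (length us))) (us @ [x, y] @ vs) = us @ [y, x] @ vs"
proof -
  have "permute_list (transpose i j) xs = xs[i := xs ! j, j := xs ! i]"
    if "i < length xs" "j < length xs" for i j and xs :: "'a list"
    using that by (intro nth_equalityI) (auto simp: permute_list_def nth_list_update transpose_def)
  then show ?thesis by (simp add: nth_append list_update_append)
qed

text \<open>Composition with the transposition of the two positions is a sign-reversing bijection
  between the permutations that produce the two words. If the length is wrong, both sums are
  empty.\<close>

lemma alternating_wedge: "alternating (wedge xs)"
  unfolding alternating_def
proof (intro allI)
  fix us x y vs
  show "wedge xs (us @ [x, y] @ vs) = - wedge xs (us @ [y, x] @ vs)"
  proof (cases "length xs = length us + 2 + length vs")
    case True
    define t where "t = transpose (length us) (Suc (length us))"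
    have t: "t permutes {..<length xs}"
      unfolding t_def using True by (intro permutes_swap_id) auto
    have tt: "t \<circ> t = id" by (auto simp: t_def)
    have perm: "permute_list (p \<circ> t) xs = us @ [y', x'] @ vs" if "permute_list p xs = us @ [x', y'] @ vs" for p x' y'
      using permute_list_compose[OF t, of p] that permute_list_transpose[of us x' y' vs]
      by (simp add: t_def)
    have sign: "sign (p \<circ> t) = - sign p" if "p permutes {..<length xs}" for p
      using sign_compose[of p t] that t
      by (auto simp: sign_swap_id t_def intro: permutes_imp_permutation[of "{..<length xs}"])
    have "wedge xs (us @ [x, y] @ vs) =
      (\<Sum>p | p permutes {..<length xs} \<and> permute_list p xs = us @ [y, x] @ vs. - sign p)"
      unfolding wedge_def
      using t tt perm sign
      by (intro sum.reindex_bij_witness[of _ "\<lambda>p. p \<circ> t" "\<lambda>p. p \<circ> t"])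
        (auto simp: comp_assoc permutes_compose)
    then show ?thesis by (simp add: wedge_def sum_negf)
  next
    case False
    then have "permute_list p xs \<noteq> us @ [x', y'] @ vs" for p x' y'
      by (metis (no_types) length_append length_permute_list add.assoc add_2_eq_Suc' length_Cons list.size(3) One_nat_def Suc_1 add.commute)
    then show ?thesis unfolding wedge_def by simp
  qed
qed

lemma wedge_nonzero: "wedge xs ys \<noteq> 0 \<Longrightarrow> mset ys = mset xs"
proof -
  assume "wedge xs ys \<noteq> 0"
  then obtain p where "p permutes {..<length xs}" "permute_list p xs = ys"
    unfolding wedge_def by (metis (mono_tags, lifting) mem_Collect_eq sum.neutral)
  then show ?thesis by auto
qed

lemma wedge_same: "distinct xs \<Longrightarrow> wedge xs xs = 1"
proof -
  assume xs: "distinct xs"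
  have "p = id" if p: "p permutes {..<length xs}" "permute_list p xs = xs" for p
  proof
    fix i
    show "p i = id i"
    proof (cases "i < length xs")
      case True
      with p have "xs ! p i = xs ! i" "p i < length xs"
        using permute_list_nth[OF p(1) True] permutes_in_image[OF p(1), of i] by auto
      with xs True show ?thesis by (simp add: nth_eq_iff_index_eq)
    qed (use p in \<open>auto simp: permutes_def\<close>)
  qed
  then have "{p. p permutes {..<length xs} \<and> permute_list p xs = xs} = {id}"
    by (auto simp: permutes_id)
  then show ?thesis by (simp add: wedge_def)
qed

lemma maximal_product_alternating: "ori \<in> maximal_products S \<Longrightarrow> alternating ori"
  by (auto simp: maximal_products_def alternating_wedge alternating_minus)

lemma maximal_product_nonzero: "ori \<in> maximal_products S \<Longrightarrow> ori xs \<noteq> 0 \<Longrightarrow> distinct xs \<and> set xs = S"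
  by (auto simp: maximal_products_def dest!: wedge_nonzero)
    (auto dest: mset_eq_imp_distinct_iff mset_eq_setD)

lemma maximal_product_value:
  assumes "ori \<in> maximal_products S" "distinct xs" "set xs = S"
  shows "ori xs = 1 \<or> ori xs = - 1"
proof -
  obtain w where w: "distinct w" "set w = S" "ori = wedge w \<or> ori = - wedge w"
    using assms(1) by (auto simp: maximal_products_def)
  then have "mset xs = mset w" using assms by (metis set_eq_iff_mset_eq_distinct)
  then obtain s :: int where "s \<in> {1, -1}"
    "\<And>f us vs. alternating f \<Longrightarrow> f (us @ xs @ vs) = s * f (us @ w @ vs)"
    using alternating_mset_eq by metis
  from this(1) this(2)[OF alternating_wedge, of w "[]" "[]"] show ?thesis
    using w wedge_same[of w] by auto
qed

text \<open>The top exterior power has rank one: all rearrangements of \<open>xs\<close> get their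
  value from the value at \<open>xs\<close>, with the same sign for \<open>f\<close> and for the
  wedge.\<close>

lemma alternating_eq_wedge:
  assumes "alternating f" "\<And>zs. f zs \<noteq> 0 \<Longrightarrow> mset zs = mset xs" "distinct xs"
  shows "f zs = f xs * wedge xs zs"
proof (cases "mset zs = mset xs")
  case True
  then obtain s :: int where
    s: "\<And>f us vs. alternating f \<Longrightarrow> f (us @ zs @ vs) = s * f (us @ xs @ vs)"
    using alternating_mset_eq by metis
  show ?thesis
    using s[OF assms(1), of "[]" "[]"] s[OF alternating_wedge[of xs], of "[]" "[]"] wedge_same[OF assms(3)]
    by simp
next
  case False
  with assms(2)[of zs] wedge_nonzero[of xs zs] have "f zs = 0" "wedge xs zs = 0" by auto
  then show ?thesis by simp
qed

lemma maximal_product_eq_wedge: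
  assumes "ori \<in> maximal_products S" "distinct xs" "set xs = S"
  shows "ori = (\<lambda>zs. ori xs * wedge xs zs)"
proof
  fix zs
  have "mset ys = mset xs" if "ori ys \<noteq> 0" for ys
    using maximal_product_nonzero[OF assms(1) that] assms(2,3) by (metis set_eq_iff_mset_eq_distinct)
  then show "ori zs = ori xs * wedge xs zs"
    using assms maximal_product_alternating by (intro alternating_eq_wedge) auto
qed

lemma wedge_maximal_product:
  assumes "distinct xs" "set xs = S" "s \<in> {1, -1}"
  shows "(\<lambda>zs. s * wedge xs zs) \<in> maximal_products S"
proof -
  have "(\<lambda>zs. s * wedge xs zs) = wedge xs \<or> (\<lambda>zs. s * wedge xs zs) = - wedge xs"
    using assms(3) by (auto simp: fun_eq_iff)
  with assms(1,2) show ?thesis by (auto simp: maximal_products_def)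
qed

lemma minus_maximal_product: "ori \<in> maximal_products S \<Longrightarrow> - ori \<in> maximal_products S"
  unfolding maximal_products_def by force

section \<open>Splitting an orientation along a partition of the nodes\<close>

lemma distinct_word_None: "distinct w \<Longrightarrow> distinct (map Some w @ [None])"
  by (auto simp: distinct_map)

lemma splits_orientationI:
  assumes "distinct w1" "set w1 = N1" "distinct w2" "set w2 = N2" "s1 \<in> {1, -1}" "s2 \<in> {1, -1}"
  shows "splits_orientation N1 N2 (\<lambda>z. s1 * s2 * wedge (map Some w1 @ map Some w2 @ [None]) z)
    (\<lambda>z. s1 * wedge (map Some w1 @ [None]) z, \<lambda>z. s2 * wedge (map Some w2 @ [None]) z)"
  unfolding splits_orientation_def prod.case
  by (rule exI[of _ w1], rule exI[of _ w2], rule bexI[OF _ assms(5)], rule bexI[OF _ assms(6)])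
    (simp add: assms)

lemma splits_orientation_in:
  assumes "splits_orientation N1 N2 ori (o1, o2)"
  shows "o1 \<in> maximal_products (insert None (Some ` N1))" "o2 \<in> maximal_products (insert None (Some ` N2))"
proof -
  obtain w1 w2 :: "'a list" and s1 s2 :: int where
    w: "distinct w1" "set w1 = N1" "distinct w2" "set w2 = N2" "s1 \<in> {1, -1}" "s2 \<in> {1, -1}"
      "o1 = (\<lambda>z. s1 * wedge (map Some w1 @ [None]) z)" "o2 = (\<lambda>z. s2 * wedge (map Some w2 @ [None]) z)"
    using assms(1) unfolding splits_orientation_def prod.case by blast
  show "o1 \<in> maximal_products (insert None (Some ` N1))"
    unfolding w(7) by (intro wedge_maximal_product distinct_word_None) (use w in auto)
  show "o2 \<in> maximal_products (insert None (Some ` N2))"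
    unfolding w(8) by (intro wedge_maximal_product distinct_word_None) (use w in auto)
qed

text \<open>The enumerations hidden in a splitting are replaced by \<open>u\<close> and
  \<open>v\<close>. The signs \<open>t1\<close> and \<open>t2\<close> of this reordering appear in
  the value of \<open>ori\<close> exactly as in those of \<open>o1\<close> and \<open>o2\<close>, by
  the uniformity of the sign in the context.\<close>

lemma splits_orientation_eval:
  assumes "splits_orientation N1 N2 ori (o1, o2)" "N1 \<inter> N2 = {}"
    and "distinct u" "set u = N1" "distinct v" "set v = N2"
  shows "ori (map Some u @ map Some v @ [None]) = o1 (map Some u @ [None]) * o2 (map Some v @ [None])"
proof -
  obtain w1 w2 :: "'a list" and s1 s2 :: int where
    w: "distinct w1" "set w1 = N1" "distinct w2" "set w2 = N2"
      "o1 = (\<lambda>z. s1 * wedge (map Some w1 @ [None]) z)" "o2 = (\<lambda>z. s2 * wedge (map Some w2 @ [None]) z)"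
      "ori = (\<lambda>z. s1 * s2 * wedge (map Some w1 @ map Some w2 @ [None]) z)"
    using assms(1) unfolding splits_orientation_def prod.case by blast
  have m: "mset (map Some u) = mset (map Some w1)" "mset (map Some v) = mset (map Some w2)"
    using assms w by (metis mset_map set_eq_iff_mset_eq_distinct)+
  obtain t1 :: int where
    t1: "\<And>f us vs. alternating f \<Longrightarrow> f (us @ map Some u @ vs) = t1 * f (us @ map Some w1 @ vs)"
    using alternating_mset_eq[OF m(1)] by metis
  obtain t2 :: int where
    t2: "\<And>f us vs. alternating f \<Longrightarrow> f (us @ map Some v @ vs) = t2 * f (us @ map Some w2 @ vs)"
    using alternating_mset_eq[OF m(2)] by metis
  have d: "distinct (map Some w1 @ map Some w2 @ [None])"
    using w assms by (auto simp: distinct_map)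
  have "ori (map Some u @ map Some v @ [None]) = s1 * s2 * (t1 * t2)"
    unfolding w(7)
    using t1[OF alternating_wedge, of "map Some w1 @ map Some w2 @ [None]" "[]" "map Some v @ [None]"]
      t2[OF alternating_wedge, of "map Some w1 @ map Some w2 @ [None]" "map Some w1" "[None]"]
      wedge_same[OF d] by simp
  moreover have "o1 (map Some u @ [None]) = s1 * t1"
    unfolding w(5)
    using t1[OF alternating_wedge, of "map Some w1 @ [None]" "[]" "[None]"]
      wedge_same[OF distinct_word_None[OF w(1)]] by simp
  moreover have "o2 (map Some v @ [None]) = s2 * t2"
    unfolding w(6)
    using t2[OF alternating_wedge, of "map Some w2 @ [None]" "[]" "[None]"]
      wedge_same[OF distinct_word_None[OF w(3)]] by simp
  ultimately show ?thesis by simp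
qed

lemma splits_orientation_exists:
  assumes "ori \<in> maximal_products (insert None (Some ` (N1 \<union> N2)))" "N1 \<inter> N2 = {}" "finite N1" "finite N2"
  shows "\<exists>q. splits_orientation N1 N2 ori q"
proof -
  obtain w1 w2 where w: "distinct w1" "set w1 = N1" "distinct w2" "set w2 = N2"
    using assms(3,4) finite_distinct_list by metis
  let ?w = "map Some w1 @ map Some w2 @ [None]"
  have d: "distinct ?w" "set ?w = insert None (Some ` (N1 \<union> N2))"
    using w assms(2) by (auto simp: distinct_map)
  \<comment> \<open>The whole sign of \<open>ori\<close> is put on the second factor.\<close>
  define c where "c = ori ?w"
  have c: "c \<in> {1, -1}" using maximal_product_value[OF assms(1) d] by (auto simp: c_def)
  have ori: "ori = (\<lambda>z. 1 * c * wedge ?w z)"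
    using maximal_product_eq_wedge[OF assms(1) d] unfolding c_def mult_1 .
  have "splits_orientation N1 N2 ori
      (\<lambda>z. 1 * wedge (map Some w1 @ [None]) z, \<lambda>z. c * wedge (map Some w2 @ [None]) z)"
    using splits_orientationI[OF w insertI1 c] by (subst ori)
  then show ?thesis by blast
qed

lemma maximal_product_eq_or_minus:
  assumes "p \<in> maximal_products S" "q \<in> maximal_products S"
  obtains s :: int where "s = 1 \<or> s = - 1" "p = (\<lambda>z. s * q z)"
proof -
  obtain w where w: "distinct w" "set w = S" using assms(1) by (auto simp: maximal_products_def)
  define s where "s = p w * q w"
  have "q w = 1 \<or> q w = - 1" "p w = 1 \<or> p w = - 1"
    using maximal_product_value assms w by metis+
  moreover have "p z = p w * wedge w z" "q z = q w * wedge w z" for z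
    using fun_cong[OF maximal_product_eq_wedge[OF assms(1) w], of z]
      fun_cong[OF maximal_product_eq_wedge[OF assms(2) w], of z] .
  then have "p z = p w * wedge w z \<and> q z = q w * wedge w z" for z by blast
  ultimately have "s = 1 \<or> s = - 1" "p z = s * q z" for z
    unfolding s_def by (metis mult.assoc mult.left_neutral mult_minus1 mult_minus1_right minus_minus mult.right_neutral)+
  then have "s = 1 \<or> s = - 1" "p = (\<lambda>z. s * q z)" by blast+
  with that show ?thesis by blast
qed

section \<open>Groups by generators and relations\<close>

definition frag_lin :: "('b \<Rightarrow> int) \<Rightarrow> ('b \<Rightarrow>\<^sub>0 int) \<Rightarrow> int" where
  "frag_lin f c = (\<Sum>x\<in>Poly_Mapping.keys c. Poly_Mapping.lookup c x * f x)"

text \<open>Views the integers as the free group on one point, which gives \<open>frag_lin\<close>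
  the linearity of \<open>frag_extend\<close>.\<close>

lemma frag_lin_conv_frag_extend:
  "frag_lin f c = Poly_Mapping.lookup (frag_extend (\<lambda>x. frag_cmul (f x) (frag_of ())) c) ()"
  by (simp add: frag_lin_def frag_extend_def lookup_sum)

lemma frag_lin_0 [simp]: "frag_lin f 0 = 0"
  by (simp add: frag_lin_def)

lemma frag_lin_frag_of [simp]: "frag_lin f (frag_of x) = f x"
  by (simp add: frag_lin_def)

lemma frag_lin_add: "frag_lin f (c + d) = frag_lin f c + frag_lin f d"
  by (simp add: frag_lin_conv_frag_extend frag_extend_add lookup_add)

lemma frag_lin_diff: "frag_lin f (c - d) = frag_lin f c - frag_lin f d"
  by (simp add: frag_lin_conv_frag_extend frag_extend_diff lookup_minus)

lemma frag_lin_minus: "frag_lin f (- c) = - frag_lin f c"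
  by (simp add: frag_lin_conv_frag_extend frag_extend_minus)

lemma frag_lin_cmul: "frag_lin f (frag_cmul k c) = k * frag_lin f c"
  by (simp add: frag_lin_conv_frag_extend frag_extend_cmul)

lemma frag_lin_sum: "frag_lin f (\<Sum>i\<in>A. g i) = (\<Sum>i\<in>A. frag_lin f (g i))"
  by (induction A rule: infinite_finite_induct) (simp_all add: frag_lin_add)

lemma frag_lin_frag_extend: "frag_lin f (frag_extend g c) = frag_lin (\<lambda>x. frag_lin f (g x)) c"
  by (simp add: frag_extend_def frag_lin_sum frag_lin_cmul frag_lin_def[of "\<lambda>x. frag_lin f (g x)"])

lemma frag_lin_cong: "(\<And>x. x \<in> Poly_Mapping.keys c \<Longrightarrow> f x = g x) \<Longrightarrow> frag_lin f c = frag_lin g c"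
  by (simp add: frag_lin_def)

lemma frag_lin_add_fun: "frag_lin (\<lambda>x. f x + g x) c = frag_lin f c + frag_lin g c"
  by (simp add: frag_lin_def algebra_simps sum.distrib)

lemma frag_lin_minus_fun: "frag_lin (\<lambda>x. - f x) c = - frag_lin f c"
  by (simp add: frag_lin_def sum_negf)

lemma frag_lin_mult_left: "frag_lin (\<lambda>x. k * f x) c = k * frag_lin f c"
  by (simp add: frag_lin_def sum_distrib_left mult.left_commute)

lemma frag_lin_mult_right: "frag_lin (\<lambda>x. f x * k) c = frag_lin f c * k"
  by (simp add: frag_lin_def sum_distrib_right mult.assoc)

lemma frag_lin_sum_fun: "frag_lin (\<lambda>x. \<Sum>i\<in>A. f i x) c = (\<Sum>i\<in>A. frag_lin (f i) c)"
  unfolding frag_lin_def by (subst sum.swap) (simp add: sum_distrib_left)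

lemma frag_lin_swap: "frag_lin (\<lambda>x. frag_lin (f x) d) c = frag_lin (\<lambda>y. frag_lin (\<lambda>x. f x y) c) d"
  unfolding frag_lin_def sum_distrib_left
  by (subst sum.swap) (simp add: mult.left_commute)

lemma frag_extend_in:
  assumes "\<And>x. x \<in> Poly_Mapping.keys c \<Longrightarrow> Poly_Mapping.keys (g x) \<subseteq> S"
  shows "Poly_Mapping.keys (frag_extend g c) \<subseteq> S"
  using keys_frag_extend[of g c] assms by blast

lemma frag_extend_add_fun: "frag_extend (\<lambda>x. f x + g x) c = frag_extend f c + frag_extend g c"
  by (simp add: frag_extend_def frag_cmul_distrib2 sum.distrib)

locale presentation =
  fixes S :: "'b set" and Rel :: "('b \<Rightarrow>\<^sub>0 int) set"
  assumes Rel: "r \<in> Rel \<Longrightarrow> Poly_Mapping.keys r \<subseteq> S"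
begin

abbreviation "cls \<equiv> presented_class S Rel"
abbreviation "P \<equiv> presented_group S Rel"

lemma subgroup_relators: "subgroup (relators S Rel) (free_Abelian_group S)"
  unfolding relators_def by (rule group.generate_is_subgroup) (use Rel in auto)

lemma normal_relators: "relators S Rel \<lhd> free_Abelian_group S"
  using comm_group.subgroup_imp_normal[OF abelian_free_Abelian_group subgroup_relators] .

lemma relators_induct [consumes 1, case_names zero rel add minus]:
  assumes "c \<in> relators S Rel" "Q 0" "\<And>r. r \<in> Rel \<Longrightarrow> Q r" "\<And>a b. Q a \<Longrightarrow> Q b \<Longrightarrow> Q (a + b)"
    "\<And>a. Q a \<Longrightarrow> Q (- a)"
  shows "Q c"
  using assms(1) unfolding relators_def
proof (induction rule: generate.induct)
  case (inv h)
  with Rel[of h] assms show ?case by simp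
qed (use assms in auto)

lemma relators_keys: "c \<in> relators S Rel \<Longrightarrow> Poly_Mapping.keys c \<subseteq> S"
  using subgroup.mem_carrier[OF subgroup_relators] by auto

lemma relators_zero: "0 \<in> relators S Rel"
  using subgroup.one_closed[OF subgroup_relators] by simp

lemma relators_add: "a \<in> relators S Rel \<Longrightarrow> b \<in> relators S Rel \<Longrightarrow> a + b \<in> relators S Rel"
  using subgroup.m_closed[OF subgroup_relators] by simp

lemma relators_minus: "a \<in> relators S Rel \<Longrightarrow> - a \<in> relators S Rel"
  using subgroup.m_inv_closed[OF subgroup_relators, of a] relators_keys by simp

lemma relators_diff: "a \<in> relators S Rel \<Longrightarrow> b \<in> relators S Rel \<Longrightarrow> a - b \<in> relators S Rel"
  using relators_add[of a "- b"] relators_minus by simp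

lemma relators_rel: "r \<in> Rel \<Longrightarrow> r \<in> relators S Rel"
  unfolding relators_def by (rule generate.incl)

lemma relators_sum: "(\<And>i. i \<in> A \<Longrightarrow> f i \<in> relators S Rel) \<Longrightarrow> (\<Sum>i\<in>A. f i) \<in> relators S Rel"
  by (induction A rule: infinite_finite_induct) (auto intro: relators_zero relators_add)

lemma relators_frag_extend:
  assumes "\<And>x. x \<in> Poly_Mapping.keys c \<Longrightarrow> g x \<in> relators S Rel"
  shows "frag_extend g c \<in> relators S Rel"
  unfolding frag_extend_def
  by (intro relators_sum frag_closure_minus_cmul[where P = "\<lambda>c. c \<in> relators S Rel"])
    (auto intro: relators_zero relators_diff assms)

lemma frag_lin_relators: "c \<in> relators S Rel \<Longrightarrow> (\<And>r. r \<in> Rel \<Longrightarrow> frag_lin f r = 0) \<Longrightarrow> frag_lin f c = 0"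
  by (induction c rule: relators_induct) (auto simp: frag_lin_add frag_lin_minus)

lemma mem_class_iff: "d \<in> cls c \<longleftrightarrow> d - c \<in> relators S Rel"
  unfolding presented_class_def r_coset_def
  by (auto simp: eq_diff_eq[symmetric])
    (metis diff_add_cancel)

lemma class_eq_iff: "cls c = cls d \<longleftrightarrow> c - d \<in> relators S Rel"
proof
  assume "cls c = cls d"
  moreover have "c \<in> cls c" by (simp add: mem_class_iff relators_zero)
  ultimately show "c - d \<in> relators S Rel" by (simp add: mem_class_iff)
next
  assume *: "c - d \<in> relators S Rel"
  have "e - c \<in> relators S Rel \<longleftrightarrow> e - d \<in> relators S Rel" for e
    using relators_add[OF _ *, of "e - c"] relators_diff[OF _ *, of "e - d"] by auto
  then show "cls c = cls d" by (auto simp: mem_class_iff)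
qed

text \<open>Every map out of a quotient is evaluated through this fact, which reduces
  well-definedness to congruence modulo relators. Representatives other than \<open>c\<close> are
  supported on \<open>S\<close> too, since relators are.\<close>

lemma the_elem_image_class:
  assumes "Poly_Mapping.keys c \<subseteq> S"
    and "\<And>d. Poly_Mapping.keys d \<subseteq> S \<Longrightarrow> d - c \<in> relators S Rel \<Longrightarrow> f d = f c"
  shows "the_elem (f ` cls c) = f c"
proof -
  have "f d = f c" if "d \<in> cls c" for d
  proof -
    have *: "d - c \<in> relators S Rel" using that by (simp add: mem_class_iff)
    have "Poly_Mapping.keys ((d - c) + c) \<subseteq> S"
      using keys_add[of "d - c" c] relators_keys[OF *] assms(1) by blast
    with assms(2) * show ?thesis by simp
  qed
  moreover have "c \<in> cls c" by (simp add: mem_class_iff relators_zero)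
  ultimately have "f ` cls c = {f c}" by blast
  then show ?thesis by simp
qed

lemma carrier_P: "carrier P = cls ` {c. Poly_Mapping.keys c \<subseteq> S}"
  by (auto simp: presented_group_def FactGroup_def RCOSETS_def presented_class_def)

lemma class_in_P [intro]: "Poly_Mapping.keys c \<subseteq> S \<Longrightarrow> cls c \<in> carrier P"
  by (simp add: carrier_P)

lemma in_P_E:
  assumes "X \<in> carrier P"
  obtains c where "X = cls c" "Poly_Mapping.keys c \<subseteq> S"
  using assms by (auto simp: carrier_P)

lemma mult_class:
  assumes "Poly_Mapping.keys c \<subseteq> S" "Poly_Mapping.keys d \<subseteq> S"
  shows "cls c \<otimes>\<^bsub>P\<^esub> cls d = cls (c + d)"
  using normal.rcos_sum[OF normal_relators, of c d] assms
  by (simp add: presented_group_def FactGroup_def presented_class_def)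

lemma group_P: "group P"
  unfolding presented_group_def using normal_relators by (rule normal.factorgroup_is_group)

lemma hom_class:
  assumes "\<phi> \<in> hom P integer_group" "Poly_Mapping.keys c \<subseteq> S"
  shows "\<phi> (cls c) = frag_lin (\<lambda>x. \<phi> (cls (frag_of x))) c"
proof -
  have add: "\<phi> (cls (a + b)) = \<phi> (cls a) + \<phi> (cls b)"
    if "Poly_Mapping.keys a \<subseteq> S" "Poly_Mapping.keys b \<subseteq> S" for a b
    using hom_mult[OF assms(1) class_in_P[OF that(1)] class_in_P[OF that(2)]] mult_class[OF that]
    by (simp add: integer_group_def)
  from assms(2) have "Poly_Mapping.keys c \<subseteq> S \<and> \<phi> (cls c) = frag_lin (\<lambda>x. \<phi> (cls (frag_of x))) c"
  proof (induction c rule: frag_induction)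
    case zero
    show ?case using add[of 0 0] by simp
  next
    case (diff a b)
    then have "Poly_Mapping.keys (a - b) \<subseteq> S" using keys_diff[of a b] by auto
    with diff add[of "a - b" b] show ?case by (simp add: frag_lin_diff)
  qed simp
  then show ?thesis by blast
qed

end

section \<open>Multiplication in the dual algebra\<close>

locale finite_ground =
  fixes I :: "'a set"
  assumes finite_ground: "finite I"
begin

lemma minus_oriented_forest: "(ori, F) \<in> oriented_forests I \<Longrightarrow> (- ori, F) \<in> oriented_forests I"
  by (auto simp: oriented_forests_def orientations_def minus_maximal_product)

sublocale M: presentation "oriented_forests I" "orientation_rels I"
  rewrites "presented_class (oriented_forests I) (orientation_rels I) = forest_class I"
    and "presented_group (oriented_forests I) (orientation_rels I) = forest_module I"
proof -
  show "presentation (oriented_forests I) (orientation_rels I)"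
  proof
    fix r assume "r \<in> orientation_rels I"
    then obtain ori F where r: "r = frag_of (- ori, F) + frag_of (ori, F)" "(ori, F) \<in> oriented_forests I"
      by (auto simp: orientation_rels_def)
    then have "Poly_Mapping.keys r \<subseteq> {(- ori, F), (ori, F)}"
      using keys_add[of "frag_of (- ori, F)" "frag_of (ori, F)"] by auto
    with r minus_oriented_forest show "Poly_Mapping.keys r \<subseteq> oriented_forests I" by blast
  qed
qed (simp_all add: forest_class_def forest_module_def)

sublocale T: presentation "carrier (forest_module I) \<times> carrier (forest_module I)"
    "bilinear_rels (forest_module I) (forest_module I)"
  rewrites "presented_class (carrier (forest_module I) \<times> carrier (forest_module I))
      (bilinear_rels (forest_module I) (forest_module I)) = tensor_class (forest_module I) (forest_module I)"
    and "presented_group (carrier (forest_module I) \<times> carrier (forest_module I))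
      (bilinear_rels (forest_module I) (forest_module I)) = tensor_group (forest_module I) (forest_module I)"
proof -
  have 3: "Poly_Mapping.keys (frag_of a - frag_of b - frag_of c) \<subseteq> {a, b, c}"
    for a b c :: "('a oforest \<Rightarrow>\<^sub>0 int) set \<times> ('a oforest \<Rightarrow>\<^sub>0 int) set"
    using keys_diff[of "frag_of a - frag_of b" "frag_of c"] keys_diff[of "frag_of a" "frag_of b"] by auto
  have m: "x \<otimes>\<^bsub>forest_module I\<^esub> y \<in> carrier (forest_module I)"
    if "x \<in> carrier (forest_module I)" "y \<in> carrier (forest_module I)" for x y
    using that M.group_P by (simp add: group.is_monoid monoid.m_closed)
  show "presentation (carrier (forest_module I) \<times> carrier (forest_module I))
    (bilinear_rels (forest_module I) (forest_module I))"
  proof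
    fix r assume "r \<in> bilinear_rels (forest_module I) (forest_module I)"
    then obtain a b c where "r = frag_of a - frag_of b - frag_of c"
      "{a, b, c} \<subseteq> carrier (forest_module I) \<times> carrier (forest_module I)"
      unfolding bilinear_rels_def using m by (elim UnE CollectE exE conjE) simp_all
    with 3[of a b c] show "Poly_Mapping.keys r \<subseteq> carrier (forest_module I) \<times> carrier (forest_module I)"
      by blast
  qed
qed (simp_all add: tensor_class_def tensor_group_def)

abbreviation "relM \<equiv> relators (oriented_forests I) (orientation_rels I)"
abbreviation "relT \<equiv> relators (carrier (forest_module I) \<times> carrier (forest_module I))
      (bilinear_rels (forest_module I) (forest_module I))"

lemma frag_lin_relM:
  assumes "c \<in> relM" "\<And>ori F. (ori, F) \<in> oriented_forests I \<Longrightarrow> g (- ori, F) = - g (ori, F)"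
  shows "frag_lin g c = 0"
  using assms(1) by (rule M.frag_lin_relators) (use assms(2) in \<open>auto simp: orientation_rels_def frag_lin_add\<close>)

lemma the_elem_lin_class:
  assumes "Poly_Mapping.keys c \<subseteq> oriented_forests I"
    and "\<And>ori F. (ori, F) \<in> oriented_forests I \<Longrightarrow> g (- ori, F) = - g (ori, F)"
  shows "the_elem (frag_lin g ` forest_class I c) = frag_lin g c"
proof (rule M.the_elem_image_class[OF assms(1)])
  fix d assume "d - c \<in> relM"
  then have "frag_lin g (d - c) = 0" using assms(2) by (rule frag_lin_relM)
  then show "frag_lin g d = frag_lin g c" by (simp add: frag_lin_diff)
qed

definition degree_part :: "int \<Rightarrow> ('a oforest \<Rightarrow>\<^sub>0 int) \<Rightarrow> ('a oforest \<Rightarrow>\<^sub>0 int)" where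
  "degree_part n = frag_extend (\<lambda>x. if oforest_degree I x = n then frag_of x else 0)"

lemma degree_part_keys: "Poly_Mapping.keys c \<subseteq> oriented_forests I \<Longrightarrow> Poly_Mapping.keys (degree_part n c) \<subseteq> oriented_forests I"
  unfolding degree_part_def by (rule frag_extend_in) auto

text \<open>Both terms of an orientation relation carry the same forest, so a degree projection
  keeps or kills the relation as a whole.\<close>

lemma degree_part_relM:
  assumes "c \<in> relM"
  shows "degree_part n c \<in> relM"
  using assms
proof (induction c rule: M.relators_induct)
  case (rel r)
  then obtain ori F where r: "r = frag_of (- ori, F) + frag_of (ori, F)" by (auto simp: orientation_rels_def)
  then have "degree_part n r = (if oforest_degree I (ori, F) = n then r else 0)"
    by (simp add: degree_part_def frag_extend_add oforest_degree_def)
  with rel show ?case using M.relators_rel M.relators_zero by simp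
qed (auto simp: degree_part_def frag_extend_add frag_extend_minus intro: M.relators_zero M.relators_add M.relators_minus)

lemma forest_proj_class:
  assumes "Poly_Mapping.keys c \<subseteq> oriented_forests I"
  shows "forest_proj I n (forest_class I c) = forest_class I (degree_part n c)"
  unfolding forest_proj_def degree_part_def[symmetric]
proof (rule M.the_elem_image_class[OF assms])
  fix d assume "d - c \<in> relM"
  then have "degree_part n (d - c) \<in> relM" by (rule degree_part_relM)
  then show "forest_class I (degree_part n d) = forest_class I (degree_part n c)"
    by (simp add: M.class_eq_iff degree_part_def frag_extend_diff)
qed

lemma forest_proj_homogeneous:
  assumes "Poly_Mapping.keys c \<subseteq> {x \<in> oriented_forests I. oforest_degree I x = m}"
  shows "forest_proj I n (forest_class I c) = forest_class I (if n = m then c else 0)"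
proof -
  have "degree_part n c = (if n = m then c else 0)"
  proof (cases "n = m")
    case True
    then have "degree_part n c = frag_extend frag_of c"
      unfolding degree_part_def using assms by (intro frag_extend_eq) auto
    with True show ?thesis by (simp flip: frag_expansion)
  next
    case False
    then show ?thesis unfolding degree_part_def using assms by (simp, intro frag_extend_eq_0) auto
  qed
  with assms show ?thesis by (subst forest_proj_class) auto
qed

lemma forest_proj_mult:
  assumes "x \<in> carrier (forest_module I)" "y \<in> carrier (forest_module I)"
  shows "forest_proj I n (x \<otimes>\<^bsub>forest_module I\<^esub> y) =
    forest_proj I n x \<otimes>\<^bsub>forest_module I\<^esub> forest_proj I n y"
proof -
  obtain c d where cd: "x = forest_class I c" "Poly_Mapping.keys c \<subseteq> oriented_forests I"
    "y = forest_class I d" "Poly_Mapping.keys d \<subseteq> oriented_forests I"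
    using assms by (elim M.in_P_E)
  then have "Poly_Mapping.keys (c + d) \<subseteq> oriented_forests I" using keys_add[of c d] by auto
  with cd show ?thesis
    by (simp add: M.mult_class forest_proj_class degree_part_keys) (simp add: degree_part_def frag_extend_add)
qed

lemma forest_proj_closed:
  "x \<in> carrier (forest_module I) \<Longrightarrow> forest_proj I n x \<in> carrier (forest_module I)"
  by (elim M.in_P_E) (auto simp: forest_proj_class intro!: M.class_in_P degree_part_keys)

lemma tensor_left_add:
  assumes "x \<in> carrier (forest_module I)" "x' \<in> carrier (forest_module I)" "y \<in> carrier (forest_module I)"
  shows "frag_of (x \<otimes>\<^bsub>forest_module I\<^esub> x', y) - frag_of (x, y) - frag_of (x', y) \<in> relT"
  by (rule T.relators_rel, unfold bilinear_rels_def, rule UnI1) (use assms in blast)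

lemma tensor_right_add:
  assumes "x \<in> carrier (forest_module I)" "y' \<in> carrier (forest_module I)" "y \<in> carrier (forest_module I)"
  shows "frag_of (x, y \<otimes>\<^bsub>forest_module I\<^esub> y') - frag_of (x, y) - frag_of (x, y') \<in> relT"
  by (rule T.relators_rel, unfold bilinear_rels_def, rule UnI2) (use assms in blast)

text \<open>The bilinear relations express additivity alone. Applied to 0 + 0 it makes the pair of 0
  and \<open>y\<close> vanish, and applied to - a + a it then yields the sign rule.\<close>

lemma tensor_minus_left:
  assumes "Poly_Mapping.keys a \<subseteq> oriented_forests I" "y \<in> carrier (forest_module I)"
  shows "frag_of (forest_class I (- a), y) + frag_of (forest_class I a, y) \<in> relT"
proof -
  let ?c = "forest_class I"
  have zero: "frag_of (?c 0, y) - frag_of (?c 0, y) - frag_of (?c 0, y) \<in> relT"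
    using tensor_left_add[of "?c 0" "?c 0" y] assms M.mult_class[of 0 0] M.class_in_P[of 0] by simp
  have "frag_of (?c 0, y) - frag_of (?c (- a), y) - frag_of (?c a, y) \<in> relT"
    using tensor_left_add[of "?c (- a)" "?c a" y] assms M.mult_class[of "- a" a] M.class_in_P by simp
  from T.relators_diff[OF T.relators_minus[OF this] zero] show ?thesis by (simp add: add.commute)
qed

lemma tensor_minus_right:
  assumes "Poly_Mapping.keys a \<subseteq> oriented_forests I" "y \<in> carrier (forest_module I)"
  shows "frag_of (y, forest_class I (- a)) + frag_of (y, forest_class I a) \<in> relT"
proof -
  let ?c = "forest_class I"
  have zero: "frag_of (y, ?c 0) - frag_of (y, ?c 0) - frag_of (y, ?c 0) \<in> relT"
    using tensor_right_add[of y "?c 0" "?c 0"] assms M.mult_class[of 0 0] M.class_in_P[of 0] by simp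
  have "frag_of (y, ?c 0) - frag_of (y, ?c (- a)) - frag_of (y, ?c a) \<in> relT"
    using tensor_right_add[of y "?c a" "?c (- a)"] assms M.mult_class[of "- a" a] M.class_in_P by simp
  from T.relators_diff[OF T.relators_minus[OF this] zero] show ?thesis by (simp add: add.commute)
qed

section \<open>The coproduct on representatives\<close>

definition subforests :: "'a forest \<Rightarrow> 'a set \<Rightarrow> 'a forest set" where
  "subforests F N = {F'. is_forest I F' \<and> subforest I F' F \<and> nodes I F' = N}"

lemma finite_subforests: "finite (subforests F N)"
  using finite_forests[OF finite_ground] by (rule rev_finite_subset) (auto simp: subforests_def)

lemma gamma_eq: "gamma I F N = (\<Sum>F'\<in>subforests F N. frag_of F')"
  by (simp add: gamma_def subforests_def)

definition oriented_gamma :: "'a option ext \<Rightarrow> 'a forest \<Rightarrow> 'a set \<Rightarrow> ('a oforest \<Rightarrow>\<^sub>0 int)" where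
  "oriented_gamma ori F N = (\<Sum>F'\<in>subforests F N. frag_of (ori, F'))"

lemma orient_gamma: "orient I ori (gamma I F N) = forest_class I (oriented_gamma ori F N)"
  by (simp add: orient_def gamma_eq oriented_gamma_def frag_extend_sum finite_subforests)

lemma oriented_gamma_keys:
  assumes "ori \<in> maximal_products (insert None (Some ` N))"
  shows "Poly_Mapping.keys (oriented_gamma ori F N) \<subseteq> {x \<in> oriented_forests I. oforest_degree I x = int (card N)}"
proof -
  have "Poly_Mapping.keys (oriented_gamma ori F N) \<subseteq> (\<Union>F'\<in>subforests F N. {(ori, F')})"
    unfolding oriented_gamma_def by (rule order_trans[OF keys_sum]) simp
  also have "\<dots> \<subseteq> {x \<in> oriented_forests I. oforest_degree I x = int (card N)}"
    using assms by (auto simp: subforests_def oriented_forests_def orientations_def oforest_degree_def)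
  finally show ?thesis .
qed

lemma orient_gamma_minus:
  assumes "ori \<in> maximal_products (insert None (Some ` N))"
  shows "orient I (- ori) (gamma I F N) = forest_class I (- oriented_gamma ori F N)"
proof -
  have "oriented_gamma (- ori) F N + oriented_gamma ori F N \<in> relM"
    unfolding oriented_gamma_def sum.distrib[symmetric]
  proof (intro M.relators_sum M.relators_rel)
    fix F' assume "F' \<in> subforests F N"
    with assms have "(ori, F') \<in> oriented_forests I"
      by (auto simp: subforests_def oriented_forests_def orientations_def)
    then show "frag_of (- ori, F') + frag_of (ori, F') \<in> orientation_rels I"
      by (auto simp: orientation_rels_def)
  qed
  then show ?thesis by (simp add: orient_gamma M.class_eq_iff)
qed

lemma orient_gamma_closed:
  assumes "ori \<in> maximal_products (insert None (Some ` N))"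
  shows "orient I ori (gamma I F N) \<in> carrier (forest_module I)"
  unfolding orient_gamma using oriented_gamma_keys[OF assms] by (intro M.class_in_P) auto

text \<open>The choice buried in \<open>coproduct_gen\<close>, named so that facts about it can be
  stated.\<close>

definition splitting :: "'a option ext \<Rightarrow> 'a set \<Rightarrow> 'a set \<Rightarrow> 'a option ext \<times> 'a option ext" where
  "splitting ori N1 N2 = (SOME q. splits_orientation N1 N2 ori q)"

abbreviation decompositions :: "'a forest \<Rightarrow> ('a set \<times> 'a set) set" where
  "decompositions F \<equiv> {(N1, N2). N1 \<union> N2 = nodes I F \<and> N1 \<inter> N2 = {}}"

definition coproduct_summand :: "'a option ext \<Rightarrow> 'a forest \<Rightarrow> 'a set \<times> 'a set
    \<Rightarrow> ('a oforest \<Rightarrow>\<^sub>0 int) set \<times> ('a oforest \<Rightarrow>\<^sub>0 int) set" where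
  "coproduct_summand ori F = (\<lambda>(N1, N2).
     (orient I (fst (splitting ori N1 N2)) (gamma I F N1), orient I (snd (splitting ori N1 N2)) (gamma I F N2)))"

lemma coproduct_gen_eq:
  "coproduct_gen I (ori, F) = (\<Sum>p\<in>decompositions F. frag_of (coproduct_summand ori F p))"
  unfolding coproduct_gen_def coproduct_summand_def splitting_def Let_def
  by (auto intro!: sum.cong split: prod.split)

lemma splits_splitting:
  assumes "(ori, F) \<in> oriented_forests I" "(N1, N2) \<in> decompositions F"
  shows "splits_orientation N1 N2 ori (splitting ori N1 N2)"
  unfolding splitting_def
proof (rule someI_ex, rule splits_orientation_exists)
  show "ori \<in> maximal_products (insert None (Some ` (N1 \<union> N2)))"
    using assms by (auto simp: oriented_forests_def orientations_def)
  have "finite (nodes I F)" using finite_ground by (simp add: nodes_def)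
  moreover have "N1 \<subseteq> nodes I F" "N2 \<subseteq> nodes I F" using assms by auto
  ultimately show "finite N1" "finite N2" by (auto intro: finite_subset)
qed (use assms in auto)

lemma splitting_in:
  assumes "(ori, F) \<in> oriented_forests I" "(N1, N2) \<in> decompositions F"
  shows "fst (splitting ori N1 N2) \<in> maximal_products (insert None (Some ` N1))"
    "snd (splitting ori N1 N2) \<in> maximal_products (insert None (Some ` N2))"
  using splits_orientation_in[of N1 N2 ori "fst (splitting ori N1 N2)" "snd (splitting ori N1 N2)"]
    splits_splitting[OF assms] by auto

text \<open>The splittings chosen for \<open>ori\<close> and for \<open>- ori\<close> are unrelated
  choices. They differ by signs \<open>a\<close> and \<open>b\<close> in the two factors, and
  evaluation at enumerations of the two node sets gives a * b = -1. So exactly one factor changes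
  its sign, and the two summands cancel in the tensor product.\<close>

lemma coproduct_gen_minus:
  assumes "(ori, F) \<in> oriented_forests I"
  shows "coproduct_gen I (- ori, F) + coproduct_gen I (ori, F) \<in> relT"
  unfolding coproduct_gen_eq sum.distrib[symmetric]
proof (intro T.relators_sum)
  fix p assume p: "p \<in> decompositions F"
  obtain N1 N2 where N: "p = (N1, N2)" by (cases p)
  define o1 o2 p1 p2 where "o1 = fst (splitting ori N1 N2)" "o2 = snd (splitting ori N1 N2)"
    "p1 = fst (splitting (- ori) N1 N2)" "p2 = snd (splitting (- ori) N1 N2)"
  note defs = this
  have s: "splits_orientation N1 N2 ori (o1, o2)" "splits_orientation N1 N2 (- ori) (p1, p2)"
    using splits_splitting[OF assms, of N1 N2] splits_splitting[OF minus_oriented_forest[OF assms], of N1 N2] p N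
    by (auto simp: defs)
  note in1 = splits_orientation_in[OF s(1)]
  note in2 = splits_orientation_in[OF s(2)]
  obtain a :: int where a: "a = 1 \<or> a = - 1" "p1 = (\<lambda>z. a * o1 z)"
    using maximal_product_eq_or_minus[OF in2(1) in1(1)] .
  obtain b :: int where b: "b = 1 \<or> b = - 1" "p2 = (\<lambda>z. b * o2 z)"
    using maximal_product_eq_or_minus[OF in2(2) in1(2)] .
  have "finite N1" "finite N2"
    using p N finite_ground by (auto simp: nodes_def intro: finite_subset[of _ I])
  then obtain u v where uv: "distinct u" "set u = N1" "distinct v" "set v = N2"
    using finite_distinct_list by metis
  have disj: "N1 \<inter> N2 = {}" using p N by auto
  have "o1 (map Some u @ [None]) = 1 \<or> o1 (map Some u @ [None]) = - 1"
    by (rule maximal_product_value[OF in1(1) distinct_word_None]) (use uv in auto)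
  moreover have "o2 (map Some v @ [None]) = 1 \<or> o2 (map Some v @ [None]) = - 1"
    by (rule maximal_product_value[OF in1(2) distinct_word_None]) (use uv in auto)
  ultimately have "a * b = - 1"
    using splits_orientation_eval[OF s(1) disj uv] splits_orientation_eval[OF s(2) disj uv] a b
    by auto
  with a b have ab: "a = 1 \<and> b = - 1 \<or> a = - 1 \<and> b = 1" by auto
  have keys: "Poly_Mapping.keys (oriented_gamma o1 F N1) \<subseteq> oriented_forests I"
    "Poly_Mapping.keys (oriented_gamma o2 F N2) \<subseteq> oriented_forests I"
    using oriented_gamma_keys[OF in1(1)] oriented_gamma_keys[OF in1(2)] by blast+
  have "frag_of (orient I p1 (gamma I F N1), orient I p2 (gamma I F N2)) +
      frag_of (orient I o1 (gamma I F N1), orient I o2 (gamma I F N2)) \<in> relT"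
    using ab
  proof
    assume "a = 1 \<and> b = - 1"
    then have "p1 = o1" "p2 = - o2" using a b by (auto simp: fun_eq_iff)
    then show ?thesis
      using tensor_minus_right[OF keys(2) orient_gamma_closed[OF in1(1), of F]]
      by (simp add: orient_gamma_minus[OF in1(2)]) (simp add: orient_gamma)
  next
    assume "a = - 1 \<and> b = 1"
    then have "p1 = - o1" "p2 = o2" using a b by (auto simp: fun_eq_iff)
    then show ?thesis
      using tensor_minus_left[OF keys(1) orient_gamma_closed[OF in1(2), of F]]
      by (simp add: orient_gamma_minus[OF in1(1)]) (simp add: orient_gamma)
  qed
  then show "frag_of (coproduct_summand (- ori) F p) + frag_of (coproduct_summand ori F p) \<in> relT"
    by (simp add: coproduct_summand_def N defs)
qed

lemma coproduct_gen_keys: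
  assumes "x \<in> oriented_forests I"
  shows "Poly_Mapping.keys (coproduct_gen I x) \<subseteq> carrier (forest_module I) \<times> carrier (forest_module I)"
proof -
  obtain ori F where x: "x = (ori, F)" by (cases x)
  have "Poly_Mapping.keys (coproduct_gen I x) \<subseteq> (\<Union>p\<in>decompositions F. {coproduct_summand ori F p})"
    unfolding x coproduct_gen_eq by (rule order_trans[OF keys_sum]) simp
  also have "\<dots> \<subseteq> carrier (forest_module I) \<times> carrier (forest_module I)"
    using assms splitting_in[of ori F]
    by (auto simp: x coproduct_summand_def intro!: orient_gamma_closed)
  finally show ?thesis .
qed

lemma coproduct_class:
  assumes "Poly_Mapping.keys c \<subseteq> oriented_forests I"
  shows "coproduct I (forest_class I c) =
    tensor_class (forest_module I) (forest_module I) (frag_extend (coproduct_gen I) c)"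
  unfolding coproduct_def
proof (rule M.the_elem_image_class[OF assms])
  fix d assume "d - c \<in> relM"
  then have "frag_extend (coproduct_gen I) (d - c) \<in> relT"
  proof (induction rule: M.relators_induct)
    case (rel r)
    then show ?case
      using coproduct_gen_minus by (auto simp: orientation_rels_def frag_extend_add)
  qed (auto simp: frag_extend_add frag_extend_minus intro: T.relators_zero T.relators_add T.relators_minus)
  then show "tensor_class (forest_module I) (forest_module I) (frag_extend (coproduct_gen I) d) =
    tensor_class (forest_module I) (forest_module I) (frag_extend (coproduct_gen I) c)"
    by (simp add: T.class_eq_iff frag_extend_diff)
qed

section \<open>The Koszul pairing and the product of functionals\<close>

lemma koszul_pairing_add:
  assumes "\<phi> \<in> hom (forest_module I) integer_group" "\<psi> \<in> hom (forest_module I) integer_group"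
    and "x \<in> carrier (forest_module I)" "x' \<in> carrier (forest_module I)"
      "y \<in> carrier (forest_module I)" "y' \<in> carrier (forest_module I)"
  shows "koszul_pairing I \<phi> \<psi> (x \<otimes>\<^bsub>forest_module I\<^esub> x') y = koszul_pairing I \<phi> \<psi> x y + koszul_pairing I \<phi> \<psi> x' y"
    "koszul_pairing I \<phi> \<psi> x (y \<otimes>\<^bsub>forest_module I\<^esub> y') = koszul_pairing I \<phi> \<psi> x y + koszul_pairing I \<phi> \<psi> x y'"
proof -
  have hom: "f (forest_proj I n (x \<otimes>\<^bsub>forest_module I\<^esub> y)) = f (forest_proj I n x) + f (forest_proj I n y)"
    if "f \<in> hom (forest_module I) integer_group" "x \<in> carrier (forest_module I)" "y \<in> carrier (forest_module I)"
    for f n x y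
    using hom_mult[OF that(1) forest_proj_closed[OF that(2)] forest_proj_closed[OF that(3)]] forest_proj_mult[OF that(2,3)]
    by (simp add: integer_group_def)
  show "koszul_pairing I \<phi> \<psi> (x \<otimes>\<^bsub>forest_module I\<^esub> x') y = koszul_pairing I \<phi> \<psi> x y + koszul_pairing I \<phi> \<psi> x' y"
    using assms by (simp add: koszul_pairing_def hom algebra_simps sum.distrib)
  show "koszul_pairing I \<phi> \<psi> x (y \<otimes>\<^bsub>forest_module I\<^esub> y') = koszul_pairing I \<phi> \<psi> x y + koszul_pairing I \<phi> \<psi> x y'"
    using assms by (simp add: koszul_pairing_def hom algebra_simps sum.distrib)
qed

lemma koszul_tensor_class:
  assumes "\<phi> \<in> hom (forest_module I) integer_group" "\<psi> \<in> hom (forest_module I) integer_group"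
    and "Poly_Mapping.keys d \<subseteq> carrier (forest_module I) \<times> carrier (forest_module I)"
  shows "koszul_tensor I \<phi> \<psi> (tensor_class (forest_module I) (forest_module I) d) =
    frag_lin (\<lambda>(x, y). koszul_pairing I \<phi> \<psi> x y) d"
proof -
  let ?g = "\<lambda>(x, y). koszul_pairing I \<phi> \<psi> x y"
  have "koszul_tensor I \<phi> \<psi> X = the_elem (frag_lin ?g ` X)" for X
    unfolding koszul_tensor_def frag_lin_def by (simp add: case_prod_unfold)
  moreover have "the_elem (frag_lin ?g ` tensor_class (forest_module I) (forest_module I) d) = frag_lin ?g d"
  proof (rule T.the_elem_image_class[OF assms(3)])
    fix e assume e: "e - d \<in> relT"
    have "frag_lin ?g (e - d) = 0"
      using e
    proof (rule T.frag_lin_relators)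
      fix r assume "r \<in> bilinear_rels (forest_module I) (forest_module I)"
      then show "frag_lin ?g r = 0"
        using koszul_pairing_add[OF assms(1,2)] by (auto simp: bilinear_rels_def frag_lin_diff)
    qed
    then show "frag_lin ?g e = frag_lin ?g d" by (simp add: frag_lin_diff)
  qed
  ultimately show ?thesis by simp
qed

text \<open>A single summand of the double sum survives; the bounds by \<open>card I\<close> keep it
  within the range of summation.\<close>

lemma koszul_pairing_homogeneous:
  assumes "\<phi> \<in> hom (forest_module I) integer_group" "\<psi> \<in> hom (forest_module I) integer_group"
    and "m \<le> card I" "n \<le> card I"
    and "Poly_Mapping.keys c \<subseteq> {x \<in> oriented_forests I. oforest_degree I x = int m}"
    and "Poly_Mapping.keys d \<subseteq> {x \<in> oriented_forests I. oforest_degree I x = int n}"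
  shows "koszul_pairing I \<phi> \<psi> (forest_class I c) (forest_class I d) =
    (-1) ^ (m * n) * \<phi> (forest_class I c) * \<psi> (forest_class I d)"
proof -
  have zero: "f (forest_class I 0) = 0" if "f \<in> hom (forest_module I) integer_group" for f
    using M.hom_class[OF that, of 0] by simp
  have "\<phi> (forest_proj I (int i) (forest_class I c)) = (if i = m then \<phi> (forest_class I c) else 0)"
    "\<psi> (forest_proj I (int j) (forest_class I d)) = (if j = n then \<psi> (forest_class I d) else 0)" for i j
    using zero[OF assms(1)] zero[OF assms(2)]
    by (simp_all add: forest_proj_homogeneous[OF assms(5)] forest_proj_homogeneous[OF assms(6)])
  moreover have "x * (if b then y else 0) = (if b then x * y else 0)"
    "(if b then y else 0) * x = (if b then y * x else 0)" for x y :: int and b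
    by simp_all
  ultimately show ?thesis
    using assms(3,4) by (simp add: koszul_pairing_def mult.commute[of n m])
qed

text \<open>The functionals need not be homogeneous: the second tensor factor has degree
  \<open>card N2\<close> and selects that component of \<open>\<psi>\<close>, which passes a first
  factor of degree \<open>card N1\<close>. Hence the sign.\<close>

definition dual_mult_gen :: "(('a oforest \<Rightarrow>\<^sub>0 int) set \<Rightarrow> int) \<Rightarrow> (('a oforest \<Rightarrow>\<^sub>0 int) set \<Rightarrow> int)
    \<Rightarrow> 'a oforest \<Rightarrow> int" where
  "dual_mult_gen \<phi> \<psi> = (\<lambda>(ori, F). \<Sum>(N1, N2)\<in>decompositions F. (-1) ^ (card N1 * card N2) *
     \<phi> (forest_class I (oriented_gamma (fst (splitting ori N1 N2)) F N1)) *
     \<psi> (forest_class I (oriented_gamma (snd (splitting ori N1 N2)) F N2)))"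

lemma dual_mult_class:
  assumes hom: "\<phi> \<in> hom (forest_module I) integer_group" "\<psi> \<in> hom (forest_module I) integer_group"
    and c: "Poly_Mapping.keys c \<subseteq> oriented_forests I"
  shows "(\<phi> \<otimes>\<^bsub>dual_algebra I\<^esub> \<psi>) (forest_class I c) = frag_lin (dual_mult_gen \<phi> \<psi>) c"
proof -
  have keys: "Poly_Mapping.keys (frag_extend (coproduct_gen I) c)
      \<subseteq> carrier (forest_module I) \<times> carrier (forest_module I)"
    using c by (intro frag_extend_in coproduct_gen_keys) auto
  have "(\<phi> \<otimes>\<^bsub>dual_algebra I\<^esub> \<psi>) (forest_class I c) =
    frag_lin (\<lambda>(x, y). koszul_pairing I \<phi> \<psi> x y) (frag_extend (coproduct_gen I) c)"
    using M.class_in_P[OF c] coproduct_class[OF c] koszul_tensor_class[OF hom keys]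
    by (simp add: dual_algebra_def)
  also have "\<dots> = frag_lin (dual_mult_gen \<phi> \<psi>) c"
    unfolding frag_lin_frag_extend
  proof (rule frag_lin_cong)
    fix x assume "x \<in> Poly_Mapping.keys c"
    then obtain ori F where x: "x = (ori, F)" "(ori, F) \<in> oriented_forests I" using c by (cases x) auto
    show "frag_lin (\<lambda>(x, y). koszul_pairing I \<phi> \<psi> x y) (coproduct_gen I x) = dual_mult_gen \<phi> \<psi> x"
      unfolding x(1) coproduct_gen_eq frag_lin_sum frag_lin_frag_of dual_mult_gen_def prod.case
    proof (rule sum.cong[OF refl])
      fix p assume p: "p \<in> decompositions F"
      obtain N1 N2 where N: "p = (N1, N2)" by (cases p)
      with p have "N1 \<subseteq> I" "N2 \<subseteq> I" by (auto simp: nodes_def)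
      then have "card N1 \<le> card I" "card N2 \<le> card I" using finite_ground by (auto intro: card_mono)
      moreover note splitting_in[OF x(2) p[unfolded N]]
      ultimately show "(case coproduct_summand ori F p of (x, y) \<Rightarrow> koszul_pairing I \<phi> \<psi> x y) =
        (case p of (N1, N2) \<Rightarrow> (-1) ^ (card N1 * card N2) *
          \<phi> (forest_class I (oriented_gamma (fst (splitting ori N1 N2)) F N1)) *
          \<psi> (forest_class I (oriented_gamma (snd (splitting ori N1 N2)) F N2)))"
        by (simp add: coproduct_summand_def N orient_gamma koszul_pairing_homogeneous[OF hom] oriented_gamma_keys)
    qed
  qed
  finally show ?thesis .
qed

end

section \<open>The pairing of words with oriented forests\<close>

lemma frag_extend_frag_extend:
  "frag_extend f (frag_extend g c) = frag_extend (\<lambda>x. frag_extend f (g x)) c"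
  by (simp add: frag_extend_def[of g] frag_extend_def[of "\<lambda>x. frag_extend f (g x)"]
      frag_extend_sum frag_extend_cmul o_def)

lemma lookup_frag_extend:
  "Poly_Mapping.lookup (frag_extend f c) y = frag_lin (\<lambda>x. Poly_Mapping.lookup (f x) y) c"
  by (simp add: frag_extend_def lookup_sum frag_lin_def)

lemma frag_lin_diff_fun: "frag_lin (\<lambda>x. f x - g x) c = frag_lin f c - frag_lin g c"
  using frag_lin_add_fun[of f "\<lambda>x. - g x" c] by (simp add: frag_lin_minus_fun)

lemma word_mult_frag_of [simp]: "word_mult (frag_of u) (frag_of v) = frag_of (u @ v)"
  by (simp add: word_mult_def)

lemma word_mult_assoc: "word_mult (word_mult p q) r = word_mult p (word_mult q r)"
  by (simp add: word_mult_def frag_extend_frag_extend)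

lemma word_mult_add_left: "word_mult (p + q) r = word_mult p r + word_mult q r"
  by (simp add: word_mult_def frag_extend_add)

lemma word_mult_add_right: "word_mult p (q + r) = word_mult p q + word_mult p r"
  by (simp add: word_mult_def frag_extend_add frag_extend_add_fun)

lemma frag_lin_word_mult: "frag_lin f (word_mult p q) = frag_lin (\<lambda>u. frag_lin (\<lambda>v. f (u @ v)) q) p"
  by (simp add: word_mult_def frag_lin_frag_extend)

lemma word_mult_keys:
  assumes "Poly_Mapping.keys p \<subseteq> lists S" "Poly_Mapping.keys q \<subseteq> lists S"
  shows "Poly_Mapping.keys (word_mult p q) \<subseteq> lists S"
  unfolding word_mult_def using assms by (intro frag_extend_in) auto

lemma ring_free_algebra: "ring (free_algebra S)"
proof (rule ringI)
  show "abelian_group (free_algebra S)"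
  proof (rule abelian_groupI)
    show "\<exists>y\<in>carrier (free_algebra S). y \<oplus>\<^bsub>free_algebra S\<^esub> x = \<zero>\<^bsub>free_algebra S\<^esub>"
      if "x \<in> carrier (free_algebra S)" for x
      using that by (intro bexI[of _ "- x"]) (auto simp: free_algebra_def)
    show "x \<oplus>\<^bsub>free_algebra S\<^esub> y \<in> carrier (free_algebra S)"
      if "x \<in> carrier (free_algebra S)" "y \<in> carrier (free_algebra S)" for x y
      using that keys_add[of x y] by (auto simp: free_algebra_def)
  qed (auto simp: free_algebra_def add_ac)
  show "monoid (free_algebra S)"
  proof (rule monoidI)
    have "word_mult (frag_of []) x = x" "word_mult x (frag_of []) = x" for x :: "'a list \<Rightarrow>\<^sub>0 int"
      by (simp_all add: word_mult_def flip: frag_expansion)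
    then show "\<one>\<^bsub>free_algebra S\<^esub> \<otimes>\<^bsub>free_algebra S\<^esub> x = x" "x \<otimes>\<^bsub>free_algebra S\<^esub> \<one>\<^bsub>free_algebra S\<^esub> = x" for x
      by (simp_all add: free_algebra_def)
  qed (simp_all add: free_algebra_def word_mult_assoc word_mult_keys)
qed (auto simp: free_algebra_def word_mult_add_left word_mult_add_right)

text \<open>
  The factor that absorbs the Koszul sign \<open>(-1)^(m * n)\<close> of the dual product, so that the pairing
  of a concatenation of words is a product of pairings.
\<close>

definition triangular_sign :: "nat \<Rightarrow> int" where
  "triangular_sign n = (-1) ^ (\<Sum>i<n. i)"

lemma triangular_sign_0 [simp]: "triangular_sign 0 = 1"
  by (simp add: triangular_sign_def)

lemma triangular_sign_cases: "triangular_sign n = 1 \<or> triangular_sign n = - 1"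
  unfolding triangular_sign_def by (metis neg_one_even_power neg_one_odd_power)

text \<open>The exponent is the binomial coefficient n over 2, and (m + n) over 2 exceeds the sum of
  m over 2 and n over 2 by m * n.\<close>

lemma triangular_sign_add:
  "triangular_sign (m + n) = (-1) ^ (m * n) * triangular_sign m * triangular_sign n"
  by (induction n) (simp_all add: triangular_sign_def power_add algebra_simps)

context finite_ground
begin

definition strict_order :: "'a forest \<Rightarrow> ('a \<times> 'a) set" where
  "strict_order F = {(i, j). j \<in> I \<and> i \<noteq> j \<and> forest_le F i j}"

lemma strict_order_forest_of:
  assumes "arborescence I S"
  shows "strict_order (forest_of I S) = S\<^sup>+"
proof -
  interpret arborescence I S by fact
  have "(i, j) \<in> strict_order (forest_of I S) \<longleftrightarrow> (i, j) \<in> S\<^sup>+" for i j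
    using forest_le_iff[of j i] trancl_sub irrefl
    by (auto simp: strict_order_def dest: rtranclD)
  then show ?thesis by auto
qed

lemma arborescence_of_forest:
  assumes "is_forest I F"
  obtains S where "arborescence I S" "F = forest_of I S"
  using forest_of_surj[OF finite_ground assms] .

text \<open>
  The arc \<open>(i, k)\<close> of a word is read as \<open>i\<close> lying strictly below \<open>k\<close> in \<open>F\<close>, not as an edge of \<open>F\<close>.
\<close>

definition word_pairing :: "('a \<times> 'a) list \<Rightarrow> 'a oforest \<Rightarrow> int" where
  "word_pairing w = (\<lambda>(ori, F).
     if distinct (map snd w) \<and> snd ` set w = nodes I F \<and> set w \<subseteq> strict_order F
     then triangular_sign (length w) * ori (map Some (map snd w) @ [None]) else 0)"

definition pairing :: "(('a \<times> 'a) list \<Rightarrow>\<^sub>0 int) \<Rightarrow> 'a oforest \<Rightarrow> int" where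
  "pairing p x = frag_lin (\<lambda>w. word_pairing w x) p"

lemma word_pairing_minus: "word_pairing w (- ori, F) = - word_pairing w (ori, F)"
  by (simp add: word_pairing_def)

lemma pairing_minus: "pairing p (- ori, F) = - pairing p (ori, F)"
  by (simp add: pairing_def word_pairing_minus frag_lin_minus_fun)

definition to_dual :: "(('a \<times> 'a) list \<Rightarrow>\<^sub>0 int) \<Rightarrow> ('a oforest \<Rightarrow>\<^sub>0 int) set \<Rightarrow> int" where
  "to_dual p = (\<lambda>X\<in>carrier (forest_module I). the_elem (frag_lin (pairing p) ` X))"

lemma to_dual_class:
  assumes "Poly_Mapping.keys c \<subseteq> oriented_forests I"
  shows "to_dual p (forest_class I c) = frag_lin (pairing p) c"
  unfolding to_dual_def using M.class_in_P[OF assms] the_elem_lin_class[OF assms, of "pairing p", OF pairing_minus] by simp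

lemma to_dual_hom: "to_dual p \<in> hom (forest_module I) integer_group"
proof (rule homI)
  fix x y assume "x \<in> carrier (forest_module I)" "y \<in> carrier (forest_module I)"
  then obtain c d where cd: "x = forest_class I c" "Poly_Mapping.keys c \<subseteq> oriented_forests I"
    "y = forest_class I d" "Poly_Mapping.keys d \<subseteq> oriented_forests I"
    by (elim M.in_P_E)
  then have "Poly_Mapping.keys (c + d) \<subseteq> oriented_forests I" using keys_add[of c d] by auto
  with cd show "to_dual p (x \<otimes>\<^bsub>forest_module I\<^esub> y) = to_dual p x \<otimes>\<^bsub>integer_group\<^esub> to_dual p y"
    by (simp add: M.mult_class to_dual_class frag_lin_add integer_group_def)
qed (simp add: integer_group_def)

lemma to_dual_carrier: "to_dual p \<in> carrier (dual_algebra I)"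
  using to_dual_hom[of p] by (auto simp: dual_algebra_def to_dual_def)

lemma dual_carrier_eqI:
  assumes "\<phi> \<in> carrier (dual_algebra I)" "\<psi> \<in> carrier (dual_algebra I)"
    and "\<And>x. x \<in> oriented_forests I \<Longrightarrow> \<phi> (forest_class I (frag_of x)) = \<psi> (forest_class I (frag_of x))"
  shows "\<phi> = \<psi>"
proof
  fix X
  show "\<phi> X = \<psi> X"
  proof (cases "X \<in> carrier (forest_module I)")
    case True
    then obtain c where c: "X = forest_class I c" "Poly_Mapping.keys c \<subseteq> oriented_forests I"
      by (elim M.in_P_E)
    have hom: "\<phi> \<in> hom (forest_module I) integer_group" "\<psi> \<in> hom (forest_module I) integer_group"
      using assms(1,2) by (auto simp: dual_algebra_def)
    show ?thesis
      unfolding c(1) M.hom_class[OF hom(1) c(2)] M.hom_class[OF hom(2) c(2)]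
      using c(2) by (intro frag_lin_cong assms(3)) auto
  next
    case False
    then show ?thesis
      using assms(1,2) by (auto simp: dual_algebra_def extensional_def)
  qed
qed

section \<open>Multiplicativity of the pairing\<close>

lemma subforest_strict_mono:
  assumes "is_forest I F" "F' \<in> subforests F N"
  shows "strict_order F' \<subseteq> strict_order F"
proof -
  obtain S where S: "arborescence I S" "F = forest_of I S" using arborescence_of_forest[OF assms(1)] .
  obtain S' where S': "arborescence I S'" "F' = forest_of I S'"
    using arborescence_of_forest[of F'] assms(2) by (auto simp: subforests_def)
  have "S' \<subseteq> S\<^sup>+"
    using assms(2) subforest_forest_of_iff[OF S(1) S'(1)] S(2) S'(2) by (auto simp: subforests_def)
  from trancl_subset_trancl[OF this] S S' show ?thesis by (simp add: strict_order_forest_of)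
qed

text \<open>Unique existence turned into a count. It makes the sum over the terms of \<gamma>(F,N)
  of indicator values an indicator value again, now expressed by the order of \<open>F\<close>
  itself.\<close>

lemma card_subforests_above:
  assumes "is_forest I F" "inj_on snd U" "snd ` U = N"
  shows "card {F' \<in> subforests F N. U \<subseteq> strict_order F'} = (if U \<subseteq> strict_order F then 1 else 0)"
proof (cases "U \<subseteq> strict_order F")
  case True
  obtain S where S: "arborescence I S" "F = forest_of I S" using arborescence_of_forest[OF assms(1)] .
  have "U \<subseteq> S\<^sup>+" using True S by (simp add: strict_order_forest_of)
  define Q where "Q T \<longleftrightarrow> arborescence I T \<and> subforest I (forest_of I T) F \<and> snd ` T = snd ` U \<and> U \<subseteq> T\<^sup>+" for T
  have "\<exists>!T. Q T"
    unfolding Q_def S(2) using ex1_subforest_above[OF S(1) \<open>U \<subseteq> S\<^sup>+\<close> assms(2)] .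
  then obtain T where "Q T" and uniq: "\<And>V. Q V \<Longrightarrow> V = T" by blast
  from \<open>Q T\<close> have T: "arborescence I T" "subforest I (forest_of I T) F" "snd ` T = snd ` U" "U \<subseteq> T\<^sup>+"
    unfolding Q_def by blast+
  have "{F' \<in> subforests F N. U \<subseteq> strict_order F'} = {forest_of I T}"
  proof (intro equalityI subsetI)
    fix F' assume F': "F' \<in> {F' \<in> subforests F N. U \<subseteq> strict_order F'}"
    then have "is_forest I F'" by (auto simp: subforests_def)
    then obtain V where V: "arborescence I V" "F' = forest_of I V" by (rule arborescence_of_forest)
    have "V = T"
      proof (rule uniq)
      show "Q V"
        using F' V(2) assms(3) arborescence.nodes_forest_of[OF V(1)]
        by (simp add: Q_def V(1) subforests_def strict_order_forest_of)
    qed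
    with V show "F' \<in> {forest_of I T}" by simp
  next
    fix F' assume "F' \<in> {forest_of I T}"
    with T assms(3) arborescence.nodes_forest_of[OF T(1)] arborescence.is_forest_forest_of[OF T(1)]
    show "F' \<in> {F' \<in> subforests F N. U \<subseteq> strict_order F'}"
      by (auto simp: subforests_def strict_order_forest_of)
  qed
  with True show ?thesis by simp
next
  case False
  with subforest_strict_mono[OF assms(1)] have "{F' \<in> subforests F N. U \<subseteq> strict_order F'} = {}" by blast
  with False show ?thesis by (simp only: card.empty if_False)
qed

text \<open>The value of a word on all of \<gamma>(F,N): the children are compared with
  \<open>N\<close>, but the inequalities are tested in the big forest \<open>F\<close>.\<close>

definition gamma_pairing :: "'a forest \<Rightarrow> 'a option ext \<Rightarrow> 'a set \<Rightarrow> ('a \<times> 'a) list \<Rightarrow> int" where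
  "gamma_pairing F ori N w =
     (if distinct (map snd w) \<and> snd ` set w = N \<and> set w \<subseteq> strict_order F
      then triangular_sign (length w) * ori (map Some (map snd w) @ [None]) else 0)"

lemma word_pairing_gamma:
  assumes "is_forest I F"
  shows "frag_lin (word_pairing w) (oriented_gamma ori F N) = gamma_pairing F ori N w"
proof -
  have "frag_lin (word_pairing w) (oriented_gamma ori F N) = (\<Sum>F'\<in>subforests F N. word_pairing w (ori, F'))"
    by (simp add: oriented_gamma_def frag_lin_sum)
  also have "\<dots> = (\<Sum>F'\<in>subforests F N. if distinct (map snd w) \<and> snd ` set w = N \<and> set w \<subseteq> strict_order F'
     then triangular_sign (length w) * ori (map Some (map snd w) @ [None]) else 0)"
    by (intro sum.cong refl) (auto simp: word_pairing_def subforests_def)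
  also have "\<dots> = gamma_pairing F ori N w"
  proof (cases "distinct (map snd w) \<and> snd ` set w = N")
    case True
    then have "(\<Sum>F'\<in>subforests F N. if distinct (map snd w) \<and> snd ` set w = N \<and> set w \<subseteq> strict_order F'
     then triangular_sign (length w) * ori (map Some (map snd w) @ [None]) else 0)
      = (\<Sum>F'\<in>{F' \<in> subforests F N. set w \<subseteq> strict_order F'}. triangular_sign (length w) * ori (map Some (map snd w) @ [None]))"
      by (simp add: sum.inter_filter[OF finite_subforests, symmetric])
    moreover have "inj_on snd (set w)" using True by (simp add: distinct_map)
    ultimately show ?thesis
      using True card_subforests_above[OF assms, of "set w" N] by (simp add: gamma_pairing_def)
  next
    case False
    then have no: "(distinct (map snd w) \<and> snd ` set w = N \<and> P) = False" for P by blast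
    show ?thesis unfolding gamma_pairing_def no by simp
  qed
  finally show ?thesis .
qed

lemma to_dual_gamma:
  assumes "is_forest I F" "ori \<in> maximal_products (insert None (Some ` N))"
  shows "to_dual p (forest_class I (oriented_gamma ori F N)) = frag_lin (gamma_pairing F ori N) p"
proof -
  have "Poly_Mapping.keys (oriented_gamma ori F N) \<subseteq> oriented_forests I"
    using oriented_gamma_keys[OF assms(2)] by blast
  then have "to_dual p (forest_class I (oriented_gamma ori F N))
    = frag_lin (\<lambda>x. frag_lin (\<lambda>w. word_pairing w x) p) (oriented_gamma ori F N)"
    by (simp add: to_dual_class pairing_def[abs_def])
  also have "\<dots> = frag_lin (\<lambda>w. frag_lin (word_pairing w) (oriented_gamma ori F N)) p"
    by (rule frag_lin_swap)
  finally show ?thesis by (simp add: word_pairing_gamma[OF assms(1)])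
qed

text \<open>The only decomposition that can contribute has the children of \<open>u\<close> as first
  part and those of \<open>v\<close> as second part. In its summand the Koszul sign and the
  triangular signs of \<open>u\<close> and \<open>v\<close> combine to that of \<open>u @ v\<close>,
  and the orientation values multiply.\<close>

lemma word_pairing_append:
  assumes "(ori, F) \<in> oriented_forests I"
  shows "word_pairing (u @ v) (ori, F) =
    (\<Sum>(N1, N2)\<in>decompositions F. (-1) ^ (card N1 * card N2) *
      gamma_pairing F (fst (splitting ori N1 N2)) N1 u * gamma_pairing F (snd (splitting ori N1 N2)) N2 v)"
    (is "_ = sum ?f _")
proof -
  let ?U = "snd ` set u" and ?V = "snd ` set v"
  have zero: "?f q = 0" if "q \<noteq> (?U, ?V)" for q
    using that by (auto simp: gamma_pairing_def split: prod.split)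
  have fin: "finite (decompositions F)"
    by (rule finite_subset[of _ "Pow I \<times> Pow I"]) (auto simp: finite_ground nodes_def)
  show ?thesis
  proof (cases "(?U, ?V) \<in> decompositions F")
    case True
    have "sum ?f (decompositions F) = sum ?f {(?U, ?V)}"
    proof (rule sum.mono_neutral_right[OF fin])
      show "{(?U, ?V)} \<subseteq> decompositions F" using True by simp
      show "\<forall>q\<in>decompositions F - {(?U, ?V)}. ?f q = 0" by (intro ballI zero) simp
    qed
    also have "\<dots> = ?f (?U, ?V)" by simp
    also have "\<dots> = word_pairing (u @ v) (ori, F)"
    proof (cases "distinct (map snd u) \<and> distinct (map snd v) \<and> set u \<subseteq> strict_order F \<and> set v \<subseteq> strict_order F")
      case d: True
      let ?o = "splitting ori ?U ?V"
      have "splits_orientation ?U ?V ori (fst ?o, snd ?o)"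
        using splits_splitting[OF assms True] by simp
      from splits_orientation_eval[OF this, of "map snd u" "map snd v"] True d
      have "ori (map Some (map snd u) @ map Some (map snd v) @ [None]) =
        fst ?o (map Some (map snd u) @ [None]) * snd ?o (map Some (map snd v) @ [None])" by auto
      moreover have "card ?U = length u" "card ?V = length v"
        using d by (metis distinct_card length_map list.set_map)+
      moreover have "?U \<union> ?V = nodes I F" "?U \<inter> ?V = {}" using True by auto
      ultimately show ?thesis
        using d by (simp add: word_pairing_def gamma_pairing_def triangular_sign_add image_Un)
    qed (auto simp: word_pairing_def gamma_pairing_def)
    finally show ?thesis by simp
  next
    case False
    \<comment> \<open>Either the children of \<open>u\<close> and \<open>v\<close> overlap, so that
      \<open>u @ v\<close> repeats a child, or together they are not the nodes of
      \<open>F\<close>.\<close>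
    then have "word_pairing (u @ v) (ori, F) = 0"
      by (auto simp: word_pairing_def image_Un)
    moreover have "sum ?f (decompositions F) = 0"
    proof (intro sum.neutral ballI zero)
      show "q \<noteq> (?U, ?V)" if "q \<in> decompositions F" for q using that False by blast
    qed
    ultimately show ?thesis by simp
  qed
qed

lemma dual_mult_gen_to_dual:
  assumes x: "x \<in> oriented_forests I"
  shows "dual_mult_gen (to_dual p) (to_dual q) x = pairing (word_mult p q) x"
proof -
  obtain ori F where xF: "x = (ori, F)" by (cases x)
  have F: "is_forest I F" "(ori, F) \<in> oriented_forests I" using x by (auto simp: xF oriented_forests_def)
  have "dual_mult_gen (to_dual p) (to_dual q) x =
    (\<Sum>(N1, N2)\<in>decompositions F. (-1) ^ (card N1 * card N2) *
      frag_lin (gamma_pairing F (fst (splitting ori N1 N2)) N1) p * frag_lin (gamma_pairing F (snd (splitting ori N1 N2)) N2) q)"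
    unfolding dual_mult_gen_def xF prod.case
    using splitting_in[OF F(2)] by (intro sum.cong refl) (auto simp: to_dual_gamma[OF F(1)])
  also have "\<dots> = (\<Sum>d\<in>decompositions F. frag_lin (\<lambda>u. frag_lin (\<lambda>v. case d of (N1, N2) \<Rightarrow> (-1) ^ (card N1 * card N2) *
      gamma_pairing F (fst (splitting ori N1 N2)) N1 u * gamma_pairing F (snd (splitting ori N1 N2)) N2 v) q) p)"
    by (intro sum.cong refl) (auto simp: frag_lin_mult_left frag_lin_mult_right split: prod.split)
  also have "\<dots> = frag_lin (\<lambda>u. frag_lin (\<lambda>v. word_pairing (u @ v) x) q) p"
    unfolding xF word_pairing_append[OF F(2)] frag_lin_sum_fun by simp
  finally show ?thesis by (simp add: pairing_def frag_lin_word_mult)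
qed

lemma to_dual_mult: "to_dual (word_mult p q) = to_dual p \<otimes>\<^bsub>dual_algebra I\<^esub> to_dual q"
proof
  fix X
  show "to_dual (word_mult p q) X = (to_dual p \<otimes>\<^bsub>dual_algebra I\<^esub> to_dual q) X"
  proof (cases "X \<in> carrier (forest_module I)")
    case True
    then obtain c where c: "X = forest_class I c" "Poly_Mapping.keys c \<subseteq> oriented_forests I"
      by (elim M.in_P_E)
    show ?thesis
      unfolding c(1) dual_mult_class[OF to_dual_hom to_dual_hom c(2)] to_dual_class[OF c(2)]
      using c(2) by (intro frag_lin_cong) (auto simp: dual_mult_gen_to_dual)
  qed (simp add: to_dual_def dual_algebra_def)
qed

lemma to_dual_add: "to_dual (p + q) = to_dual p \<oplus>\<^bsub>dual_algebra I\<^esub> to_dual q"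
proof
  fix X
  show "to_dual (p + q) X = (to_dual p \<oplus>\<^bsub>dual_algebra I\<^esub> to_dual q) X"
  proof (cases "X \<in> carrier (forest_module I)")
    case True
    then obtain c where c: "X = forest_class I c" "Poly_Mapping.keys c \<subseteq> oriented_forests I"
      by (elim M.in_P_E)
    then show ?thesis
      using True by (simp add: dual_algebra_def to_dual_class pairing_def[abs_def] frag_lin_add frag_lin_add_fun)
  qed (simp add: to_dual_def dual_algebra_def)
qed

lemma to_dual_zero: "to_dual 0 = \<zero>\<^bsub>dual_algebra I\<^esub>"
proof
  fix X
  show "to_dual 0 X = \<zero>\<^bsub>dual_algebra I\<^esub> X"
  proof (cases "X \<in> carrier (forest_module I)")
    case True
    then obtain c where c: "X = forest_class I c" "Poly_Mapping.keys c \<subseteq> oriented_forests I"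
      by (elim M.in_P_E)
    then show ?thesis
      using True by (simp add: dual_algebra_def to_dual_class pairing_def[abs_def]) (simp add: frag_lin_def)
  qed (simp add: to_dual_def dual_algebra_def)
qed

section \<open>Counit and empty word\<close>

lemma arborescence_empty: "arborescence I {}"
  using finite_ground by unfold_locales (auto simp: acyclic_def)

lemma discrete_forest:
  assumes "(ori, F) \<in> oriented_forests I" "nodes I F = {}"
  shows "F = Forest {} I" "ori = (\<lambda>z. ori [None] * wedge [None] z)"
proof -
  obtain S where S: "arborescence I S" "F = forest_of I S"
    using arborescence_of_forest assms by (auto simp: oriented_forests_def)
  with assms(2) have "S = {}" using arborescence.nodes_forest_of[OF S(1)] by auto
  with S show "F = Forest {} I" by (simp add: forest_of_def)
  have "ori \<in> maximal_products {None}" using assms by (auto simp: oriented_forests_def orientations_def)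
  then show "ori = (\<lambda>z. ori [None] * wedge [None] z)" by (rule maximal_product_eq_wedge) auto
qed

lemma discrete_oriented_forest: "(wedge [None], Forest {} I) \<in> oriented_forests I"
proof -
  have "(\<lambda>z. 1 * wedge [None] z) \<in> maximal_products {None :: 'a option}"
    by (rule wedge_maximal_product) auto
  moreover have "is_forest I (Forest {} I)"
    using arborescence.is_forest_forest_of[OF arborescence_empty] by (simp add: forest_of_def)
  ultimately show ?thesis by (simp add: oriented_forests_def orientations_def nodes_def)
qed

lemma pairing_one:
  "pairing (frag_of []) (ori, F) = (if nodes I F = {} then ori [None] else 0)"
  by (auto simp: pairing_def word_pairing_def)

text \<open>An oriented forest without nodes is the discrete one with orientation R or -R, and its
  pairing with the empty word is this sign. Modulo the orientation relation it is therefore that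
  multiple of the generator.\<close>

lemma degree_part_0_eq:
  assumes "Poly_Mapping.keys c \<subseteq> oriented_forests I"
  shows "forest_class I (degree_part 0 c) =
    forest_class I (frag_cmul (frag_lin (pairing (frag_of [])) c) (frag_of (wedge [None], Forest {} I)))"
proof -
  let ?b = "frag_of (wedge [None], Forest {} I)"
  have "degree_part 0 c - frag_cmul (frag_lin (pairing (frag_of [])) c) ?b =
    frag_extend (\<lambda>x. (if oforest_degree I x = 0 then frag_of x else 0) - frag_cmul (pairing (frag_of []) x) ?b) c"
    by (rule poly_mapping_eqI)
      (simp add: degree_part_def lookup_minus lookup_frag_extend frag_lin_diff_fun frag_lin_mult_right del: lookup_frag_of)
  also have "\<dots> \<in> relM"
  proof (rule M.relators_frag_extend)
    fix x assume "x \<in> Poly_Mapping.keys c"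
    then obtain ori F where x: "x = (ori, F)" "(ori, F) \<in> oriented_forests I" using assms by (cases x) auto
    have fin: "finite (nodes I F)" using finite_ground by (simp add: nodes_def)
    show "(if oforest_degree I x = 0 then frag_of x else 0) - frag_cmul (pairing (frag_of []) x) ?b \<in> relM"
    proof (cases "nodes I F = {}")
      case True
      note disc = discrete_forest[OF x(2) True]
      have "ori \<in> maximal_products {None}" using x True by (auto simp: oriented_forests_def orientations_def)
      then consider "ori [None] = 1" | "ori [None] = - 1" using maximal_product_value[of ori "{None}" "[None]"] by auto
      then show ?thesis
      proof cases
        case 1
        have "ori = wedge [None]" using disc(2) unfolding 1 by simp
        with x disc(1) have "x = (wedge [None], Forest {} I)" by simp
        moreover have "pairing (frag_of []) x = 1" "oforest_degree I x = 0"
          using x(1) True 1 by (simp_all add: pairing_one oforest_degree_def)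
        ultimately show ?thesis by (simp add: M.relators_zero)
      next
        case 2
        have "ori = - wedge [None]" using disc(2) unfolding 2 by (simp add: fun_eq_iff)
        with x disc(1) have "x = (- wedge [None], Forest {} I)" by simp
        moreover have "pairing (frag_of []) x = - 1" "oforest_degree I x = 0"
          using x(1) True 2 by (simp_all add: pairing_one oforest_degree_def)
        ultimately have "(if oforest_degree I x = 0 then frag_of x else 0) - frag_cmul (pairing (frag_of []) x) ?b
          = frag_of (- wedge [None], Forest {} I) + frag_of (wedge [None], Forest {} I)"
          by simp
        also have "\<dots> \<in> relM"
          by (rule M.relators_rel, unfold orientation_rels_def) (use discrete_oriented_forest in blast)
        finally show ?thesis .
      qed
    qed (use x fin in \<open>simp add: pairing_one oforest_degree_def M.relators_zero\<close>)
  qed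
  finally show ?thesis by (simp add: M.class_eq_iff)
qed

lemma counit_class:
  assumes "Poly_Mapping.keys c \<subseteq> oriented_forests I"
  shows "counit I (forest_class I c) = frag_lin (pairing (frag_of [])) c"
  unfolding counit_def forest_proj_class[OF assms] degree_part_0_eq[OF assms]
proof (rule the_equality, rule refl)
  fix z
  let ?b = "frag_of (wedge [None], Forest {} I)"
  assume *: "forest_class I (frag_cmul (frag_lin (pairing (frag_of [])) c) ?b) = forest_class I (frag_cmul z ?b)"
  have keys: "Poly_Mapping.keys (frag_cmul k ?b) \<subseteq> oriented_forests I" for k
    using keys_cmul[of k ?b] discrete_oriented_forest by auto
  \<comment> \<open>The functional of the empty word reads off the coefficient, which makes it
    unique; this is what the definite description in \<open>counit\<close> needs.\<close>
  have "to_dual (frag_of []) (forest_class I (frag_cmul k ?b)) = k" for k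
    using wedge_same[of "[None :: 'a option]"]
    by (simp add: to_dual_class[OF keys] frag_lin_cmul pairing_one nodes_def)
  with * show "z = frag_lin (pairing (frag_of [])) c" by metis
qed

lemma to_dual_one: "to_dual (frag_of []) = \<one>\<^bsub>dual_algebra I\<^esub>"
proof
  fix X
  show "to_dual (frag_of []) X = \<one>\<^bsub>dual_algebra I\<^esub> X"
  proof (cases "X \<in> carrier (forest_module I)")
    case True
    then obtain c where c: "X = forest_class I c" "Poly_Mapping.keys c \<subseteq> oriented_forests I"
      by (elim M.in_P_E)
    with True show ?thesis by (simp add: dual_algebra_def counit_class to_dual_class)
  qed (simp add: to_dual_def dual_algebra_def)
qed

lemma to_dual_ring_hom: "to_dual \<in> ring_hom (free_algebra (Omega_gens I)) (dual_algebra I)"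
  by (rule ring_hom_memI)
    (simp_all add: to_dual_carrier to_dual_mult to_dual_add to_dual_one free_algebra_def)

end

section \<open>Unitriangularity of the pairing\<close>

text \<open>A triangular matrix with diagonal entries 1 or -1 is invertible over the integers. The
  system is solved rank by rank upwards, and uniqueness follows by induction on the rank of the
  index.\<close>

lemma
  fixes M :: "'s \<Rightarrow> 's \<Rightarrow> int" and rank :: "'s \<Rightarrow> nat"
  assumes "finite A" and diag: "\<And>s. s \<in> A \<Longrightarrow> M s s = 1 \<or> M s s = - 1"
    and tri: "\<And>s t. s \<in> A \<Longrightarrow> t \<in> A \<Longrightarrow> M s t \<noteq> 0 \<Longrightarrow> s = t \<or> rank s < rank t"
  shows triangular_system_solve: "\<exists>c. \<forall>t\<in>A. (\<Sum>s\<in>A. c s * M s t) = f t"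
    and triangular_system_unique:
      "\<And>c. (\<And>t. t \<in> A \<Longrightarrow> (\<Sum>s\<in>A. c s * M s t) = 0) \<Longrightarrow> s \<in> A \<Longrightarrow> c s = 0"
proof -
  have "\<exists>c. \<forall>t\<in>A. rank t < n \<longrightarrow> (\<Sum>s\<in>A. c s * M s t) = f t" for n
  proof (induction n)
    case (Suc n)
    then obtain c where c: "\<And>t. t \<in> A \<Longrightarrow> rank t < n \<Longrightarrow> (\<Sum>s\<in>A. c s * M s t) = f t" by blast
    \<comment> \<open>Correction at indices of rank \<open>n\<close> only. It leaves the equations
      of smaller rank alone and meets one of rank \<open>n\<close> through the diagonal;
      multiplication by \<open>M s s\<close> stands for division, since the entry is its own
      inverse.\<close>
    define d where "d s = (if rank s = n then M s s * (f s - (\<Sum>r\<in>A. c r * M r s)) else 0)" for s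
    have step: "(\<Sum>s\<in>A. (c s + d s) * M s t) = f t" if t: "t \<in> A" "rank t < Suc n" for t
    proof -
      have zero: "d s * M s t = 0" if "s \<in> A" "s \<noteq> t" for s
        using tri[OF that(1) t(1)] that t(2) by (auto simp: d_def)
      have "(\<Sum>s\<in>A. (c s + d s) * M s t) = (\<Sum>s\<in>A. c s * M s t) + (\<Sum>s\<in>A. d s * M s t)"
        by (simp add: algebra_simps sum.distrib)
      also have "(\<Sum>s\<in>A. d s * M s t) = d t * M t t"
        using sum.remove[OF assms(1) t(1), of "\<lambda>s. d s * M s t"] sum.neutral[of "A - {t}" "\<lambda>s. d s * M s t"] zero
        by simp
      also have "(\<Sum>s\<in>A. c s * M s t) + d t * M t t = f t"
      proof (cases "rank t = n")
        case True
        have "M t t * M t t = 1" using diag[OF t(1)] by auto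
        then have "d t * M t t = f t - (\<Sum>r\<in>A. c r * M r t)"
          using True by (simp add: d_def mult.commute mult.left_commute)
        then show ?thesis by simp
      next
        case False
        then have "d t = 0" "rank t < n" using t(2) by (simp_all add: d_def)
        with c[OF t(1)] show ?thesis by simp
      qed
      finally show ?thesis .
    qed
    show ?case by (intro exI[of _ "\<lambda>s. c s + d s"] ballI impI) (rule step)
  qed simp
  from this[of "Suc (Max (rank ` A))"] obtain c where
    c: "\<And>t. t \<in> A \<Longrightarrow> rank t < Suc (Max (rank ` A)) \<Longrightarrow> (\<Sum>s\<in>A. c s * M s t) = f t" by blast
  have "rank t < Suc (Max (rank ` A))" if "t \<in> A" for t
    using assms(1) that by (simp add: less_Suc_eq_le)
  with c show "\<exists>c. \<forall>t\<in>A. (\<Sum>s\<in>A. c s * M s t) = f t" by blast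
next
  fix c assume sum0: "\<And>t. t \<in> A \<Longrightarrow> (\<Sum>s\<in>A. c s * M s t) = 0"
  show "s \<in> A \<Longrightarrow> c s = 0"
  proof (induction "rank s" arbitrary: s rule: less_induct)
    case less
    have "c r * M r s = 0" if "r \<in> A" "r \<noteq> s" for r
      using tri[OF that(1) less.prems] less.hyps[OF _ that(1)] that(2) by (cases "M r s = 0") auto
    then have "(\<Sum>r\<in>A. c r * M r s) = c s * M s s"
      using sum.remove[OF assms(1) less.prems, of "\<lambda>r. c r * M r s"] sum.neutral[of "A - {s}" "\<lambda>r. c r * M r s"]
      by simp
    with sum0[OF less.prems] have "c s * M s s = 0" by (metis (no_types))
    moreover have "M s s \<noteq> 0" using diag[OF less.prems] by linarith
    ultimately show ?case by simp
  qed
qed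

context finite_ground
begin

section \<open>Forest monomials against a basis of oriented forests\<close>

definition node_list :: "'a set \<Rightarrow> 'a list" where
  "node_list N = (SOME xs. distinct xs \<and> set xs = N)"

lemma node_list: "finite N \<Longrightarrow> distinct (node_list N) \<and> set (node_list N) = N"
  unfolding node_list_def by (rule someI_ex) (use finite_distinct_list in blast)

text \<open>The arcs are listed by child, in the same order that fixes the orientation of
  \<open>basis_forest\<close>. So this orientation takes the value 1 on the word, and only the
  triangular sign is left in the matrix entries.\<close>

definition arc_word :: "('a \<times> 'a) set \<Rightarrow> ('a \<times> 'a) list" where
  "arc_word S = map (inv_into S snd) (node_list (snd ` S))"

lemma arc_word:
  assumes "finite S" "inj_on snd S"
  shows "map snd (arc_word S) = node_list (snd ` S)" "set (arc_word S) = S" "distinct (arc_word S)"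
proof -
  have nl: "distinct (node_list (snd ` S))" "set (node_list (snd ` S)) = snd ` S"
    using node_list[of "snd ` S"] assms(1) by auto
  show "map snd (arc_word S) = node_list (snd ` S)"
    unfolding arc_word_def map_map by (rule map_idI) (use nl in \<open>auto simp: f_inv_into_f\<close>)
  with nl show "distinct (arc_word S)" by (metis distinct_map)
  show "set (arc_word S) = S"
    using inv_into_image_cancel[OF assms(2), of S] nl by (simp add: arc_word_def)
qed

definition basis_forest :: "('a \<times> 'a) set \<Rightarrow> 'a oforest" where
  "basis_forest S = (wedge (map Some (node_list (snd ` S)) @ [None]), forest_of I S)"

lemma orientation_forest_of:
  assumes "arborescence I S" "ori \<in> orientations I (forest_of I S)"
  shows "ori = wedge (map Some (node_list (snd ` S)) @ [None]) \<or> ori = - wedge (map Some (node_list (snd ` S)) @ [None])"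
proof -
  let ?l = "map Some (node_list (snd ` S)) @ [None]"
  interpret arborescence I S by fact
  have nl: "distinct (node_list (snd ` S))" "set (node_list (snd ` S)) = snd ` S"
    using node_list[of "snd ` S"] finite_arcs by auto
  have ori: "ori \<in> maximal_products (insert None (Some ` snd ` S))"
    using assms(2) by (simp add: orientations_def nodes_forest_of)
  have l: "distinct ?l" "set ?l = insert None (Some ` snd ` S)"
    using distinct_word_None[OF nl(1)] nl by simp_all
  show ?thesis
    using maximal_product_value[OF ori l]
  proof
    assume 1: "ori ?l = 1"
    show ?thesis using maximal_product_eq_wedge[OF ori l] unfolding 1 by simp
  next
    assume 1: "ori ?l = - 1"
    show ?thesis using maximal_product_eq_wedge[OF ori l] unfolding 1 by (simp add: fun_eq_iff)
  qed
qed

lemma basis_forest_in: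
  assumes "arborescence I S"
  shows "basis_forest S \<in> oriented_forests I"
proof -
  interpret arborescence I S by fact
  have nl: "distinct (node_list (snd ` S))" "set (node_list (snd ` S)) = snd ` S"
    using node_list[of "snd ` S"] finite_arcs by auto
  have "(\<lambda>z. 1 * wedge (map Some (node_list (snd ` S)) @ [None]) z) \<in> maximal_products (insert None (Some ` snd ` S))"
    by (rule wedge_maximal_product[OF distinct_word_None[OF nl(1)]]) (use nl in auto)
  then show ?thesis
    by (simp add: basis_forest_def oriented_forests_def orientations_def nodes_forest_of is_forest_forest_of)
qed

text \<open>A forest has only two orientations, and a functional changes its sign between
  them.\<close>

lemma dual_eqI_basis:
  assumes "\<phi> \<in> carrier (dual_algebra I)" "\<psi> \<in> carrier (dual_algebra I)"
    and eq: "\<And>S. arborescence I S \<Longrightarrow>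
      \<phi> (forest_class I (frag_of (basis_forest S))) = \<psi> (forest_class I (frag_of (basis_forest S)))"
  shows "\<phi> = \<psi>"
  using assms(1,2)
proof (rule dual_carrier_eqI)
  fix x assume x: "x \<in> oriented_forests I"
  then obtain ori F where xF: "x = (ori, F)" "is_forest I F" "ori \<in> orientations I F"
    by (auto simp: oriented_forests_def)
  obtain S where S: "arborescence I S" "F = forest_of I S" using arborescence_of_forest[OF xF(2)] .
  have keys: "Poly_Mapping.keys (- frag_of (basis_forest S)) \<subseteq> oriented_forests I"
    using basis_forest_in[OF S(1)] by simp
  have neg: "f (forest_class I (- frag_of (basis_forest S))) = - f (forest_class I (frag_of (basis_forest S)))"
    if "f \<in> carrier (dual_algebra I)" for f
    using M.hom_class[OF _ keys, of f] that by (auto simp: dual_algebra_def frag_lin_minus)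
  consider "x = basis_forest S" | "x = (- fst (basis_forest S), snd (basis_forest S))"
    using orientation_forest_of[of S ori] S xF by (auto simp: basis_forest_def)
  then show "\<phi> (forest_class I (frag_of x)) = \<psi> (forest_class I (frag_of x))"
  proof cases
    case 2
    have "forest_class I (frag_of x) = forest_class I (- frag_of (basis_forest S))"
    proof -
      have "frag_of (- fst (basis_forest S), snd (basis_forest S)) +
          frag_of (fst (basis_forest S), snd (basis_forest S)) \<in> relM"
        using basis_forest_in[OF S(1)]
        by (intro M.relators_rel, unfold orientation_rels_def,
            intro CollectI exI[of _ "fst (basis_forest S)"] exI[of _ "snd (basis_forest S)"]) simp
      with 2 show ?thesis by (simp add: M.class_eq_iff)
    qed
    with eq[OF S(1)] neg[OF assms(1)] neg[OF assms(2)] show ?thesis by simp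
  qed (use eq[OF S(1)] in simp)
qed

lemma word_pairing_basis:
  assumes "arborescence I S" "arborescence I T"
  shows "word_pairing (arc_word S) (basis_forest T) =
    (if snd ` S = snd ` T \<and> S \<subseteq> T\<^sup>+ then triangular_sign (length (arc_word S)) else 0)"
proof -
  interpret S: arborescence I S by fact
  interpret T: arborescence I T by fact
  note aw = arc_word[OF S.finite_arcs S.inj]
  have nl: "distinct (node_list (snd ` S))" "set (node_list (snd ` S)) = snd ` S"
    using node_list[of "snd ` S"] S.finite_arcs by auto
  have "wedge (map Some (node_list (snd ` S)) @ [None]) (map Some (node_list (snd ` S)) @ [None]) = 1"
    by (rule wedge_same[OF distinct_word_None[OF nl(1)]])
  then show ?thesis
    using aw nl by (auto simp: word_pairing_def basis_forest_def T.nodes_forest_of strict_order_forest_of[OF assms(2)]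
      simp del: map_append)
qed

text \<open>The number of comparable pairs ranks the triangular system: equality of the orders would
  force equality of the arc sets.\<close>

lemma arborescence_rank:
  assumes "arborescence I S" "arborescence I T" "S \<subseteq> T\<^sup>+" "S \<noteq> T"
  shows "card (S\<^sup>+) < card (T\<^sup>+)"
proof -
  interpret T: arborescence I T by fact
  have "finite (T\<^sup>+)" using T.finite_arcs by simp
  moreover have "S\<^sup>+ \<subset> T\<^sup>+"
    using trancl_subset_trancl[OF assms(3)] arborescence_eqI[OF assms(1,2)] assms(4) by blast
  ultimately show ?thesis by (rule psubset_card_mono)
qed

lemma basis_solve:
  "\<exists>c. \<forall>T. arborescence I T \<longrightarrow>
    (\<Sum>S | arborescence I S. c S * word_pairing (arc_word S) (basis_forest T)) = f T"
  and basis_unique: "(\<And>T. arborescence I T \<Longrightarrow>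
      (\<Sum>S | arborescence I S. d S * word_pairing (arc_word S) (basis_forest T)) = 0) \<Longrightarrow> arborescence I S \<Longrightarrow> d S = 0"
proof -
  note sys = finite_arborescences[OF finite_ground]
  have diag: "word_pairing (arc_word S) (basis_forest S) = 1 \<or> word_pairing (arc_word S) (basis_forest S) = - 1"
    if "S \<in> {S. arborescence I S}" for S
    using that word_pairing_basis[of S S] triangular_sign_cases by auto
  have tri: "S = T \<or> card (S\<^sup>+) < card (T\<^sup>+)"
    if "S \<in> {S. arborescence I S}" "T \<in> {S. arborescence I S}" "word_pairing (arc_word S) (basis_forest T) \<noteq> 0"
    for S T
  proof -
    from that have ST: "arborescence I S" "arborescence I T" by simp_all
    have "S \<subseteq> T\<^sup>+"
      using that(3) unfolding word_pairing_basis[OF ST] by (rule contrapos_np) simp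
    with arborescence_rank[OF ST] show ?thesis by blast
  qed
  show "\<exists>c. \<forall>T. arborescence I T \<longrightarrow>
    (\<Sum>S | arborescence I S. c S * word_pairing (arc_word S) (basis_forest T)) = f T"
    using triangular_system_solve[where M = "\<lambda>S T. word_pairing (arc_word S) (basis_forest T)" and
        rank = "\<lambda>S. card (S\<^sup>+)", OF sys diag tri, where f = f] by simp
  show "d S = 0" if "\<And>T. arborescence I T \<Longrightarrow>
      (\<Sum>S | arborescence I S. d S * word_pairing (arc_word S) (basis_forest T)) = 0" "arborescence I S"
    using triangular_system_unique[where M = "\<lambda>S T. word_pairing (arc_word S) (basis_forest T)" and
        rank = "\<lambda>S. card (S\<^sup>+)", OF sys diag tri, where c = d and s = S] that by simp
qed

lemma arc_word_gens:
  assumes "arborescence I S"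
  shows "arc_word S \<in> lists (Omega_gens I)"
proof -
  interpret arborescence I S by fact
  show ?thesis using arc_word(2)[OF finite_arcs inj] subset_gens by auto
qed

text \<open>The normal form of an element modulo the defining ideal, with one monomial for each
  forest.\<close>

definition forest_poly :: "(('a \<times> 'a) set \<Rightarrow> int) \<Rightarrow> ('a \<times> 'a) list \<Rightarrow>\<^sub>0 int" where
  "forest_poly c = (\<Sum>S | arborescence I S. frag_cmul (c S) (frag_of (arc_word S)))"

lemma forest_poly_keys: "Poly_Mapping.keys (forest_poly c) \<subseteq> lists (Omega_gens I)"
  unfolding forest_poly_def
proof (rule order_trans[OF keys_sum], intro UN_least)
  fix S assume "S \<in> {S. arborescence I S}"
  then show "Poly_Mapping.keys (frag_cmul (c S) (frag_of (arc_word S))) \<subseteq> lists (Omega_gens I)"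
    using keys_cmul[of "c S" "frag_of (arc_word S)"] arc_word_gens[of S] by auto
qed

lemma to_dual_forest_poly:
  assumes "arborescence I T"
  shows "to_dual (forest_poly c) (forest_class I (frag_of (basis_forest T))) =
    (\<Sum>S | arborescence I S. c S * word_pairing (arc_word S) (basis_forest T))"
  using basis_forest_in[OF assms]
  by (simp add: to_dual_class pairing_def forest_poly_def frag_lin_sum frag_lin_cmul)

lemma to_dual_surj:
  assumes "\<phi> \<in> carrier (dual_algebra I)"
  obtains p where "p \<in> carrier (free_algebra (Omega_gens I))" "to_dual p = \<phi>"
proof -
  obtain c where c: "\<And>T. arborescence I T \<Longrightarrow>
    (\<Sum>S | arborescence I S. c S * word_pairing (arc_word S) (basis_forest T)) = \<phi> (forest_class I (frag_of (basis_forest T)))"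
    using basis_solve[of "\<lambda>T. \<phi> (forest_class I (frag_of (basis_forest T)))"] by blast
  have "to_dual (forest_poly c) = \<phi>"
    using to_dual_carrier assms by (rule dual_eqI_basis) (simp add: to_dual_forest_poly c)
  moreover have "forest_poly c \<in> carrier (free_algebra (Omega_gens I))"
    using forest_poly_keys by (simp add: free_algebra_def)
  ultimately show ?thesis using that by blast
qed

lemma to_dual_forest_poly_eq_0:
  assumes "to_dual (forest_poly c) = \<zero>\<^bsub>dual_algebra I\<^esub>"
  shows "forest_poly c = 0"
proof -
  have "c S = 0" if "arborescence I S" for S
  proof (rule basis_unique[OF _ that])
    fix T assume T: "arborescence I T"
    have "to_dual (forest_poly c) (forest_class I (frag_of (basis_forest T))) = 0"
      unfolding assms using M.class_in_P[of "frag_of (basis_forest T)"] basis_forest_in[OF T]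
      by (simp add: dual_algebra_def)
    with to_dual_forest_poly[OF T]
    show "(\<Sum>S | arborescence I S. c S * word_pairing (arc_word S) (basis_forest T)) = 0" by simp
  qed
  then show ?thesis unfolding forest_poly_def by (intro sum.neutral) simp
qed

end

section \<open>The defining ideal as a kernel\<close>

locale graded_presentation =
  fixes S :: "'g set" and Rel :: "('g list \<Rightarrow>\<^sub>0 int) set"
  assumes Rel_keys: "r \<in> Rel \<Longrightarrow> Poly_Mapping.keys r \<subseteq> lists S"
begin

abbreviation "J \<equiv> presented_ideal S Rel"

lemma graded_comm_rels_keys:
  assumes "r \<in> graded_comm_rels S"
  shows "Poly_Mapping.keys r \<subseteq> lists S"
  using assms unfolding graded_comm_rels_def
proof (elim UnE CollectE exE conjE)
  fix p q m n
  assume r: "r = word_mult p q - frag_cmul ((- 1) ^ (m * n)) (word_mult q p)"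
    "p \<in> free_component S (int m)" "q \<in> free_component S (int n)"
  then have "Poly_Mapping.keys p \<subseteq> lists S" "Poly_Mapping.keys q \<subseteq> lists S" by (auto simp: free_component_def)
  with word_mult_keys[of p S q] word_mult_keys[of q S p] keys_cmul[of "(- 1) ^ (m * n)" "word_mult q p"]
    keys_diff[of "word_mult p q" "frag_cmul ((- 1) ^ (m * n)) (word_mult q p)"]
  show ?thesis unfolding r(1) by blast
next
  fix p m assume "r = word_mult p p" "p \<in> free_component S (int m)"
  then show ?thesis using word_mult_keys[of p S p] by (auto simp: free_component_def)
qed

lemma rels_carrier: "graded_comm_rels S \<union> Rel \<subseteq> carrier (free_algebra S)"
  using graded_comm_rels_keys Rel_keys by (auto simp: free_algebra_def)

lemma ideal_J: "ideal J (free_algebra S)"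
  unfolding presented_ideal_def using ring_free_algebra rels_carrier by (rule ring.genideal_ideal)

lemma rel_in_J: "r \<in> graded_comm_rels S \<union> Rel \<Longrightarrow> r \<in> J"
  unfolding presented_ideal_def using ring.genideal_self[OF ring_free_algebra rels_carrier] by blast

lemma J_zero: "0 \<in> J"
  using additive_subgroup.zero_closed[OF ideal.axioms(1)[OF ideal_J]] by (simp add: free_algebra_def)

lemma J_add: "p \<in> J \<Longrightarrow> q \<in> J \<Longrightarrow> p + q \<in> J"
  using additive_subgroup.a_closed[OF ideal.axioms(1)[OF ideal_J]] by (simp add: free_algebra_def)

lemma J_mult:
  assumes "p \<in> J" "Poly_Mapping.keys q \<subseteq> lists S"
  shows "word_mult q p \<in> J" "word_mult p q \<in> J"
  using ideal.I_l_closed[OF ideal_J assms(1), of q] ideal.I_r_closed[OF ideal_J assms(1), of q] assms(2)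
  by (simp_all add: free_algebra_def)

lemma J_minus:
  assumes "p \<in> J"
  shows "- p \<in> J"
proof -
  have "word_mult (frag_cmul (- 1) (frag_of [])) p = - p"
    by (simp add: word_mult_def frag_extend_minus flip: frag_expansion)
  with J_mult(1)[OF assms, of "frag_cmul (- 1) (frag_of [])"] show ?thesis by simp
qed

lemma J_diff: "p \<in> J \<Longrightarrow> q \<in> J \<Longrightarrow> p - q \<in> J"
  using J_add[of p "- q"] J_minus by simp

lemma J_cmul: "p \<in> J \<Longrightarrow> frag_cmul k p \<in> J"
  by (rule frag_closure_minus_cmul) (auto intro: J_zero J_diff)

lemma J_append:
  assumes "frag_of w \<in> J" "us \<in> lists S" "vs \<in> lists S"
  shows "frag_of (us @ w @ vs) \<in> J"
  using J_mult(2)[OF J_mult(1)[OF assms(1), of "frag_of us"], of "frag_of vs"] assms(2,3) by simp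

lemma swap_in_J:
  assumes "us @ [x, y] @ vs \<in> lists S"
  shows "frag_of (us @ [x, y] @ vs) + frag_of (us @ [y, x] @ vs) \<in> J"
proof -
  \<comment> \<open>Graded commutativity in degrees 1 and 1, where the sign is -1.\<close>
  have "word_mult (frag_of [x]) (frag_of [y]) - frag_cmul ((- 1) ^ (1 * 1)) (word_mult (frag_of [y]) (frag_of [x]))
      \<in> graded_comm_rels S"
    unfolding graded_comm_rels_def
    by (rule UnI1, rule CollectI, rule exI[of _ "frag_of [x]"], rule exI[of _ "frag_of [y]"],
        rule exI[of _ 1], rule exI[of _ 1]) (use assms in \<open>auto simp: free_component_def\<close>)
  from rel_in_J[OF UnI1[OF this]] have "frag_of [x, y] + frag_of [y, x] \<in> J" by simp
  from J_mult(2)[OF J_mult(1)[OF this, of "frag_of us"], of "frag_of vs"] assms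
  show ?thesis by (simp add: word_mult_add_left word_mult_add_right)
qed

text \<open>The swap principle again. The induction also carries membership in
  \<open>lists S\<close> from right to left, because the swap relation is available only for words
  in the generators.\<close>

lemma mset_eq_mod_J:
  assumes "mset xs = mset ys" "ys \<in> lists S"
  obtains s :: int where "s = 1 \<or> s = - 1" "frag_of xs - frag_cmul s (frag_of ys) \<in> J"
proof -
  have "ys \<in> lists S \<longrightarrow> xs \<in> lists S \<and>
      (\<exists>s::int. (s = 1 \<or> s = - 1) \<and> frag_of xs - frag_cmul s (frag_of ys) \<in> J)"
  proof (rule mset_eq_swap_induct[OF assms(1)], goal_cases)
    case (1 xs)
    show ?case by (auto intro!: exI[of _ 1] simp: J_zero)
  next
    case (2 xs ys zs)
    show ?case
    proof
      assume "zs \<in> lists S"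
      with 2 obtain s t :: int where st: "s = 1 \<or> s = - 1" "t = 1 \<or> t = - 1" "xs \<in> lists S"
        "frag_of xs - frag_cmul s (frag_of ys) \<in> J" "frag_of ys - frag_cmul t (frag_of zs) \<in> J" by blast
      have "frag_of xs - frag_cmul (s * t) (frag_of zs) =
        (frag_of xs - frag_cmul s (frag_of ys)) + frag_cmul s (frag_of ys - frag_cmul t (frag_of zs))"
        by (rule poly_mapping_eqI) (simp add: lookup_minus lookup_add algebra_simps)
      moreover have "s * t = 1 \<or> s * t = - 1" using st by auto
      ultimately show "xs \<in> lists S \<and>
          (\<exists>s::int. (s = 1 \<or> s = - 1) \<and> frag_of xs - frag_cmul s (frag_of zs) \<in> J)"
        using st J_add J_cmul by metis
    qed
  next
    case (3 us x y vs)
    show ?case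
    proof
      assume "us @ [y, x] @ vs \<in> lists S"
      then have *: "us @ [x, y] @ vs \<in> lists S" by auto
      with swap_in_J[OF *] show "us @ [x, y] @ vs \<in> lists S \<and>
          (\<exists>s::int. (s = 1 \<or> s = - 1) \<and> frag_of (us @ [x, y] @ vs) - frag_cmul s (frag_of (us @ [y, x] @ vs)) \<in> J)"
        by (intro conjI exI[of _ "- 1"]) simp_all
    qed
  qed
  with assms(2) that show ?thesis by blast
qed

text \<open>Up to sign the letters of \<open>w\<close> can be moved to the front, and the remaining
  letters multiply an element of the ideal. So a forbidden factor may be scattered over the
  word.\<close>

lemma mset_subset_in_J:
  assumes "frag_of w \<in> J" "mset w \<subseteq># mset xs" "xs \<in> lists S"
  shows "frag_of xs \<in> J"
proof -
  obtain vs where vs: "mset xs = mset (w @ vs)"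
    using assms(2) by (metis ex_mset mset_append subset_mset.less_eqE)
  then have wvs: "w @ vs \<in> lists S" using assms(3) by (metis in_listsI in_listsD mset_eq_setD)
  then have "frag_of (w @ vs) \<in> J" using J_append[OF assms(1), of "[]" vs] by simp
  moreover obtain s :: int where "frag_of xs - frag_cmul s (frag_of (w @ vs)) \<in> J"
    using mset_eq_mod_J[OF vs wvs] by blast
  ultimately show ?thesis using J_add[OF _ J_cmul[of "frag_of (w @ vs)" s]] by fastforce
qed

end

text \<open>A closed walk is shortened to a path without repetition from \<open>x\<close> to
  \<open>y\<close>, closed by the arc from \<open>y\<close> to \<open>x\<close>. The absence of
  loops among the generators gives length at least 2, and \<open>zip p (rotate1 p)\<close> is the
  shape of the cyclic relations.\<close>

lemma not_acyclic_imp_cycle: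
  assumes "\<not> acyclic R" "R \<subseteq> Omega_gens I"
  obtains p where "set p \<subseteq> I" "distinct p" "2 \<le> length p" "set (zip p (rotate1 p)) \<subseteq> R"
proof -
  obtain x where "(x, x) \<in> R\<^sup>+" using assms(1) by (auto simp: acyclic_def)
  then obtain y where y: "(x, y) \<in> R\<^sup>*" "(y, x) \<in> R" by (meson tranclD2)
  obtain p where p: "p \<noteq> []" "distinct p" "hd p = x" "last p = y" "successively (\<lambda>a b. (a, b) \<in> R) p"
    using rtrancl_imp_distinct_path[OF y(1)] by blast
  have irr: "x \<noteq> y" "x \<in> I" using y(2) assms(2) by (auto simp: Omega_gens_def)
  obtain q where q: "p = x # q" using p by (cases p) auto
  have "2 \<le> length p" using p irr q by (cases q) auto
  moreover have arcs: "set (zip p (rotate1 p)) \<subseteq> R"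
  proof
    fix a assume "a \<in> set (zip p (rotate1 p))"
    then obtain i where i: "i < length p" "a = (p ! i, rotate1 p ! i)" by (auto simp: set_zip)
    show "a \<in> R"
    proof (cases "Suc i < length p")
      case True
      then have "rotate1 p ! i = p ! Suc i" by (simp add: nth_rotate1)
      with i True p(5) show ?thesis by (auto simp: successively_conv_nth)
    next
      case False
      then have "i = length p - 1" using i by simp
      with i p y show ?thesis by (auto simp: nth_rotate1 last_conv_nth hd_conv_nth)
    qed
  qed
  moreover have "set p \<subseteq> I"
  proof
    fix z assume "z \<in> set p"
    then obtain i where "i < length p" "z = p ! i" by (auto simp: in_set_conv_nth)
    then have "(z, rotate1 p ! i) \<in> set (zip p (rotate1 p))" by (auto simp: set_zip)
    with arcs assms(2) show "z \<in> I" by (auto simp: Omega_gens_def)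
  qed
  ultimately show ?thesis using p that by blast
qed

context finite_ground
begin

section \<open>Reduction of words to forest monomials, and the kernel\<close>

sublocale A: graded_presentation "Omega_gens I" "Omega_rels I"
proof
  fix r assume "r \<in> Omega_rels I"
  then show "Poly_Mapping.keys r \<subseteq> lists (Omega_gens I)"
    unfolding Omega_rels_def
  proof (elim UnE CollectE exE conjE)
    fix p assume p: "r = frag_of (zip p (rotate1 p))" "set p \<subseteq> I" "distinct p" "2 \<le> length p"
    have "a \<in> Omega_gens I" if "a \<in> set (zip p (rotate1 p))" for a
    proof -
      from that obtain i where i: "i < length p" "a = (p ! i, p ! (Suc i mod length p))"
        by (auto simp: set_zip nth_rotate1)
      have "Suc i mod length p < length p" using p(4) by (intro mod_less_divisor) linarith
      moreover have "Suc i mod length p \<noteq> i" using i(1) p(4)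
        by (cases "Suc i = length p") auto
      ultimately show ?thesis
        using i p by (auto simp: Omega_gens_def nth_eq_iff_index_eq)
    qed
    with p(1) show ?thesis by auto
  qed (auto simp: Omega_gens_def)
qed

text \<open>A word fails to list the arcs of a forest for one of three reasons, each covered by a
  relation: two parents of one child, a repeated arc, or a cycle.\<close>

lemma word_reduction:
  assumes "w \<in> lists (Omega_gens I)"
  shows "frag_of w \<in> A.J \<or> arborescence I (set w) \<and> distinct w"
proof (cases "distinct (map snd w) \<and> acyclic (set w)")
  case True
  then have "arborescence I (set w)"
    using assms finite_ground by unfold_locales (auto simp: Omega_gens_def distinct_map)
  with True show ?thesis by (simp add: distinct_map)
next
  case False
  show ?thesis
  proof (cases "distinct (map snd w)")
    case True
    with False have "\<not> acyclic (set w)" by simp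
    then obtain p where p: "set p \<subseteq> I" "distinct p" "2 \<le> length p" "set (zip p (rotate1 p)) \<subseteq> set w"
      using not_acyclic_imp_cycle[of "set w" I] assms by blast
    have "frag_of (zip p (rotate1 p)) \<in> A.J"
      by (rule A.rel_in_J) (use p in \<open>auto simp: Omega_rels_def\<close>)
    moreover have "mset (zip p (rotate1 p)) \<subseteq># mset w"
    proof -
      have "distinct w" "distinct (zip p (rotate1 p))" using True p(2) by (auto simp: distinct_map distinct_zipI1)
      with p(4) show ?thesis
        by (metis mset_set_set subset_imp_msubset_mset_set List.finite_set)
    qed
    ultimately show ?thesis using A.mset_subset_in_J assms by blast
  next
    case nd: False
    then obtain k us ys zs where dec: "map snd w = us @ [k] @ ys @ [k] @ zs"
      using not_distinct_decomp by blast
    have split: "\<exists>u a v. w = u @ a # v \<and> snd a = k \<and> map snd v = ys"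
      if "map snd w = xs @ k # ys" for w :: "('a \<times> 'a) list" and xs ys
      using that by (force simp: map_eq_append_conv map_eq_Cons_conv)
    from dec split[of w us "ys @ [k] @ zs"] obtain u a r
      where r: "w = u @ a # r" "snd a = k" "map snd r = ys @ k # zs" by auto
    from split[OF r(3)] obtain y b z where "r = y @ b # z" "snd b = k" by blast
    with r have w: "w = u @ a # y @ b # z" "snd a = k" "snd b = k" by simp_all
    obtain i j where ij: "a = (i, k)" "b = (j, k)" using w by (cases a; cases b) auto
    have gens: "(i, k) \<in> Omega_gens I" "(j, k) \<in> Omega_gens I" using assms w ij by auto
    have "frag_of [(i, k), (j, k)] \<in> A.J"
    \<comment> \<open>The relations for a common child require different parents. A repeated
      generator vanishes as the square of an element of odd degree.\<close>
    proof (cases "i = j")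
      case True
      have "frag_of [(i, k)] \<in> free_component (Omega_gens I) (int 1)"
        using gens by (simp add: free_component_def)
      then have "word_mult (frag_of [(i, k)]) (frag_of [(i, k)]) \<in> graded_comm_rels (Omega_gens I)"
        unfolding graded_comm_rels_def by (intro UnI2) (metis (mono_tags, lifting) mem_Collect_eq odd_one)
      then have "word_mult (frag_of [(i, k)]) (frag_of [(i, k)]) \<in> A.J" by (intro A.rel_in_J) simp
      with True show ?thesis by simp
    next
      case False
      with gens show ?thesis
        by (intro A.rel_in_J) (auto simp: Omega_rels_def Omega_gens_def)
    qed
    moreover have "mset [(i, k), (j, k)] \<subseteq># mset w" using w ij by simp
    ultimately show ?thesis using A.mset_subset_in_J assms by blast
  qed
qed

lemma forest_poly_cong_mod_J:
  assumes "Poly_Mapping.keys p \<subseteq> lists (Omega_gens I)"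
  shows "\<exists>c. p - forest_poly c \<in> A.J"
  using assms
proof (induction p rule: frag_induction)
  case zero
  have "forest_poly (\<lambda>_. 0) = 0" by (simp add: forest_poly_def)
  then show ?case using A.J_zero by (intro exI[of _ "\<lambda>_. 0"]) simp
next
  case (one w)
  show ?case
  proof (cases "frag_of w \<in> A.J")
    case True
    have "forest_poly (\<lambda>_. 0) = 0" by (simp add: forest_poly_def)
    with True show ?thesis by (intro exI[of _ "\<lambda>_. 0"]) simp
  next
    case False
    with word_reduction[OF one] have w: "arborescence I (set w)" "distinct w" by auto
    interpret arborescence I "set w" by fact
    have "mset w = mset (arc_word (set w))"
      using arc_word[OF finite_arcs inj] w(2) by (metis set_eq_iff_mset_eq_distinct)
    then obtain s :: int where s: "frag_of w - frag_cmul s (frag_of (arc_word (set w))) \<in> A.J"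
      using A.mset_eq_mod_J[OF _ arc_word_gens[OF w(1)]] by blast
    have "forest_poly (\<lambda>S. if S = set w then s else 0) =
      (\<Sum>S\<in>{S. arborescence I S}. if S = set w then frag_cmul s (frag_of (arc_word (set w))) else 0)"
      unfolding forest_poly_def by (intro sum.cong) auto
    also have "\<dots> = frag_cmul s (frag_of (arc_word (set w)))"
      using finite_arborescences[OF finite_ground] w(1) by simp
    finally show ?thesis using s by metis
  qed
next
  case (diff a b)
  then obtain c d where "a - forest_poly c \<in> A.J" "b - forest_poly d \<in> A.J" by blast
  from A.J_diff[OF this] have "(a - b) - (forest_poly c - forest_poly d) \<in> A.J" by (simp add: algebra_simps)
  moreover have "forest_poly c - forest_poly d = forest_poly (\<lambda>S. c S - d S)"
    by (simp add: forest_poly_def frag_cmul_diff_distrib sum_subtractf)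
  ultimately show ?case by metis
qed

text \<open>The admissibility of a word for a forest does not depend on the order of its letters.
  Only the orientation value changes, by the sign of exchanging two blocks of lengths
  \<open>m\<close> and \<open>n\<close>.\<close>

lemma pairing_commute:
  assumes "p \<in> free_component (Omega_gens I) (int m)" "q \<in> free_component (Omega_gens I) (int n)"
    and "x \<in> oriented_forests I"
  shows "pairing (word_mult p q) x = (-1) ^ (m * n) * pairing (word_mult q p) x"
proof -
  obtain ori F where x: "x = (ori, F)" "ori \<in> orientations I F"
    using assms(3) by (auto simp: oriented_forests_def)
  have alt: "alternating ori" using x(2) maximal_product_alternating by (auto simp: orientations_def)
  have swap: "word_pairing (u @ v) x = (-1) ^ (length u * length v) * word_pairing (v @ u) x" for u v
  proof -
    have "distinct (map snd (u @ v)) = distinct (map snd (v @ u))" by auto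
    moreover have "set (u @ v) = set (v @ u)" "length (u @ v) = length (v @ u)" by auto
    moreover have "ori (map Some (map snd (u @ v)) @ [None]) =
        (-1) ^ (length u * length v) * ori (map Some (map snd (v @ u)) @ [None])"
      using alternating_swap_blocks[OF alt, of "[]" "map Some (map snd u)" "map Some (map snd v)" "[None]"]
      by simp
    ultimately show ?thesis unfolding x(1) word_pairing_def prod.case
      by (simp only: if_distrib[of "\<lambda>z. (- 1) ^ (length u * length v) * z"] mult_zero_right mult.left_commute)
  qed
  have "word_pairing (u @ v) x = (-1) ^ (m * n) * word_pairing (v @ u) x"
    if "u \<in> Poly_Mapping.keys p" "v \<in> Poly_Mapping.keys q" for u v
  proof -
    have "length u = m" "length v = n" using that assms(1,2) by (auto simp: free_component_def)
    with swap[of u v] show ?thesis by simp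
  qed
  then have "frag_lin (\<lambda>u. frag_lin (\<lambda>v. word_pairing (u @ v) x) q) p =
    frag_lin (\<lambda>u. frag_lin (\<lambda>v. (-1) ^ (m * n) * word_pairing (v @ u) x) q) p"
    by (intro frag_lin_cong)
  also have "\<dots> = (-1) ^ (m * n) * frag_lin (\<lambda>v. frag_lin (\<lambda>u. word_pairing (v @ u) x) p) q"
    by (simp add: frag_lin_mult_left frag_lin_swap[of _ q p])
  finally show ?thesis by (simp add: pairing_def frag_lin_word_mult)
qed

lemma to_dual_eq_zeroI:
  assumes "\<And>x. x \<in> oriented_forests I \<Longrightarrow> pairing p x = 0"
  shows "to_dual p = \<zero>\<^bsub>dual_algebra I\<^esub>"
proof -
  have "to_dual p = to_dual 0"
    using to_dual_carrier to_dual_carrier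
    by (rule dual_carrier_eqI) (simp add: to_dual_class assms, simp add: pairing_def)
  then show ?thesis by (simp add: to_dual_zero)
qed

lemma acyclic_strict_order:
  assumes "is_forest I F"
  shows "acyclic (strict_order F)"
proof -
  obtain S where S: "arborescence I S" "F = forest_of I S" using arborescence_of_forest[OF assms] .
  then show ?thesis by (simp add: strict_order_forest_of acyclic_def arborescence.irrefl)
qed

lemma relation_in_kernel:
  assumes "r \<in> graded_comm_rels (Omega_gens I) \<union> Omega_rels I"
  shows "to_dual r = \<zero>\<^bsub>dual_algebra I\<^esub>"
proof (rule to_dual_eq_zeroI)
  fix x assume x: "x \<in> oriented_forests I"
  then obtain ori F where xF: "x = (ori, F)" "is_forest I F" by (auto simp: oriented_forests_def)
  show "pairing r x = 0"
    using assms unfolding graded_comm_rels_def Omega_rels_def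
  proof (elim UnE CollectE exE conjE)
    fix p q m n assume "r = word_mult p q - frag_cmul ((- 1) ^ (m * n)) (word_mult q p)"
      "p \<in> free_component (Omega_gens I) (int m)" "q \<in> free_component (Omega_gens I) (int n)"
    with pairing_commute[of p m q n x] x show ?thesis by (simp add: pairing_def frag_lin_diff frag_lin_cmul)
  next
    \<comment> \<open>The square is paired to its own negative, since m * m is odd, and the integers
      have no 2-torsion.\<close>
    fix p m assume "r = word_mult p p" "odd m" "p \<in> free_component (Omega_gens I) (int m)"
    with pairing_commute[of p m p m x] x show ?thesis by simp
  next
    fix i j k assume "r = frag_of [(i, k), (j, k)]"
    then show ?thesis by (simp add: pairing_def word_pairing_def xF(1))
  next
    fix p assume p: "r = frag_of (zip p (rotate1 p))" "distinct p" "2 \<le> length p"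
    have "\<not> set (zip p (rotate1 p)) \<subseteq> strict_order F"
    proof
      assume sub: "set (zip p (rotate1 p)) \<subseteq> strict_order F"
      have "(p ! 0, p ! i) \<in> (strict_order F)\<^sup>*" if "i < length p" for i
        using that
      proof (induction i)
        case (Suc i)
        then have "(p ! i, p ! Suc i) \<in> set (zip p (rotate1 p))"
          by (auto simp: set_zip nth_rotate1 intro!: exI[of _ i])
        with Suc sub show ?case by (meson Suc_lessD rtrancl.rtrancl_into_rtrancl subsetD)
      qed simp
      then have "(p ! 0, p ! (length p - 1)) \<in> (strict_order F)\<^sup>*" using p(3) by simp
      moreover have "(p ! (length p - 1), p ! 0) \<in> set (zip p (rotate1 p))"
      proof -
        have "Suc (length p - 1) = length p" "length p - 1 < length p" using p(3) by linarith+
        then show ?thesis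
          by (auto simp: set_zip nth_rotate1 intro!: exI[of _ "length p - 1"])
      qed
      ultimately have "(p ! 0, p ! 0) \<in> (strict_order F)\<^sup>+" using sub by (meson rtrancl_into_trancl1 subsetD)
      with acyclic_strict_order[OF xF(2)] show False by (auto simp: acyclic_def)
    qed
    then show ?thesis by (simp add: p(1) pairing_def word_pairing_def xF(1))
  qed
qed

text \<open>The image of a ring under a map that respects sum, product and unit is a ring, and this
  map is onto. So neither coassociativity nor the counit laws of the coproduct have to be
  verified.\<close>

lemma ring_dual_algebra: "ring (dual_algebra I)"
proof -
  have "ring (dual_algebra I \<lparr>carrier := to_dual ` carrier (free_algebra (Omega_gens I)),
      zero := to_dual \<zero>\<^bsub>free_algebra (Omega_gens I)\<^esub>\<rparr>)"
    using ring_free_algebra to_dual_ring_hom by (rule ring.ring_hom_imp_img_ring)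
  moreover have "to_dual ` carrier (free_algebra (Omega_gens I)) = carrier (dual_algebra I)"
    using to_dual_carrier to_dual_surj by blast
  moreover have "to_dual \<zero>\<^bsub>free_algebra (Omega_gens I)\<^esub> = \<zero>\<^bsub>dual_algebra I\<^esub>"
    using to_dual_zero by (simp add: free_algebra_def)
  ultimately show ?thesis by simp
qed

lemma ring_hom_ring_to_dual: "ring_hom_ring (free_algebra (Omega_gens I)) (dual_algebra I) to_dual"
  by (rule ring_hom_ringI2[OF ring_free_algebra ring_dual_algebra to_dual_ring_hom])

text \<open>An element of the kernel is congruent to a combination of forest monomials, whose image
  also vanishes. By triangularity all its coefficients are zero, so the element itself lies in the
  ideal.\<close>

lemma kernel_eq: "a_kernel (free_algebra (Omega_gens I)) (dual_algebra I) to_dual = A.J"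
proof
  have J_kernel: "A.J \<subseteq> a_kernel (free_algebra (Omega_gens I)) (dual_algebra I) to_dual"
    unfolding presented_ideal_def
  proof (rule ring.genideal_minimal[OF ring_free_algebra ring_hom_ring.kernel_is_ideal[OF ring_hom_ring_to_dual]], rule subsetI)
    fix r assume r: "r \<in> graded_comm_rels (Omega_gens I) \<union> Omega_rels I"
    then have "r \<in> carrier (free_algebra (Omega_gens I))" using A.rels_carrier by blast
    with relation_in_kernel[OF r] show "r \<in> a_kernel (free_algebra (Omega_gens I)) (dual_algebra I) to_dual"
      by (simp add: a_kernel_def')
  qed
  then show "A.J \<subseteq> a_kernel (free_algebra (Omega_gens I)) (dual_algebra I) to_dual" .
  show "a_kernel (free_algebra (Omega_gens I)) (dual_algebra I) to_dual \<subseteq> A.J"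
  proof
    fix p assume "p \<in> a_kernel (free_algebra (Omega_gens I)) (dual_algebra I) to_dual"
    then have p: "p \<in> carrier (free_algebra (Omega_gens I))" "to_dual p = \<zero>\<^bsub>dual_algebra I\<^esub>"
      unfolding a_kernel_def' by blast+
    from p(1) have keys: "Poly_Mapping.keys p \<subseteq> lists (Omega_gens I)" by (simp add: free_algebra_def)
    obtain c where c: "p - forest_poly c \<in> A.J" using forest_poly_cong_mod_J[OF keys] ..
    then have "- (p - forest_poly c) \<in> a_kernel (free_algebra (Omega_gens I)) (dual_algebra I) to_dual"
      using A.J_minus J_kernel by blast
    then have "to_dual (- (p - forest_poly c)) = \<zero>\<^bsub>dual_algebra I\<^esub>"
      unfolding a_kernel_def' by blast
    \<comment> \<open>The normal form is written as a sum of two kernel elements, so that additivity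
      of the map suffices.\<close>
    moreover have "to_dual (forest_poly c) = to_dual p \<oplus>\<^bsub>dual_algebra I\<^esub> to_dual (- (p - forest_poly c))"
      unfolding to_dual_add[symmetric] by simp
    ultimately have "to_dual (forest_poly c) = \<zero>\<^bsub>dual_algebra I\<^esub>"
      using p(2) to_dual_add[of 0 0] to_dual_zero by simp
    then have "forest_poly c = 0" by (rule to_dual_forest_poly_eq_0)
    with c show "p \<in> A.J" by simp
  qed
qed

section \<open>Compatibility with the gradings\<close>

lemma pairing_free_component:
  assumes "p \<in> free_component (Omega_gens I) n" "oforest_degree I x \<noteq> n"
  shows "pairing p x = 0"
proof -
  obtain ori F where x: "x = (ori, F)" by (cases x)
  have "word_pairing w x = 0" if "w \<in> Poly_Mapping.keys p" for w
  proof (rule ccontr)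
    assume "word_pairing w x \<noteq> 0"
    then have "distinct (map snd w)" "snd ` set w = nodes I F"
      by (auto simp: word_pairing_def x split: if_splits)
    then have "card (nodes I F) = length w" by (metis distinct_card length_map list.set_map)
    with that assms show False by (auto simp: x oforest_degree_def free_component_def)
  qed
  then have "pairing p x = frag_lin (\<lambda>_. 0) p" unfolding pairing_def by (rule frag_lin_cong)
  then show ?thesis by (simp add: frag_lin_def)
qed

text \<open>A homogeneous class has a representative supported in its degree, so it suffices to test
  oriented forests.\<close>

lemma dual_component_iff:
  assumes "\<phi> \<in> carrier (dual_algebra I)"
  shows "\<phi> \<in> dual_component I n \<longleftrightarrow>
    (\<forall>x\<in>oriented_forests I. oforest_degree I x \<noteq> n \<longrightarrow> \<phi> (forest_class I (frag_of x)) = 0)"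
proof
  assume l: "\<phi> \<in> dual_component I n"
  show "\<forall>x\<in>oriented_forests I. oforest_degree I x \<noteq> n \<longrightarrow> \<phi> (forest_class I (frag_of x)) = 0"
  proof (intro ballI impI)
    fix x assume x: "x \<in> oriented_forests I" "oforest_degree I x \<noteq> n"
    then have "forest_class I (frag_of x) \<in> forest_component I (oforest_degree I x)"
      unfolding forest_component_def by (intro CollectI exI[of _ "frag_of x"]) auto
    with l x(2) show "\<phi> (forest_class I (frag_of x)) = 0" unfolding dual_component_def by blast
  qed
next
  assume r: "\<forall>x\<in>oriented_forests I. oforest_degree I x \<noteq> n \<longrightarrow> \<phi> (forest_class I (frag_of x)) = 0"
  have hom: "\<phi> \<in> hom (forest_module I) integer_group" using assms by (simp add: dual_algebra_def)
  have "\<phi> X = 0" if "m \<noteq> n" "X \<in> forest_component I m" for m X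
  proof -
    obtain c where c: "X = forest_class I c"
      "Poly_Mapping.keys c \<subseteq> {x \<in> oriented_forests I. oforest_degree I x = m}"
      using \<open>X \<in> forest_component I m\<close> unfolding forest_component_def by blast
    then have "Poly_Mapping.keys c \<subseteq> oriented_forests I" by blast
    from M.hom_class[OF hom this] have "\<phi> X = frag_lin (\<lambda>x. \<phi> (forest_class I (frag_of x))) c" using c(1) by simp
    also have "\<dots> = frag_lin (\<lambda>_. 0) c" using c(2) r \<open>m \<noteq> n\<close> by (intro frag_lin_cong) blast
    finally show ?thesis by (simp add: frag_lin_def)
  qed
  with assms show "\<phi> \<in> dual_component I n" unfolding dual_component_def by blast
qed

lemma to_dual_free_component: "to_dual ` free_component (Omega_gens I) n = dual_component I n"
proof (intro equalityI subsetI)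
  fix \<phi> assume "\<phi> \<in> to_dual ` free_component (Omega_gens I) n"
  then obtain p where p: "\<phi> = to_dual p" "p \<in> free_component (Omega_gens I) n" by blast
  show "\<phi> \<in> dual_component I n"
    unfolding p(1) dual_component_iff[OF to_dual_carrier]
    using pairing_free_component[OF p(2)] by (simp add: to_dual_class)
next
  fix \<phi> assume \<phi>: "\<phi> \<in> dual_component I n"
  then have car: "\<phi> \<in> carrier (dual_algebra I)" by (simp add: dual_component_def)
  from car obtain p where p: "p \<in> carrier (free_algebra (Omega_gens I))" "to_dual p = \<phi>" by (rule to_dual_surj)
  \<comment> \<open>The degree \<open>n\<close> part of an arbitrary preimage. On forests of degree
    \<open>n\<close> the discarded words vanish, and on all other forests both \<open>q\<close> and
    \<open>\<phi>\<close> do.\<close>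
  define q where "q = frag_extend (\<lambda>w. if int (length w) = n then frag_of w else 0) p"
  have q: "q \<in> free_component (Omega_gens I) n"
  proof -
    have "Poly_Mapping.keys q \<subseteq> {w \<in> lists (Omega_gens I). int (length w) = n}"
      unfolding q_def by (rule frag_extend_in) (use p(1) in \<open>auto simp: free_algebra_def\<close>)
    then show ?thesis by (simp add: free_component_def)
  qed
  have "to_dual q = \<phi>"
    using to_dual_carrier car
  proof (rule dual_carrier_eqI)
    fix x assume x: "x \<in> oriented_forests I"
    show "to_dual q (forest_class I (frag_of x)) = \<phi> (forest_class I (frag_of x))"
    proof (cases "oforest_degree I x = n")
      case False
      with pairing_free_component[OF q] dual_component_iff[OF car] \<phi> x show ?thesis by (simp add: to_dual_class)
    next
      case True
      have "pairing q x = frag_lin (\<lambda>w. frag_lin (\<lambda>w. word_pairing w x) (if int (length w) = n then frag_of w else 0)) p"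
        unfolding pairing_def q_def by (rule frag_lin_frag_extend)
      also have "\<dots> = frag_lin (\<lambda>w. word_pairing w x) p"
      proof (rule frag_lin_cong)
        fix w
        have "frag_of w \<in> free_component (Omega_gens I) (int (length w))" if "w \<in> Poly_Mapping.keys p"
          using that p(1) by (auto simp: free_component_def free_algebra_def)
        moreover assume "w \<in> Poly_Mapping.keys p"
        ultimately show "frag_lin (\<lambda>w. word_pairing w x) (if int (length w) = n then frag_of w else 0) = word_pairing w x"
          using pairing_free_component[of "frag_of w" "int (length w)" x] True by (auto simp: pairing_def)
      qed
      finally have "pairing q x = pairing p x" by (simp add: pairing_def)
      with x show ?thesis by (simp add: to_dual_class flip: p(2))
    qed
  qed
  with q show "\<phi> \<in> to_dual ` free_component (Omega_gens I) n" by blast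
qed

end

theorem theorem3:
  fixes I :: "'a set"
  assumes "finite I"
  shows "\<exists>h. h \<in> ring_iso (dual_algebra I) (Omega_algebra I) \<and>
             (\<forall>n::int. h ` dual_component I n = Omega_component I n)"
proof -
  interpret finite_ground I by unfold_locales (fact assms)
  let ?R = "free_algebra (Omega_gens I)"
  \<comment> \<open>The map induced on cosets by the pairing, in the form in which the homomorphism
    theorem for rings delivers it.\<close>
  define g where "g = (\<lambda>X. the_elem (to_dual ` X))"
  have iso: "g \<in> ring_iso (Omega_algebra I) (dual_algebra I)"
    using ring_hom_ring.FactRing_iso_set[OF ring_hom_ring_to_dual] to_dual_carrier to_dual_surj
    unfolding g_def kernel_eq Omega_algebra_def presented_algebra_def by blast
  have g_coset: "g (A.J +>\<^bsub>?R\<^esub> p) = to_dual p" if "p \<in> carrier ?R" for p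
    using ring_hom_ring.the_elem_simp[OF ring_hom_ring_to_dual that] by (simp add: g_def kernel_eq)
  have comp: "free_component (Omega_gens I) n \<subseteq> carrier ?R" for n
    by (auto simp: free_component_def free_algebra_def)
  have g_comp: "g ` Omega_component I n = dual_component I n" for n
  proof -
    have "g ` Omega_component I n = (\<lambda>p. g (A.J +>\<^bsub>?R\<^esub> p)) ` free_component (Omega_gens I) n"
      by (simp add: Omega_component_def presented_component_def image_image)
    also have "\<dots> = to_dual ` free_component (Omega_gens I) n"
      using comp g_coset by (intro image_cong) auto
    finally show ?thesis by (simp add: to_dual_free_component)
  qed
  have carrier: "Omega_component I n \<subseteq> carrier (Omega_algebra I)" for n
    using comp by (auto simp: Omega_component_def presented_component_def Omega_algebra_def
        presented_algebra_def FactRing_def A_RCOSETS_def' subset_iff)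
  \<comment> \<open>The inverse is taken on the carrier only, so components can be carried back once
    they are known to lie in the carrier.\<close>
  define h where "h = inv_into (carrier (Omega_algebra I)) g"
  have "ring (Omega_algebra I)"
    unfolding Omega_algebra_def presented_algebra_def using A.ideal_J by (rule ideal.quotient_is_ring)
  from ring_iso_set_sym[OF this iso] have "h \<in> ring_iso (dual_algebra I) (Omega_algebra I)"
    by (simp add: h_def)
  moreover have "h ` dual_component I n = Omega_component I n" for n
  proof -
    have "inj_on g (carrier (Omega_algebra I))" using iso by (auto simp: ring_iso_def bij_betw_def)
    from inv_into_image_cancel[OF this carrier] show ?thesis by (simp add: h_def flip: g_comp)
  qed
  ultimately show ?thesis by blast
qed

end
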